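(* Let $\{q_n\}_{n\ge0}$ be a non-increasing sequence of real numbers with $q_n\ge0$ and $Q_n:=\sum_{k=0}^nq_k>0$ for every $n$. For $f\in L_1(\mathbb{I})$ and $n\in\mathbb{P}$ let $$\mathcal{T}_n^{\mathbb{Q}}(f;x):=\frac1{Q_n}\sum_{k=1}^nq_{n-k}\,S_k(f;x)$$ be the Nörlund means of the Walsh--Fourier series of $f$. Then: (a1) If $$\sup_{n\in\mathbb{P}}\Bigl(\frac1{Q_{2^{|n|}}}\sum_{s=0}^{|n|}Q_{2^s}\Bigr)<\infty,$$ then for every $f\in L_1(\mathbb{I})$, $\mathcal{T}_n^{\mathbb{Q}}(f)\to f$ almost everywhere on $\mathbb{I}$ as $n\to\infty$. (b1) If $$\sup_{n\in\mathbb{P}}\Bigl(\frac1{Q_{2^{|n|}}}\sum_{s=0}^{|n|}Q_{2^s}\Bigr)=\infty,$$ then there exists a function $f\in L_1(\mathbb{I})$ such that the sequence $\{\mathcal{T}_n^{\mathbb{Q}}(f;x)\}_{n\ge1}$ diverges at every point $x\in\mathbb{I}$.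
   Context: $\mathbb{P}=\{1,2,\dots\}$, $\mathbb{N}=\mathbb{P}\cup\{0\}$, $\mathbb{I}=[0,1)$ with Lebesgue measure. For $n\in\mathbb{N}$ write $n=\sum_{j\ge0}\varepsilon_j(n)2^j$ with $\varepsilon_j(n)\in\{0,1\}$; for $n\in\mathbb{P}$, $|n|:=\max\{s:\varepsilon_s(n)=1\}$. Each $x\in\mathbb{I}$ is written $x=\sum_{j\ge0}x_j2^{-(j+1)}$, $x_j\in\{0,1\}$ (terminating expansion for dyadic rationals); $r_k(x)=(-1)^{x_k}$ and $w_n=\prod_{k\ge0}r_k^{\varepsilon_k(n)}$ is the Walsh--Paley system. For $f\in L_1(\mathbb{I})$, $\widehat f(k)=\int_{\mathbb{I}}fw_k$ and $S_n(f;x)=\sum_{k=0}^{n-1}\widehat f(k)w_k(x)$. *)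

theory Defs
  imports "HOL-Analysis.Analysis"
begin

abbreviation unit_measure :: "real measure" where
  "unit_measure \<equiv> lebesgue_on {0..<1}"

definition binary_order :: "nat \<Rightarrow> nat" where
  "binary_order n = Max {s. bit n s}"

text \<open>For \<open>x \<in> [0,1)\<close>, \<open>dyadic_digit j x\<close> is the coefficient of \<open>2 powr - (j + 1)\<close> in the
  binary expansion of \<open>x\<close>, the terminating one if \<open>x\<close> is a dyadic rational; see the lemmas
  \<open>dyadic_digit_sums\<close> and \<open>dyadic_digit_terminates\<close> below.\<close>

definition dyadic_digit :: "nat \<Rightarrow> real \<Rightarrow> nat" where
  "dyadic_digit j x = nat (\<lfloor>2 ^ (j + 1) * x\<rfloor> mod 2)"

definition rademacher :: "nat \<Rightarrow> real \<Rightarrow> real" where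
  "rademacher k x = (- 1) ^ dyadic_digit k x"

definition walsh :: "nat \<Rightarrow> real \<Rightarrow> real" where
  "walsh n x = (\<Prod>k\<in>{k. bit n k}. rademacher k x)"

definition walsh_coeff :: "(real \<Rightarrow> real) \<Rightarrow> nat \<Rightarrow> real" where
  "walsh_coeff f k = (LINT x|unit_measure. f x * walsh k x)"

definition walsh_partial_sum :: "(real \<Rightarrow> real) \<Rightarrow> nat \<Rightarrow> real \<Rightarrow> real" where
  "walsh_partial_sum f n x = (\<Sum>k<n. walsh_coeff f k * walsh k x)"

definition weight_sum :: "(nat \<Rightarrow> real) \<Rightarrow> nat \<Rightarrow> real" where
  "weight_sum q n = (\<Sum>k\<le>n. q k)"

definition norlund_mean :: "(nat \<Rightarrow> real) \<Rightarrow> (real \<Rightarrow> real) \<Rightarrow> nat \<Rightarrow> real \<Rightarrow> real" where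
  "norlund_mean q f n x =
     1 / weight_sum q n * (\<Sum>k=1..n. q (n - k) * walsh_partial_sum f k x)"

text \<open>The index set of the product defining \<open>walsh\<close> (and of the maximum defining
  \<open>binary_order\<close>) is finite, so neither takes a default value there.\<close>

lemma finite_bits: "finite {k. bit (n::nat) k}"
proof (rule finite_subset)
  show "{k. bit n k} \<subseteq> {..n}"
  proof
    fix k assume "k \<in> {k. bit n k}"
    then have "n div 2 ^ k \<noteq> 0"
      by (metis bit_iff_odd even_zero mem_Collect_eq)
    then have "2 ^ k \<le> n"
      by (simp add: div_eq_0_iff)
    then show "k \<in> {..n}"
      using less_exp[of k] unfolding atMost_iff by linarith
  qed
qed simp

lemma dyadic_digit_less_2: "dyadic_digit j x < 2"
  by (simp add: dyadic_digit_def nat_less_iff)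

lemma dyadic_digit_partial_sum:
  assumes "0 \<le> x" "x < 1"
  shows "(\<Sum>j<n. real (dyadic_digit j x) / 2 ^ (j + 1)) = real_of_int \<lfloor>2 ^ n * x\<rfloor> / 2 ^ n"
proof (induction n)
  case 0
  then show ?case using assms by (simp add: floor_eq_iff)
next
  case (Suc n)
  define m where "m = \<lfloor>2 ^ Suc n * x\<rfloor>"
  have "m div 2 = \<lfloor>2 ^ n * x\<rfloor>"
    using floor_divide_real_eq_div[of 2 "2 ^ Suc n * x"] by (simp add: m_def)
  moreover have "real_of_int m = 2 * real_of_int (m div 2) + real_of_int (m mod 2)"
    by (metis mult_div_mod_eq of_int_add of_int_mult of_int_numeral)
  moreover have "real (dyadic_digit n x) = real_of_int (m mod 2)"
    by (simp add: dyadic_digit_def m_def)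
  ultimately show ?case
    using Suc.IH unfolding sum.lessThan_Suc m_def[symmetric] by (simp add: field_simps)
qed

lemma dyadic_digit_sums:
  assumes "0 \<le> x" "x < 1"
  shows "(\<lambda>j. real (dyadic_digit j x) / 2 ^ (j + 1)) sums x"
proof -
  have "(\<lambda>n. real_of_int \<lfloor>2 ^ n * x\<rfloor> / 2 ^ n) \<longlonglongrightarrow> x"
  proof (rule real_tendsto_sandwich)
    show "\<forall>\<^sub>F n in sequentially. x - (1/2) ^ n \<le> real_of_int \<lfloor>2 ^ n * x\<rfloor> / 2 ^ n"
    proof (intro always_eventually allI)
      fix n
      have "2 ^ n * x - 1 \<le> real_of_int \<lfloor>2 ^ n * x\<rfloor>" by linarith
      then show "x - (1/2) ^ n \<le> real_of_int \<lfloor>2 ^ n * x\<rfloor> / 2 ^ n"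
        by (simp add: power_one_over diff_le_eq pos_le_divide_eq
            pos_divide_le_eq mult.commute add.commute flip: add_divide_distrib)
    qed
    show "\<forall>\<^sub>F n in sequentially. real_of_int \<lfloor>2 ^ n * x\<rfloor> / 2 ^ n \<le> x"
    proof (intro always_eventually allI)
      fix n
      have "real_of_int \<lfloor>2 ^ n * x\<rfloor> \<le> 2 ^ n * x" by linarith
      then show "real_of_int \<lfloor>2 ^ n * x\<rfloor> / 2 ^ n \<le> x"
        by (simp add: field_simps)
    qed
    have "(\<lambda>n. x - (1/2) ^ n) \<longlonglongrightarrow> x - 0"
      by (intro tendsto_intros LIMSEQ_power_zero) auto
    then show "(\<lambda>n. x - (1/2) ^ n) \<longlonglongrightarrow> x" by simp
  qed simp
  then show ?thesis
    by (simp only: sums_def dyadic_digit_partial_sum[OF assms])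
qed

lemma dyadic_digit_terminates:
  assumes "x = real_of_int m / 2 ^ n" "n \<le> j"
  shows "dyadic_digit j x = 0"
proof -
  have "(2::real) ^ (j + 1) = 2 ^ n * 2 * 2 ^ (j - n)"
    using assms(2) by (metis Suc_eq_plus1 le_add_diff_inverse mult.assoc mult.commute power_Suc power_add)
  then have "2 ^ (j + 1) * x = real_of_int (2 * (2 ^ (j - n) * m))"
    using assms(1) by (simp add: field_simps)
  then have "\<lfloor>2 ^ (j + 1) * x\<rfloor> = 2 * (2 ^ (j - n) * m)"
    by (metis floor_of_int)
  then show ?thesis
    by (simp add: dyadic_digit_def)
qed

end

theory Submission
  imports Defs
begin

text \<open>
  The kernel of a Noerlund mean at the points \<open>x\<close> and \<open>t\<close> depends only on the sequence of signs
  \<open>\<rho> k = rademacher k x * rademacher k t\<close>, and its analysis is carried out for arbitrary sequences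
  of signs. Write \<open>Q\<close> for \<open>weight_sum q\<close>.

  Convergence. If the first two entries \<open>-1\<close> of \<open>\<rho>\<close> stand at \<open>j < i\<close>, every Dirichlet kernel is bounded
  by \<open>2 ^ j\<close>, and the sum of the Dirichlet kernels over each aligned block of length \<open>2 ^ (i + 1)\<close>
  vanishes. Abel summation with the monotone weights then bounds the unnormalized Noerlund kernel by
  \<open>6 * 2 ^ j * Q (2 ^ i)\<close>, uniformly in \<open>n\<close> (\<open>abs_kernel_two_signs\<close>). Therefore the modulus of the mean of
  order \<open>n\<close>, with \<open>2 ^ N \<le> n < 2 ^ (N + 1)\<close>, is at most a constant times the sum of the
  \<open>Q (2 ^ s) / Q n * near_mass f s x\<close> with \<open>s \<le> N + 1\<close>, where \<open>near_mass f s x\<close> is a weighted sum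
  of the masses of \<open>\<bar>f\<bar>\<close> on the cells of rank \<open>s\<close> that contain \<open>x\<close> after at most one digit has been
  flipped. The hypothesis bounds the total weight. The supremum of \<open>near_mass f s x\<close> over \<open>s\<close> is of weak type (1,1)
  (\<open>near_mass_weak_type\<close>), by a stopping time argument. As the means converge for Walsh polynomials,
  which are dense, they converge almost everywhere for every integrable function.

  Divergence. If the supremum is infinite, then for every \<open>H\<close> and \<open>e > 0\<close> there is \<open>L\<close> such that
  \<open>Q\<close> grows at most by the factor \<open>1 + e\<close> from \<open>2 ^ L\<close> to \<open>2 ^ (L + H)\<close> (\<open>ex_slow_window\<close>). For the dilation
  \<open>P x = p (frac (2 ^ L * x))\<close> of a Walsh polynomial \<open>p\<close> the partial sums of \<open>P\<close> are constant on blocks of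
  orders of length \<open>2 ^ L\<close>, so in such a window the mean of \<open>P\<close> of order \<open>2 ^ L * h\<close> is nearly a multiple of
  the partial sum of \<open>p\<close> of order \<open>h\<close> (\<open>norlund_mean_dilate_ge\<close>). This reduces everything to ordinary
  Walsh partial sums, for which a construction in the manner of Kolmogorov works
  (\<open>ex_walsh_poly_large_partial_sums\<close>): \<open>p\<close> is a mean of approximate point masses, one in each cell of
  rank \<open>m\<close>, and each mass has a digit of its own, by which the order \<open>h\<close> adjusts the sign of its
  contribution. For each \<open>x\<close> some \<open>h\<close> gives all contributions to the partial sum at \<open>x\<close> the same sign.
  Those from outside the cell of \<open>x\<close> are in modulus values of one Dirichlet kernel and add up to at
  least \<open>m / 6\<close>, a lower bound for its Lebesgue constant. A gliding hump combines such
  polynomials into one function with unbounded means at every point.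
\<close>

section \<open>Characters and Dirichlet kernels of a sign sequence\<close>

text \<open>For \<open>\<rho> = (\<lambda>k. rademacher k x)\<close> this is \<open>walsh n x\<close>, and for the product of the sign
  sequences of \<open>x\<close> and \<open>t\<close> it is \<open>walsh n x * walsh n t\<close>. Sequences of signs thus replace dyadic
  addition of points.\<close>

definition walsh_char :: "(nat \<Rightarrow> real) \<Rightarrow> nat \<Rightarrow> real" where
  "walsh_char \<rho> n = (\<Prod>k\<in>{k. bit n k}. \<rho> k)"

definition dirichlet :: "(nat \<Rightarrow> real) \<Rightarrow> nat \<Rightarrow> real" where
  "dirichlet \<rho> n = (\<Sum>k<n. walsh_char \<rho> k)"

definition sign_seq :: "(nat \<Rightarrow> real) \<Rightarrow> bool" where
  "sign_seq \<rho> \<longleftrightarrow> (\<forall>k. \<rho> k = 1 \<or> \<rho> k = -1)"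

lemma walsh_char_0 [simp]: "walsh_char \<rho> 0 = 1"
  by (simp add: walsh_char_def)

lemma walsh_char_mult:
  "walsh_char (\<lambda>k. \<rho> k * \<sigma> k) n = walsh_char \<rho> n * walsh_char \<sigma> n"
  by (simp add: walsh_char_def prod.distrib)

lemma walsh_char_cong:
  assumes "\<And>k. bit n k \<Longrightarrow> \<rho> k = \<sigma> k"
  shows "walsh_char \<rho> n = walsh_char \<sigma> n"
  unfolding walsh_char_def using assms by (intro prod.cong) auto

lemma bit_less_exp: "n < 2 ^ s \<Longrightarrow> bit (n::nat) k \<Longrightarrow> k < s"
  by (metis bit_take_bit_iff take_bit_nat_eq_self)

lemma abs_walsh_char:
  assumes "sign_seq \<rho>"
  shows "\<bar>walsh_char \<rho> n\<bar> = 1"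
proof -
  have "\<bar>\<rho> k\<bar> = 1" for k
    using assms unfolding sign_seq_def by (metis abs_1 abs_minus_cancel)
  then show ?thesis by (simp add: walsh_char_def abs_prod)
qed

lemma bit_block:
  assumes "b < 2 ^ s"
  shows "bit (2 ^ s * c + b :: nat) k \<longleftrightarrow> (if k < s then bit b k else bit c (k - s))"
proof -
  have "2 ^ s * c = push_bit s c" by (simp add: push_bit_eq_mult mult.commute)
  moreover have "push_bit s c + b = or (push_bit s c) b"
    using bit_less_exp[OF assms] by (intro disjunctive_add) (fastforce simp: bit_push_bit_iff)
  ultimately have "2 ^ s * c + b = or (push_bit s c) b" by simp
  then show ?thesis
    using bit_less_exp[OF assms] by (auto simp: bit_or_iff bit_push_bit_iff)
qed

lemma walsh_char_block:
  assumes "b < 2 ^ s"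
  shows "walsh_char \<rho> (2 ^ s * c + b) = walsh_char \<rho> (2 ^ s * c) * walsh_char \<rho> b"
proof -
  have "{k. bit (2 ^ s * c + b) k} = {k. bit (2 ^ s * c) k} \<union> {k. bit b k}"
    using bit_block[OF assms, of c] bit_block[of 0 s c] bit_less_exp[OF assms] by auto
  moreover have "{k. bit (2 ^ s * c) k} \<inter> {k. bit b k} = {}"
    using bit_block[of 0 s c] bit_less_exp[OF assms] by auto
  ultimately show ?thesis
    unfolding walsh_char_def by (simp add: prod.union_disjoint finite_bits)
qed

lemma walsh_char_shift:
  "walsh_char \<rho> (2 ^ s * c) = walsh_char (\<lambda>k. \<rho> (k + s)) c"
proof -
  have "{k. bit (2 ^ s * c) k} = (\<lambda>k. k + s) ` {k. bit c k}"
    using bit_block[of 0 s c] by (auto simp: image_iff) (metis le_add_diff_inverse2 not_less)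
  then show ?thesis
    unfolding walsh_char_def by (simp add: prod.reindex inj_on_def)
qed

lemma walsh_char_exp [simp]: "walsh_char \<rho> (2 ^ s) = \<rho> s"
  using walsh_char_shift[of \<rho> s 1] by (simp add: walsh_char_def bit_1_iff flip: One_nat_def)

text \<open>The self-similarity of the Walsh-Paley ordering: adding a multiple of \<open>2 ^ s\<close> to an
  order below \<open>2 ^ s\<close> does not interfere with its binary digits.\<close>

lemma dirichlet_block:
  assumes "b \<le> 2 ^ s"
  shows "dirichlet \<rho> (2 ^ s * c + b) =
    dirichlet \<rho> (2 ^ s * c) + walsh_char \<rho> (2 ^ s * c) * dirichlet \<rho> b"
proof -
  have "dirichlet \<rho> (2 ^ s * c + b) =
    dirichlet \<rho> (2 ^ s * c) + (\<Sum>k<b. walsh_char \<rho> (2 ^ s * c + k))"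
    unfolding dirichlet_def by (induction b) auto
  also have "(\<Sum>k<b. walsh_char \<rho> (2 ^ s * c + k)) = (\<Sum>k<b. walsh_char \<rho> (2 ^ s * c) * walsh_char \<rho> k)"
    using assms by (intro sum.cong) (auto simp: walsh_char_block)
  finally show ?thesis by (simp add: dirichlet_def sum_distrib_left)
qed

lemma dirichlet_exp: "dirichlet \<rho> (2 ^ s) = (\<Prod>k<s. 1 + \<rho> k)"
proof (induction s)
  case 0
  then show ?case by (simp add: dirichlet_def)
next
  case (Suc s)
  have "dirichlet \<rho> (2 ^ Suc s) = dirichlet \<rho> (2 ^ s * 1 + 2 ^ s)"
    by (simp add: mult_2)
  also have "\<dots> = dirichlet \<rho> (2 ^ s) + \<rho> s * dirichlet \<rho> (2 ^ s)"
    by (subst dirichlet_block) auto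
  finally show ?case using Suc by (simp add: algebra_simps)
qed

lemma dirichlet_multiple:
  assumes "\<rho> j = -1" "j < s"
  shows "dirichlet \<rho> (2 ^ s * c) = 0"
proof (induction c)
  case 0
  then show ?case by (simp add: dirichlet_def)
next
  case (Suc c)
  have "dirichlet \<rho> (2 ^ s) = 0"
    unfolding dirichlet_exp using assms by (intro prod_zero) (auto intro!: bexI[of _ j])
  moreover have "2 ^ s * Suc c = 2 ^ s * c + 2 ^ s" by simp
  ultimately show ?case using Suc dirichlet_block[of "2^s" s \<rho> c] by (simp del: mult_Suc_right)
qed

lemma dirichlet_split:
  assumes "\<rho> j = -1" "j < s"
  shows "dirichlet \<rho> n = walsh_char \<rho> (2 ^ s * (n div 2 ^ s)) * dirichlet \<rho> (n mod 2 ^ s)"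
proof -
  have "dirichlet \<rho> (2 ^ s * (n div 2 ^ s) + n mod 2 ^ s) =
      walsh_char \<rho> (2 ^ s * (n div 2 ^ s)) * dirichlet \<rho> (n mod 2 ^ s)"
    using dirichlet_block[of "n mod 2^s" s \<rho> "n div 2^s"] dirichlet_multiple[of \<rho> j s "n div 2^s"] assms
    by (simp add: less_imp_le)
  then show ?thesis by (simp only: mult_div_mod_eq)
qed

lemma abs_dirichlet_le:
  assumes "sign_seq \<rho>"
  shows "\<bar>dirichlet \<rho> n\<bar> \<le> n"
proof -
  have "\<bar>dirichlet \<rho> n\<bar> \<le> (\<Sum>k<n. \<bar>walsh_char \<rho> k\<bar>)"
    unfolding dirichlet_def by (rule sum_abs)
  then show ?thesis by (simp add: abs_walsh_char[OF assms])
qed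

lemma walsh_char_initial:
  assumes "\<And>k. k < j \<Longrightarrow> \<rho> k = 1" "n < 2 ^ j"
  shows "walsh_char \<rho> n = 1"
  using assms(1) bit_less_exp[OF assms(2)] unfolding walsh_char_def by (intro prod.neutral) auto

lemma dirichlet_initial:
  assumes "\<And>k. k < j \<Longrightarrow> \<rho> k = 1" "n \<le> 2 ^ j"
  shows "dirichlet \<rho> n = n"
proof -
  have "walsh_char \<rho> k = 1" if "k < n" for k
    using that assms(2) by (intro walsh_char_initial[OF assms(1)]) auto
  then show ?thesis by (simp add: dirichlet_def)
qed

text \<open>If the first \<open>-1\<close> stands at \<open>j\<close>, the characters of order below \<open>2 ^ j\<close> equal \<open>1\<close> and
  those of order between \<open>2 ^ j\<close> and \<open>2 ^ (j + 1)\<close> equal \<open>-1\<close>. So the kernel grows with slope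
  one up to \<open>2 ^ j\<close> and falls back to zero: it is a tent with its peak at \<open>2 ^ j\<close>.\<close>

lemma dirichlet_tent:
  assumes init: "\<And>k. k < j \<Longrightarrow> \<rho> k = 1" and j: "\<rho> j = -1" and b: "b < 2 ^ Suc j"
  shows "dirichlet \<rho> b = 2 ^ j - \<bar>2 ^ j - real b\<bar>"
proof (cases "b \<le> 2 ^ j")
  case True
  then have "real b \<le> real (2 ^ j)" by (rule of_nat_mono)
  then show ?thesis using dirichlet_initial[OF init True] by simp
next
  case False
  define b' where "b' = b - 2 ^ j"
  have b': "b = 2 ^ j * 1 + b'" "b' \<le> 2 ^ j" using False b by (auto simp: b'_def)
  have "dirichlet \<rho> b = 2 ^ j - real b'"
    unfolding b'(1) using b'(2) dirichlet_initial[of j \<rho> "2^j", OF init] dirichlet_initial[of j \<rho> b', OF init]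
    by (subst dirichlet_block) (auto simp: j)
  moreover have "real b = 2 ^ j + real b'" using b'(1) by simp
  ultimately show ?thesis by simp
qed

text \<open>Higher digits of \<open>n\<close> change the kernel only by a sign, which makes the modulus periodic
  in \<open>n\<close>.\<close>

lemma abs_dirichlet_tent:
  assumes "sign_seq \<rho>" "\<And>k. k < j \<Longrightarrow> \<rho> k = 1" "\<rho> j = -1"
  shows "\<bar>dirichlet \<rho> n\<bar> = 2 ^ j - \<bar>2 ^ j - real (n mod 2 ^ Suc j)\<bar>"
proof -
  define b where "b = n mod 2 ^ Suc j"
  have b: "b < 2 ^ Suc j" by (simp add: b_def)
  then have "b \<le> 2 * 2 ^ j" by simp
  then have "real b \<le> real (2 * 2 ^ j)" by (rule of_nat_mono)
  then have "0 \<le> 2 ^ j - \<bar>2 ^ j - real b\<bar>" by simp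
  moreover have "\<bar>dirichlet \<rho> n\<bar> = \<bar>dirichlet \<rho> b\<bar>"
    using dirichlet_split[of \<rho> j "Suc j" n, OF assms(3)] abs_walsh_char[OF assms(1)]
    by (simp add: abs_mult b_def)
  ultimately show ?thesis using dirichlet_tent[of j \<rho> b, OF assms(2,3) b] by (simp add: b_def)
qed

lemma abs_dirichlet_le_exp:
  assumes "sign_seq \<rho>" "\<rho> j = -1"
  shows "\<bar>dirichlet \<rho> n\<bar> \<le> 2 ^ j"
proof -
  define i where "i = (LEAST i. \<rho> i = -1)"
  have i: "\<rho> i = -1" unfolding i_def using assms(2) by (rule LeastI)
  have ij: "i \<le> j" unfolding i_def using assms(2) by (rule Least_le)
  have "\<rho> k = 1" if "k < i" for k
    using not_less_Least[OF that[unfolded i_def]] assms(1) by (auto simp: sign_seq_def)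
  then have "\<bar>dirichlet \<rho> n\<bar> \<le> 2 ^ i"
    using abs_dirichlet_tent[OF assms(1) _ i, of n] by simp
  also have "(2::real) ^ i \<le> 2 ^ j" using ij by (intro power_increasing) auto
  finally show ?thesis .
qed

lemma sum_lessThan_add:
  fixes f :: "nat \<Rightarrow> real"
  shows "(\<Sum>k<m + n. f k) = (\<Sum>k<m. f k) + (\<Sum>k<n. f (m + k))"
  by (induction n) auto

text \<open>Passing from \<open>k < 2 ^ i\<close> to \<open>2 ^ i + k\<close> multiplies the character by \<open>\<rho> i = -1\<close>, and
  \<open>D (2 ^ i) = 0\<close> because of the \<open>-1\<close> at \<open>j < i\<close>. Hence the two halves of every block of length
  \<open>2 ^ (i + 1)\<close> cancel. This second cancellation is what makes Abel summation effective.\<close>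

lemma sum_dirichlet_multiple:
  assumes "\<rho> j = -1" "\<rho> i = -1" "j < i"
  shows "(\<Sum>k<2 ^ Suc i * c. dirichlet \<rho> k) = 0"
proof (induction c)
  case 0
  then show ?case by simp
next
  case (Suc c)
  define w where "w = walsh_char \<rho> (2 ^ Suc i * c)"
  have "(\<Sum>k<2 ^ Suc i. dirichlet \<rho> (2 ^ Suc i * c + k)) = (\<Sum>k<2 ^ Suc i. w * dirichlet \<rho> k)"
    using dirichlet_multiple[of \<rho> j "Suc i" c] assms(1,3)
    by (intro sum.cong) (auto simp del: power_Suc simp: dirichlet_block w_def)
  also have "\<dots> = w * ((\<Sum>k<2 ^ i. dirichlet \<rho> k) + (\<Sum>k<2 ^ i. dirichlet \<rho> (2 ^ i * 1 + k)))"
    using sum_lessThan_add[of "dirichlet \<rho>" "2 ^ i" "2 ^ i"] by (simp add: mult_2 flip: sum_distrib_left)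
  also have "(\<Sum>k<2 ^ i. dirichlet \<rho> (2 ^ i * 1 + k)) = (\<Sum>k<2 ^ i. - dirichlet \<rho> k)"
  proof (intro sum.cong refl)
    fix k assume "k \<in> {..<2 ^ i :: nat}"
    then show "dirichlet \<rho> (2 ^ i * 1 + k) = - dirichlet \<rho> k"
      using dirichlet_multiple[of \<rho> j i 1] assms(1,3) by (subst dirichlet_block) (auto simp: assms(2))
  qed
  finally show ?case
    using Suc sum_lessThan_add[of "dirichlet \<rho>" "2 ^ Suc i * c" "2 ^ Suc i"]
    by (simp add: sum_negf add.commute del: power_Suc)
qed

lemma abs_sum_dirichlet_le:
  assumes "sign_seq \<rho>" "\<rho> j = -1" "\<rho> i = -1" "j < i"
  shows "\<bar>\<Sum>k<n. dirichlet \<rho> k\<bar> \<le> 2 ^ Suc i * 2 ^ j"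
proof -
  define c where "c = n div 2 ^ Suc i"
  have "n = 2 ^ Suc i * c + n mod 2 ^ Suc i" by (simp add: c_def)
  then have "(\<Sum>k<n. dirichlet \<rho> k) = (\<Sum>k<n mod 2 ^ Suc i. dirichlet \<rho> (2 ^ Suc i * c + k))"
    using sum_lessThan_add[of "dirichlet \<rho>" "2 ^ Suc i * c" "n mod 2 ^ Suc i"] sum_dirichlet_multiple[OF assms(2-4), of c]
    by (metis add_0)
  also have "\<bar>\<dots>\<bar> \<le> (\<Sum>k<n mod 2 ^ Suc i. 2 ^ j)"
    by (intro order.trans[OF sum_abs] sum_mono abs_dirichlet_le_exp assms)
  also have "\<dots> = real (n mod 2 ^ Suc i) * 2 ^ j" by simp
  also have "\<dots> \<le> 2 ^ Suc i * 2 ^ j"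
  proof (intro mult_right_mono)
    have "n mod 2 ^ Suc i \<le> 2 ^ Suc i" by (simp add: less_imp_le)
    then show "real (n mod 2 ^ Suc i) \<le> 2 ^ Suc i" by (metis of_nat_le_iff of_nat_numeral of_nat_power)
  qed simp
  finally show ?thesis .
qed

lemma abel_inequality:
  fixes q b :: "nat \<Rightarrow> real"
  assumes "decseq q" "\<And>n. q n \<ge> 0" "\<And>r. \<bar>\<Sum>l<r. b l\<bar> \<le> B"
  shows "\<bar>\<Sum>l<n. q l * b l\<bar> \<le> q 0 * B"
proof -
  define G where "G r = (\<Sum>l<r. b l)" for r
  have B0: "B \<ge> 0" using assms(3)[of 0] by simp
  have *: "(\<Sum>l<n. q l * b l) = q n * G n + (\<Sum>l<n. (q l - q (Suc l)) * G (Suc l))"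
    by (induction n) (auto simp: G_def algebra_simps)
  have "\<bar>\<Sum>l<n. q l * b l\<bar> \<le> q n * B + (\<Sum>l<n. (q l - q (Suc l)) * B)"
    unfolding * using assms decseq_SucD[OF assms(1)]
    by (intro order.trans[OF abs_triangle_ineq] add_mono order.trans[OF sum_abs] sum_mono)
       (auto simp: abs_mult G_def simp del: sum.lessThan_Suc intro!: mult_left_mono)
  also have "\<dots> = q 0 * B"
    by (induction n) (auto simp: algebra_simps)
  finally show ?thesis .
qed

section \<open>The kernel of the Noerlund means\<close>

definition norlund_kernel :: "(nat \<Rightarrow> real) \<Rightarrow> nat \<Rightarrow> (nat \<Rightarrow> real) \<Rightarrow> real" where
  "norlund_kernel q n \<rho> = (\<Sum>k=1..n. q (n - k) * dirichlet \<rho> k)"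

locale norlund_weights =
  fixes q :: "nat \<Rightarrow> real"
  assumes q_dec: "decseq q" and q_nonneg: "\<And>n. q n \<ge> 0" and weight_pos: "\<And>n. weight_sum q n > 0"
begin

lemma weight_mono: "m \<le> n \<Longrightarrow> weight_sum q m \<le> weight_sum q n"
  unfolding weight_sum_def using q_nonneg by (intro sum_mono2) auto

lemma sum_lessThan_weight: "(\<Sum>l<n. q l) \<le> weight_sum q n"
  unfolding weight_sum_def using q_nonneg by (intro sum_mono2) auto

text \<open>The second half of the weights is dominated by the first, as \<open>q\<close> decreases.\<close>

lemma weight_double: "weight_sum q (2 * n) \<le> 2 * weight_sum q n"
proof (induction n)
  case 0
  then show ?case by (simp add: weight_sum_def q_nonneg)
next
  case (Suc n)
  have "q (Suc (2 * n)) \<le> q (Suc n)" "q (Suc (Suc (2 * n))) \<le> q (Suc n)"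
    using decseqD[OF q_dec] by auto
  then show ?case using Suc by (simp add: weight_sum_def)
qed

lemma q_le_weight: "real (Suc n) * q n \<le> weight_sum q n"
proof -
  have "(\<Sum>k\<le>n. q n) \<le> weight_sum q n"
    unfolding weight_sum_def using decseqD[OF q_dec] by (intro sum_mono) auto
  then show ?thesis by simp
qed

lemma kernel_reverse: "norlund_kernel q n \<rho> = (\<Sum>l<n. q l * dirichlet \<rho> (n - l))"
  unfolding norlund_kernel_def
  by (rule sum.reindex_bij_witness[of _ "\<lambda>l. n - l" "\<lambda>k. n - k"]) auto

lemma abs_kernel_le:
  assumes "\<And>k. k \<le> n \<Longrightarrow> \<bar>dirichlet \<rho> k\<bar> \<le> B"
  shows "\<bar>norlund_kernel q n \<rho>\<bar> \<le> B * weight_sum q n"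
proof -
  have B: "B \<ge> 0" using assms[of 0] by simp
  have "\<bar>norlund_kernel q n \<rho>\<bar> \<le> (\<Sum>l<n. q l * B)"
    unfolding kernel_reverse using q_nonneg assms
    by (intro order.trans[OF sum_abs] sum_mono) (auto simp: abs_mult intro!: mult_left_mono)
  also have "\<dots> = B * (\<Sum>l<n. q l)" by (simp add: sum_distrib_left mult.commute[of _ B])
  finally show ?thesis using mult_left_mono[OF sum_lessThan_weight[of n] B] by linarith
qed

text \<open>The indices \<open>l < 2 ^ (i + 1)\<close> are estimated trivially by \<open>2 ^ j\<close> and contribute
  \<open>2 ^ j * Q (2 ^ (i + 1))\<close>. On the others Abel summation against the bounded sums of Dirichlet
  kernels costs \<open>q (2 ^ (i + 1))\<close> times \<open>2 ^ (i + 1) * 2 ^ j\<close>, and monotonicity of \<open>q\<close> bounds this by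
  a multiple of \<open>2 ^ j * Q (2 ^ (i + 1))\<close> again.\<close>

lemma abs_kernel_two_signs:
  assumes "sign_seq \<rho>" "\<rho> j = -1" "\<rho> i = -1" "j < i"
  shows "\<bar>norlund_kernel q n \<rho>\<bar> \<le> 6 * 2 ^ j * weight_sum q (2 ^ i)"
proof -
  \<comment> \<open>the threshold below which the trivial estimate is used\<close>
  define m where "m = min n (2 ^ Suc i)"
  have Q: "weight_sum q (2 ^ Suc i) \<le> 2 * weight_sum q (2 ^ i)"
    using weight_double[of "2 ^ i"] by simp
  have "n = m + (n - m)" by (simp add: m_def)
  then have "norlund_kernel q n \<rho> = (\<Sum>l<m. q l * dirichlet \<rho> (n - l)) + (\<Sum>l<n - m. q (m + l) * dirichlet \<rho> (n - (m + l)))"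
    unfolding kernel_reverse using sum_lessThan_add[of "\<lambda>l. q l * dirichlet \<rho> (n - l)" m "n - m"] by simp
  moreover have "\<bar>\<Sum>l<m. q l * dirichlet \<rho> (n - l)\<bar> \<le> 2 * 2 ^ j * weight_sum q (2 ^ i)"
  proof -
    have "\<bar>\<Sum>l<m. q l * dirichlet \<rho> (n - l)\<bar> \<le> (\<Sum>l<m. q l * 2 ^ j)"
      using q_nonneg abs_dirichlet_le_exp[OF assms(1,2)]
      by (intro order.trans[OF sum_abs] sum_mono) (auto simp: abs_mult intro!: mult_left_mono)
    also have "\<dots> = 2 ^ j * (\<Sum>l<m. q l)" by (simp add: sum_distrib_right mult.commute)
    also have "\<dots> \<le> 2 ^ j * (2 * weight_sum q (2 ^ i))"
      using sum_lessThan_weight[of m] weight_mono[of m "2 ^ Suc i"] Q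
      by (intro mult_left_mono) (auto simp: m_def)
    finally show ?thesis by simp
  qed
  moreover have "\<bar>\<Sum>l<n - m. q (m + l) * dirichlet \<rho> (n - (m + l))\<bar> \<le> 4 * 2 ^ j * weight_sum q (2 ^ i)"
  proof (cases "n \<le> 2 ^ Suc i")
    case True
    then show ?thesis using less_imp_le[OF weight_pos] by (simp add: m_def)
  next
    case False
    then have m: "m = 2 ^ Suc i" "m < n" by (auto simp: m_def)
    define b where "b l = (if l < n - m then dirichlet \<rho> (n - (m + l)) else 0)" for l
    have b: "\<bar>\<Sum>l<r. b l\<bar> \<le> 2 * (2 ^ Suc i * 2 ^ j)" for r
    proof -
      define r' where "r' = min r (n - m)"
      have "(\<Sum>l<r. b l) = (\<Sum>l<r'. b l)"
        by (rule sum.mono_neutral_right) (auto simp: b_def r'_def)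
      also have "\<dots> = (\<Sum>l<r'. dirichlet \<rho> (n - m - l))"
        by (intro sum.cong) (auto simp: b_def r'_def)
      also have "\<dots> = (\<Sum>k\<in>{n - m - r'<..n - m}. dirichlet \<rho> k)"
        by (rule sum.reindex_bij_witness[of _ "\<lambda>k. n - m - k" "\<lambda>l. n - m - l"]) (auto simp: r'_def)
      also have "\<dots> = (\<Sum>k<Suc (n - m). dirichlet \<rho> k) - (\<Sum>k<Suc (n - m - r'). dirichlet \<rho> k)"
        by (subst sum_diff[symmetric]) (auto intro!: sum.cong simp del: sum.lessThan_Suc sum.op_ivl_Suc)
      finally show ?thesis
        using abs_sum_dirichlet_le[OF assms, of "Suc (n - m)"] abs_sum_dirichlet_le[OF assms, of "Suc (n - m - r')"]
        by linarith
    qed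
    have "(\<Sum>l<n - m. q (m + l) * dirichlet \<rho> (n - (m + l))) = (\<Sum>l<n - m. q (m + l) * b l)"
      by (intro sum.cong) (auto simp: b_def)
    also have "\<bar>\<dots>\<bar> \<le> q (m + 0) * (2 * (2 ^ Suc i * 2 ^ j))"
      using q_dec q_nonneg b by (intro abel_inequality) (auto simp: decseq_def)
    also have "\<dots> = 2 * 2 ^ j * (real m * q m)" by (simp add: m)
    also have "\<dots> \<le> 2 * 2 ^ j * (2 * weight_sum q (2 ^ i))"
    proof (intro mult_left_mono)
      have "real m * q m \<le> weight_sum q m" using q_le_weight[of m] q_nonneg[of m] by (simp add: algebra_simps)
      then show "real m * q m \<le> 2 * weight_sum q (2 ^ i)" using Q m(1) by simp
    qed simp
    finally show ?thesis by simp
  qed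
  ultimately show ?thesis by (simp add: abs_if split: if_splits)
qed

end

section \<open>Dyadic cells and Walsh functions\<close>

definition cell_index :: "nat \<Rightarrow> real \<Rightarrow> nat" where
  "cell_index s x = nat \<lfloor>2 ^ s * x\<rfloor>"

definition cell :: "nat \<Rightarrow> nat \<Rightarrow> real set" where
  "cell s a = {real a / 2 ^ s ..< (real a + 1) / 2 ^ s}"

lemma cell_index_eq_iff:
  assumes "0 \<le> x"
  shows "cell_index s x = a \<longleftrightarrow> x \<in> cell s a"
proof -
  have "cell_index s x = a \<longleftrightarrow> \<lfloor>2 ^ s * x\<rfloor> = int a"
    using assms by (auto simp: cell_index_def nat_eq_iff)
  also have "\<dots> \<longleftrightarrow> x \<in> cell s a"
    by (auto simp: cell_def floor_eq_iff field_simps)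
  finally show ?thesis .
qed

lemma cell_index_less:
  assumes "x \<in> {0..<1}"
  shows "cell_index s x < 2 ^ s"
proof -
  have "2 ^ s * x < 2 ^ s" using assms by simp
  then have "\<lfloor>2 ^ s * x\<rfloor> < 2 ^ s" by (simp add: floor_less_iff)
  then show ?thesis using assms by (simp add: cell_index_def nat_less_iff)
qed

lemma cell_subset_unit:
  assumes "a < 2 ^ s"
  shows "cell s a \<subseteq> {0..<1}"
proof -
  have "a + 1 \<le> 2 ^ s" using assms by simp
  then have "real (a + 1) \<le> real (2 ^ s)" by (rule of_nat_mono)
  then have "(real a + 1) / 2 ^ s \<le> 1" by (simp add: add.commute)
  moreover have "0 \<le> real a / 2 ^ s" by simp
  ultimately show ?thesis unfolding cell_def by (simp add: ivl_subset)
qed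

lemma cell_index_coarser:
  assumes "0 \<le> x" "r \<le> s"
  shows "cell_index r x = cell_index s x div 2 ^ (s - r)"
proof -
  have "(2::real) ^ s = 2 ^ r * 2 ^ (s - r)" using assms(2) by (simp flip: power_add)
  then have "\<lfloor>2 ^ r * x\<rfloor> = \<lfloor>2 ^ s * x\<rfloor> div 2 ^ (s - r)"
    using floor_divide_real_eq_div[of "2 ^ (s - r)" "2 ^ s * x"] by simp
  then show ?thesis
    using assms by (simp add: cell_index_def nat_div_distrib nat_power_eq)
qed

text \<open>The value of \<open>rademacher k\<close> on the cell of rank \<open>s\<close> and index \<open>a\<close>, for \<open>k < s\<close>. The bits of
  \<open>a\<close> are the first \<open>s\<close> binary digits of the points of the cell in reversed order, since the
  leading digit of a point is the highest bit of the index.\<close>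

definition digit_sign :: "nat \<Rightarrow> nat \<Rightarrow> nat \<Rightarrow> real" where
  "digit_sign s a k = (if bit a (s - 1 - k) then - 1 else 1)"

lemma rademacher_eq_digit_sign:
  assumes "0 \<le> x" "k < s"
  shows "rademacher k x = digit_sign s (cell_index s x) k"
proof -
  have *: "dyadic_digit k x = cell_index (Suc k) x mod 2"
    using assms by (simp add: dyadic_digit_def cell_index_def nat_mod_distrib)
  have "cell_index (Suc k) x = cell_index s x div 2 ^ (s - 1 - k)"
    using cell_index_coarser[of x "Suc k" s] assms by simp
  then have "odd (dyadic_digit k x) \<longleftrightarrow> bit (cell_index s x) (s - 1 - k)"
    unfolding * by (simp add: bit_iff_odd)
  then show ?thesis by (auto simp: rademacher_def digit_sign_def)
qed

lemma sign_seq_rademacher: "sign_seq (\<lambda>k. rademacher k x)"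
  unfolding sign_seq_def rademacher_def by (auto simp: minus_one_power_iff)

lemma sign_seq_mult: "sign_seq \<rho> \<Longrightarrow> sign_seq \<sigma> \<Longrightarrow> sign_seq (\<lambda>k. \<rho> k * \<sigma> k)"
  unfolding sign_seq_def
proof
  fix k assume "\<forall>k. \<rho> k = 1 \<or> \<rho> k = - 1" "\<forall>k. \<sigma> k = 1 \<or> \<sigma> k = - 1"
  then have "\<rho> k = 1 \<or> \<rho> k = - 1" "\<sigma> k = 1 \<or> \<sigma> k = - 1" by auto
  then show "\<rho> k * \<sigma> k = 1 \<or> \<rho> k * \<sigma> k = - 1" by auto
qed

lemma walsh_eq_walsh_char: "walsh n x = walsh_char (\<lambda>k. rademacher k x) n"
  by (simp add: walsh_def walsh_char_def)

lemma abs_walsh [simp]: "\<bar>walsh n x\<bar> = 1"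
  by (simp add: walsh_eq_walsh_char abs_walsh_char sign_seq_rademacher)

lemma walsh_eq_step:
  assumes "0 \<le> x" "n < 2 ^ s"
  shows "walsh n x = walsh_char (digit_sign s (cell_index s x)) n"
  unfolding walsh_eq_walsh_char using assms rademacher_eq_digit_sign[of x _ s] bit_less_exp[of n s]
  by (intro walsh_char_cong) auto

lemma space_unit [simp]: "space unit_measure = {0..<1}"
  by (simp add: space_restrict_space)

lemma sets_unit: "A \<in> sets unit_measure \<longleftrightarrow> A \<subseteq> {0..<1} \<and> A \<in> sets lebesgue"
  by (simp add: sets_restrict_space_iff)

lemma emeasure_unit: "A \<subseteq> {0..<1} \<Longrightarrow> emeasure unit_measure A = emeasure lebesgue A"
  by (rule emeasure_restrict_space) auto

lemma finite_measure_unit: "finite_measure unit_measure"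
  by (rule finite_measureI) (simp add: emeasure_unit)

lemma measurable_unit: "f \<in> borel_measurable borel \<Longrightarrow> f \<in> borel_measurable unit_measure"
  by (intro measurable_restrict_space1 measurable_completion) simp

lemma measurable_cell_index: "cell_index s \<in> measurable unit_measure (count_space UNIV)"
  unfolding cell_index_def
  by (intro measurable_restrict_space1 measurable_completion) simp

lemma measurable_step: "(\<lambda>x. \<phi> (cell_index s x) :: real) \<in> borel_measurable unit_measure"
  by (rule measurable_compose[OF measurable_cell_index]) simp

lemma cell_in_sets: "cell s a \<in> sets lebesgue"
  by (simp add: cell_def)

lemma emeasure_cell: "a < 2 ^ s \<Longrightarrow> emeasure unit_measure (cell s a) = ennreal (1 / 2 ^ s)"
  using cell_subset_unit[of a s]
  by (simp add: emeasure_unit) (simp add: cell_def field_simps)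

lemma step_eq_sum_cells:
  assumes "x \<in> {0..<1}"
  shows "\<phi> (cell_index s x) = (\<Sum>a<2^s. \<phi> a * indicator (cell s a) x :: real)"
proof -
  have "(\<Sum>a<2^s. \<phi> a * indicator (cell s a) x :: real) = (\<Sum>a<2^s. if a = cell_index s x then \<phi> a else 0)"
    using assms by (intro sum.cong) (auto simp: indicator_def simp flip: cell_index_eq_iff)
  then show ?thesis using cell_index_less[OF assms] by simp
qed

lemma has_integral_step:
  "has_bochner_integral unit_measure (\<lambda>x. \<phi> (cell_index s x) :: real) ((\<Sum>a<2^s. \<phi> a) / 2 ^ s)"
proof -
  have "has_bochner_integral unit_measure (indicator (cell s a) :: real \<Rightarrow> real) (1 / 2 ^ s)" if "a < 2 ^ s" for a
    using has_bochner_integral_real_indicator[of "cell s a" unit_measure] emeasure_cell[OF that]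
      cell_subset_unit[OF that] cell_in_sets[of s a] by (simp add: sets_unit measure_def)
  then have "has_bochner_integral unit_measure (\<lambda>x. \<Sum>a<2^s. \<phi> a * indicator (cell s a) x :: real) (\<Sum>a<2^s. \<phi> a * (1 / 2 ^ s))"
    by (intro has_bochner_integral_sum has_bochner_integral_mult_right) auto
  also have "?this \<longleftrightarrow> has_bochner_integral unit_measure (\<lambda>x. \<phi> (cell_index s x)) ((\<Sum>a<2^s. \<phi> a) / 2 ^ s)"
    using step_eq_sum_cells[of _ \<phi> s] by (intro has_bochner_integral_cong) (simp_all add: sum_divide_distrib)
  finally show ?thesis .
qed

lemma integrable_step: "integrable unit_measure (\<lambda>x. \<phi> (cell_index s x) :: real)"
  using has_integral_step[of \<phi> s] by (simp add: has_bochner_integral_iff)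

lemma flip_bit_less:
  assumes "a < 2 ^ s" "k < s"
  shows "flip_bit k a < (2::nat) ^ s"
proof -
  have "take_bit s (flip_bit k a) = flip_bit k a"
    using assms by (simp add: take_bit_flip_bit_eq take_bit_nat_eq_self)
  then show ?thesis by (simp add: take_bit_nat_eq_self_iff)
qed

lemma flip_bit_flip_bit [simp]: "flip_bit k (flip_bit k a) = (a::nat)"
  by (rule bit_eqI) (auto simp: bit_flip_bit_iff)

lemma sum_flip_bit:
  assumes "k < s"
  shows "(\<Sum>a<2^s. f (flip_bit k a)) = (\<Sum>a<2^s. f (a::nat) :: 'b :: comm_monoid_add)"
  by (rule sum.reindex_bij_witness[of _ "flip_bit k" "flip_bit k"]) (auto simp: flip_bit_less assms)

text \<open>Flipping a digit on which \<open>walsh n\<close> depends permutes the cells and reverses the sign.\<close>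

lemma integral_walsh: "has_bochner_integral unit_measure (walsh n) (of_bool (n = 0))"
proof -
  define s where "s = n"
  have n: "n < 2 ^ s" by (simp add: s_def)
  define \<phi> where "\<phi> a = walsh_char (digit_sign s a) n" for a
  have "(\<Sum>a<2^s. \<phi> a) = 0" if n0: "n \<noteq> 0"
  proof -
    obtain k where k: "bit n k" using n0 bit_eq_iff[of n 0] by auto
    have ks: "k < s" using bit_less_exp[OF n k] .
    have "\<phi> (flip_bit (s - 1 - k) a) = - \<phi> a" for a
    proof -
      have *: "digit_sign s (flip_bit (s - 1 - k) a) l = (if l = k then - 1 else 1) * digit_sign s a l"
        if "bit n l" for l
        using bit_less_exp[OF n that] ks by (auto simp: digit_sign_def bit_flip_bit_iff)
      have "\<phi> (flip_bit (s - 1 - k) a) = walsh_char (\<lambda>l. (if l = k then - 1 else 1) * digit_sign s a l) n"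
        unfolding \<phi>_def by (intro walsh_char_cong *)
      also have "\<dots> = walsh_char (\<lambda>l. if l = k then - 1 else 1) n * \<phi> a"
        by (simp add: walsh_char_mult \<phi>_def)
      also have "walsh_char (\<lambda>l. if l = k then - 1 else 1) n = -1"
        unfolding walsh_char_def using k finite_bits[of n] by (subst prod.delta) auto
      finally show ?thesis by simp
    qed
    then have "(\<Sum>a<2^s. \<phi> a) = (\<Sum>a<2^s. - \<phi> a)"
      using sum_flip_bit[of "s - 1 - k" s \<phi>] ks by simp
    then show ?thesis by (simp add: sum_negf)
  qed
  moreover have "(\<Sum>a<2^s. \<phi> a) = 2 ^ s" if "n = 0"
    using that by (simp add: \<phi>_def)
  ultimately have "(\<Sum>a<2^s. \<phi> a) / 2 ^ s = of_bool (n = 0)" by auto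
  then have "has_bochner_integral unit_measure (\<lambda>x. \<phi> (cell_index s x)) (of_bool (n = 0))"
    using has_integral_step[of \<phi> s] by simp
  then show ?thesis
    by (subst has_bochner_integral_cong[OF refl _ refl, where g = "\<lambda>x. \<phi> (cell_index s x)"])
       (auto simp: \<phi>_def walsh_eq_step[OF _ n])
qed

lemma walsh_mult: "walsh m x * walsh n x = walsh (xor m n) x"
proof -
  define A B where "A = {k. bit m k}" and "B = {k. bit n k}"
  define r where "r = (\<lambda>k. rademacher k x)"
  have fin: "finite A" "finite B" by (auto simp: A_def B_def finite_bits)
  have "r k * r k = 1" for k
    using sign_seq_rademacher[of x] unfolding sign_seq_def r_def by (auto dest: spec[of _ k])
  then have sq: "prod r (A \<inter> B) * prod r (A \<inter> B) = 1" by (simp flip: prod.distrib)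
  have "prod r A = prod r (A - B) * prod r (A \<inter> B)"
    using fin by (subst prod.union_disjoint[symmetric]) (auto intro!: prod.cong)
  moreover have "prod r B = prod r (B - A) * prod r (A \<inter> B)"
    using fin by (subst prod.union_disjoint[symmetric]) (auto intro!: prod.cong)
  moreover have "prod r {k. bit (xor m n) k} = prod r (A - B) * prod r (B - A)"
    using fin by (subst prod.union_disjoint[symmetric]) (auto intro!: prod.cong simp: A_def B_def bit_xor_iff)
  ultimately have "prod r A * prod r B = prod r {k. bit (xor m n) k}"
    using sq by (simp add: mult_ac)
  then show ?thesis
    by (simp add: walsh_def r_def A_def B_def)
qed

lemma measurable_walsh [measurable]: "walsh n \<in> borel_measurable unit_measure"
  using integral_walsh[of n] by (simp add: has_bochner_integral_iff borel_measurable_integrable)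

lemma integrable_mult_walsh:
  assumes "integrable unit_measure f"
  shows "integrable unit_measure (\<lambda>x. f x * walsh n x)"
  by (rule Bochner_Integration.integrable_bound[OF assms]) (use assms in \<open>auto simp: abs_mult\<close>)

definition walsh_poly :: "(nat \<Rightarrow> real) \<Rightarrow> nat \<Rightarrow> real \<Rightarrow> real" where
  "walsh_poly \<alpha> n x = (\<Sum>k<n. \<alpha> k * walsh k x)"

lemma integrable_walsh_poly: "integrable unit_measure (walsh_poly \<alpha> n)"
proof -
  have "integrable unit_measure (walsh k)" for k
    using integral_walsh[of k] by (simp add: has_bochner_integral_iff)
  then show ?thesis unfolding walsh_poly_def by auto
qed

lemma walsh_coeff_walsh_poly: "walsh_coeff (walsh_poly \<alpha> n) k = (if k < n then \<alpha> k else 0)"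
proof -
  have "has_bochner_integral unit_measure (\<lambda>x. \<Sum>l<n. \<alpha> l * walsh (xor l k) x) (\<Sum>l<n. \<alpha> l * of_bool (xor l k = 0))"
    by (intro has_bochner_integral_sum has_bochner_integral_mult_right integral_walsh)
  then have "walsh_coeff (walsh_poly \<alpha> n) k = (\<Sum>l<n. \<alpha> l * of_bool (xor l k = 0))"
    unfolding walsh_coeff_def walsh_poly_def
    by (simp add: has_bochner_integral_iff sum_distrib_right mult.assoc walsh_mult)
  also have "\<dots> = (\<Sum>l<n. if l = k then \<alpha> l else 0)"
  proof (intro sum.cong refl)
    fix l
    have "xor l k = 0 \<longleftrightarrow> l = k"
      by (auto simp: bit_eq_iff bit_xor_iff)
    then show "\<alpha> l * of_bool (xor l k = 0) = (if l = k then \<alpha> l else 0)" by simp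
  qed
  finally show ?thesis by simp
qed

lemma walsh_partial_sum_walsh_poly: "walsh_partial_sum (walsh_poly \<alpha> n) k x = walsh_poly \<alpha> (min n k) x"
  unfolding walsh_partial_sum_def walsh_poly_def walsh_coeff_walsh_poly
  by (rule sum.mono_neutral_cong_right) auto

lemma abs_walsh_poly_le: "\<bar>walsh_poly \<alpha> n x\<bar> \<le> (\<Sum>k<n. \<bar>\<alpha> k\<bar>)"
  unfolding walsh_poly_def by (rule order.trans[OF sum_abs]) (simp add: abs_mult)

lemma integral_walsh_poly: "n > 0 \<Longrightarrow> (LINT x|unit_measure. walsh_poly \<alpha> n x) = \<alpha> 0"
  using walsh_coeff_walsh_poly[of \<alpha> n 0] by (simp add: walsh_coeff_def walsh_eq_walsh_char)

lemma walsh_poly_add_scaled: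
  "\<exists>\<gamma> k. \<forall>x. walsh_poly \<gamma> k x = walsh_poly \<alpha> m x + c * walsh_poly \<beta> n x"
proof (intro exI allI)
  fix x
  have "(\<Sum>k<max m n. (if k < m then \<alpha> k else 0) * walsh k x) = (\<Sum>k<m. \<alpha> k * walsh k x)"
    by (rule sum.mono_neutral_cong_right) auto
  moreover have "(\<Sum>k<max m n. (if k < n then c * \<beta> k else 0) * walsh k x) = (\<Sum>k<n. c * \<beta> k * walsh k x)"
    by (rule sum.mono_neutral_cong_right) auto
  ultimately show "walsh_poly (\<lambda>k. (if k < m then \<alpha> k else 0) + (if k < n then c * \<beta> k else 0)) (max m n) x =
      walsh_poly \<alpha> m x + c * walsh_poly \<beta> n x"
    by (simp add: walsh_poly_def distrib_right sum.distrib sum_distrib_left mult.assoc)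
qed

section \<open>Density of the Walsh polynomials\<close>

text \<open>The kernel \<open>dirichlet \<rho> (2 ^ m)\<close> is the product of the \<open>1 + \<rho> k\<close> with \<open>k < m\<close>, so for the sign
  sequence of two points it is \<open>2 ^ m\<close> if they share their cell of rank \<open>m\<close> and zero otherwise.
  This expresses indicators of cells by Walsh functions.\<close>

lemma step_eq_walsh_poly:
  "\<exists>\<alpha>. \<forall>x\<in>{0..<1}. \<phi> (cell_index m x) = walsh_poly \<alpha> (2 ^ m) x"
proof (intro exI ballI)
  fix x :: real assume x: "x \<in> {0..<1}"
  define c where "c = cell_index m x"
  have c: "c < 2 ^ m" unfolding c_def by (rule cell_index_less[OF x])
  define \<alpha> where "\<alpha> l = (\<Sum>a<2^m. \<phi> a * walsh_char (digit_sign m a) l) / 2 ^ m" for l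
  have D: "dirichlet (\<lambda>k. digit_sign m a k * rademacher k x) (2 ^ m) = (if a = c then 2 ^ m else 0)"
    if a: "a < 2 ^ m" for a
  proof -
    have "dirichlet (\<lambda>k. digit_sign m a k * rademacher k x) (2 ^ m) = (\<Prod>k<m. 1 + digit_sign m a k * digit_sign m c k)"
      unfolding dirichlet_exp c_def using x by (intro prod.cong) (auto simp: rademacher_eq_digit_sign)
    also have "\<dots> = (if a = c then 2 ^ m else 0)"
    proof (cases "a = c")
      case True
      then have "(\<Prod>k<m. 1 + digit_sign m a k * digit_sign m c k) = (\<Prod>k<m. 2)"
        by (intro prod.cong) (auto simp: digit_sign_def)
      then show ?thesis using True by simp
    next
      case False
      then obtain b where b: "bit a b \<noteq> bit c b" using bit_eq_iff[of a c] by auto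
      then have "b < m" using bit_less_exp[OF a] bit_less_exp[OF c] by blast
      then have "digit_sign m a (m - 1 - b) * digit_sign m c (m - 1 - b) = -1" "m - 1 - b < m"
        using b by (auto simp: digit_sign_def)
      then have "(\<Prod>k<m. 1 + digit_sign m a k * digit_sign m c k) = 0"
        by (intro prod_zero) (auto intro!: bexI[of _ "m - 1 - b"])
      then show ?thesis using False by simp
    qed
    finally show ?thesis .
  qed
  have "walsh_poly \<alpha> (2 ^ m) x = (\<Sum>l<2^m. \<Sum>a<2^m. \<phi> a * (walsh_char (digit_sign m a) l * walsh l x)) / 2 ^ m"
    by (simp add: walsh_poly_def \<alpha>_def sum_divide_distrib sum_distrib_left mult_ac)
  also have "(\<Sum>l<2^m. \<Sum>a<2^m. \<phi> a * (walsh_char (digit_sign m a) l * walsh l x)) =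
      (\<Sum>a<2^m. \<phi> a * dirichlet (\<lambda>k. digit_sign m a k * rademacher k x) (2 ^ m))"
    by (subst sum.swap) (simp add: dirichlet_def walsh_char_mult walsh_eq_walsh_char sum_distrib_left)
  also have "\<dots> = (\<Sum>a<2^m. if a = c then \<phi> a * 2 ^ m else 0)"
    by (intro sum.cong) (auto simp: D)
  finally show "\<phi> (cell_index m x) = walsh_poly (\<lambda>l. (\<Sum>a<2^m. \<phi> a * walsh_char (digit_sign m a) l) / 2 ^ m) (2 ^ m) x"
    using c by (simp add: c_def[symmetric] \<alpha>_def[symmetric])
qed

definition walsh_approximable :: "(real \<Rightarrow> real) \<Rightarrow> bool" where
  "walsh_approximable f \<longleftrightarrow> integrable unit_measure f \<and>
     (\<forall>e>0. \<exists>\<alpha> n. (LINT x|unit_measure. \<bar>f x - walsh_poly \<alpha> n x\<bar>) < e)"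

lemma walsh_approximable_limit:
  assumes f: "integrable unit_measure f"
    and g: "\<And>e. e > 0 \<Longrightarrow> \<exists>g. walsh_approximable g \<and> (LINT x|unit_measure. \<bar>f x - g x\<bar>) < e"
  shows "walsh_approximable f"
  unfolding walsh_approximable_def
proof (intro conjI f allI impI)
  fix e :: real assume "e > 0"
  then obtain g where g: "walsh_approximable g" "(LINT x|unit_measure. \<bar>f x - g x\<bar>) < e / 2"
    using assms(2)[of "e / 2"] by auto
  then obtain \<alpha> n where p: "(LINT x|unit_measure. \<bar>g x - walsh_poly \<alpha> n x\<bar>) < e / 2"
    using \<open>e > 0\<close> unfolding walsh_approximable_def by (meson half_gt_zero)
  have [simp]: "integrable unit_measure g" "integrable unit_measure (walsh_poly \<alpha> n)"
    using g integrable_walsh_poly by (auto simp: walsh_approximable_def)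
  have "(LINT x|unit_measure. \<bar>f x - walsh_poly \<alpha> n x\<bar>) \<le>
      (LINT x|unit_measure. \<bar>f x - g x\<bar> + \<bar>g x - walsh_poly \<alpha> n x\<bar>)"
    using f by (intro integral_mono) auto
  also have "\<dots> = (LINT x|unit_measure. \<bar>f x - g x\<bar>) + (LINT x|unit_measure. \<bar>g x - walsh_poly \<alpha> n x\<bar>)"
    using f by (intro Bochner_Integration.integral_add) auto
  finally show "\<exists>\<alpha> n. (LINT x|unit_measure. \<bar>f x - walsh_poly \<alpha> n x\<bar>) < e"
    using g(2) p by (intro exI[of _ \<alpha>] exI[of _ n]) simp
qed

lemma walsh_approximable_dominated:
  assumes s: "\<And>i. walsh_approximable (s i)" and f: "f \<in> borel_measurable unit_measure"
    and w: "integrable unit_measure w"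
    and lim: "\<And>x. x \<in> {0..<1} \<Longrightarrow> (\<lambda>i. s i x) \<longlonglongrightarrow> f x"
    and bound: "\<And>i x. x \<in> {0..<1} \<Longrightarrow> \<bar>s i x\<bar> \<le> w x"
  shows "walsh_approximable f"
proof -
  have [measurable]: "s i \<in> borel_measurable unit_measure" for i
    using s[of i] by (auto simp: walsh_approximable_def)
  note f [measurable]
  have f_le: "\<bar>f x\<bar> \<le> w x" if "x \<in> {0..<1}" for x
    using lim[OF that] bound[OF that] by (intro LIMSEQ_le_const2[of "\<lambda>i. \<bar>s i x\<bar>"]) (auto intro: tendsto_rabs)
  have int_f: "integrable unit_measure f"
    using f_le by (intro Bochner_Integration.integrable_bound[OF w]) (auto intro!: AE_I2 order.trans[OF _ abs_ge_self])
  have "(\<lambda>i. LINT x|unit_measure. \<bar>f x - s i x\<bar>) \<longlonglongrightarrow> (LINT x|unit_measure. 0)"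
  proof (rule integral_dominated_convergence[where w = "\<lambda>x. 2 * w x"])
    show "AE x in unit_measure. (\<lambda>i. \<bar>f x - s i x\<bar>) \<longlonglongrightarrow> 0"
    proof (rule AE_I2)
      fix x assume "x \<in> space unit_measure"
      then have "(\<lambda>i. \<bar>f x - s i x\<bar>) \<longlonglongrightarrow> \<bar>f x - f x\<bar>"
        by (intro tendsto_intros lim) simp
      then show "(\<lambda>i. \<bar>f x - s i x\<bar>) \<longlonglongrightarrow> 0" by simp
    qed
    show "AE x in unit_measure. norm \<bar>f x - s i x\<bar> \<le> 2 * w x" for i
    proof (rule AE_I2)
      fix x assume "x \<in> space unit_measure"
      then show "norm \<bar>f x - s i x\<bar> \<le> 2 * w x"
        using f_le[of x] bound[of x i] by simp
    qed
  qed (use w in auto)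
  then have lim0: "(\<lambda>i. LINT x|unit_measure. \<bar>f x - s i x\<bar>) \<longlonglongrightarrow> 0" by simp
  show ?thesis
  proof (rule walsh_approximable_limit[OF int_f])
    fix e :: real assume "e > 0"
    then have "\<forall>\<^sub>F i in sequentially. (LINT x|unit_measure. \<bar>f x - s i x\<bar>) < e"
      using order_tendstoD(2)[OF lim0] by blast
    then show "\<exists>g. walsh_approximable g \<and> (LINT x|unit_measure. \<bar>f x - g x\<bar>) < e"
      using s by (auto simp: eventually_sequentially)
  qed
qed

lemma walsh_approximable_step: "walsh_approximable (\<lambda>x. \<phi> (cell_index m x))"
proof -
  obtain \<alpha> where "\<And>x. x \<in> {0..<1} \<Longrightarrow> \<phi> (cell_index m x) = walsh_poly \<alpha> (2 ^ m) x"
    using step_eq_walsh_poly by blast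
  then have "(LINT x|unit_measure. \<bar>\<phi> (cell_index m x) - walsh_poly \<alpha> (2 ^ m) x\<bar>) = (LINT x|unit_measure. 0)"
    by (intro Bochner_Integration.integral_cong) auto
  then show ?thesis
    unfolding walsh_approximable_def using integrable_step by (metis Bochner_Integration.integral_zero)
qed

text \<open>Within the unit interval an open set is the increasing union, over the rank, of the cells contained in it.\<close>

lemma walsh_approximable_open:
  assumes "open U"
  shows "walsh_approximable (indicator U)"
proof (rule walsh_approximable_dominated)
  show "walsh_approximable (\<lambda>x. of_bool (cell m (cell_index m x) \<subseteq> U))" for m
    by (rule walsh_approximable_step)
  show "(indicator U :: real \<Rightarrow> real) \<in> borel_measurable unit_measure"
    using assms by (intro measurable_unit) auto
  show "integrable unit_measure (\<lambda>x. 1 :: real)"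
    using integrable_step[of "\<lambda>_. 1"] .
  fix x :: real assume x: "x \<in> {0..<1}"
  show "(\<lambda>m. of_bool (cell m (cell_index m x) \<subseteq> U)) \<longlonglongrightarrow> (indicator U x :: real)"
  proof (cases "x \<in> U")
    case True
    then obtain e where e: "e > 0" "ball x e \<subseteq> U" using assms openE by blast
    obtain M where M: "(1 / 2) ^ M < e" using real_arch_pow_inv[of e "1/2"] e(1) by auto
    have "cell m (cell_index m x) \<subseteq> U" if "M \<le> m" for m
    proof
      fix y assume y: "y \<in> cell m (cell_index m x)"
      have x': "x \<in> cell m (cell_index m x)"
        using x cell_index_eq_iff[of x m "cell_index m x"] by simp
      have "\<bar>x - y\<bar> < 1 / 2 ^ m"
        using x' y by (auto simp: cell_def add_divide_distrib abs_less_iff)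
      also have "\<dots> \<le> 1 / 2 ^ M"
        using that by (intro divide_left_mono power_increasing) auto
      also have "\<dots> < e" using M by (simp add: power_one_over)
      finally show "y \<in> U" using e(2) by (auto simp: dist_real_def subset_iff)
    qed
    then have "\<forall>\<^sub>F m in sequentially. of_bool (cell m (cell_index m x) \<subseteq> U) = (indicator U x :: real)"
      using True by (auto simp: eventually_sequentially)
    then show ?thesis by (rule tendsto_eventually)
  next
    case False
    have "x \<in> cell m (cell_index m x)" for m
      using x cell_index_eq_iff[of x m "cell_index m x"] by simp
    then have "\<not> cell m (cell_index m x) \<subseteq> U" for m
      using False by blast
    then show ?thesis using False by simp
  qed
  show "\<bar>of_bool (cell m (cell_index m x) \<subseteq> U)\<bar> \<le> (1::real)" for m
    by simp
qed

lemma walsh_approximable_add: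
  assumes "walsh_approximable f" "walsh_approximable g"
  shows "walsh_approximable (\<lambda>x. f x + g x)"
  unfolding walsh_approximable_def
proof (intro conjI allI impI)
  show "integrable unit_measure (\<lambda>x. f x + g x)"
    using assms by (auto simp: walsh_approximable_def)
  fix e :: real assume "e > 0"
  then have e2: "e / 2 > 0" by simp
  obtain \<alpha> m where p: "(LINT x|unit_measure. \<bar>f x - walsh_poly \<alpha> m x\<bar>) < e / 2"
    using assms(1) e2 unfolding walsh_approximable_def by meson
  obtain \<beta> n where r: "(LINT x|unit_measure. \<bar>g x - walsh_poly \<beta> n x\<bar>) < e / 2"
    using assms(2) e2 unfolding walsh_approximable_def by meson
  have [simp]: "integrable unit_measure f" "integrable unit_measure g"
    using assms by (auto simp: walsh_approximable_def)
  obtain \<gamma> k where split: "\<And>x. walsh_poly \<gamma> k x = walsh_poly \<alpha> m x + 1 * walsh_poly \<beta> n x"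
    using walsh_poly_add_scaled[of \<alpha> m 1 \<beta> n] by blast
  have "(LINT x|unit_measure. \<bar>f x + g x - walsh_poly \<gamma> k x\<bar>) \<le>
      (LINT x|unit_measure. \<bar>f x - walsh_poly \<alpha> m x\<bar> + \<bar>g x - walsh_poly \<beta> n x\<bar>)"
    using integrable_walsh_poly by (intro integral_mono) (auto simp: split)
  also have "\<dots> = (LINT x|unit_measure. \<bar>f x - walsh_poly \<alpha> m x\<bar>) + (LINT x|unit_measure. \<bar>g x - walsh_poly \<beta> n x\<bar>)"
    using integrable_walsh_poly by (intro Bochner_Integration.integral_add) auto
  finally show "\<exists>\<alpha> n. (LINT x|unit_measure. \<bar>f x + g x - walsh_poly \<alpha> n x\<bar>) < e"
    using p r by (intro exI[of _ \<gamma>] exI[of _ k]) simp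
qed

lemma walsh_approximable_scale:
  assumes "walsh_approximable f"
  shows "walsh_approximable (\<lambda>x. f x * c)"
  unfolding walsh_approximable_def
proof (intro conjI allI impI)
  show int: "integrable unit_measure (\<lambda>x. f x * c)"
    using assms by (auto simp: walsh_approximable_def)
  fix e :: real assume e: "e > 0"
  then have "e / (\<bar>c\<bar> + 1) > 0" by simp
  then obtain \<alpha> n where p: "(LINT x|unit_measure. \<bar>f x - walsh_poly \<alpha> n x\<bar>) < e / (\<bar>c\<bar> + 1)"
    using assms unfolding walsh_approximable_def by meson
  have "f x * c - walsh_poly (\<lambda>k. \<alpha> k * c) n x = (f x - walsh_poly \<alpha> n x) * c" for x
    by (simp add: walsh_poly_def sum_distrib_left right_diff_distrib mult_ac)
  then have "(LINT x|unit_measure. \<bar>f x * c - walsh_poly (\<lambda>k. \<alpha> k * c) n x\<bar>) =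
      (LINT x|unit_measure. \<bar>f x - walsh_poly \<alpha> n x\<bar>) * \<bar>c\<bar>"
    by (simp add: abs_mult)
  also have "\<dots> \<le> (LINT x|unit_measure. \<bar>f x - walsh_poly \<alpha> n x\<bar>) * (\<bar>c\<bar> + 1)"
    by (intro mult_left_mono integral_nonneg_AE) auto
  also have "\<dots> < e" using p by (simp add: pos_less_divide_eq)
  finally show "\<exists>\<alpha> n. (LINT x|unit_measure. \<bar>f x * c - walsh_poly \<alpha> n x\<bar>) < e" by blast
qed

text \<open>Outer regularity of Lebesgue measure reduces measurable sets to open ones.\<close>

lemma walsh_approximable_indicator:
  assumes "A \<in> sets unit_measure"
  shows "walsh_approximable (indicator A)"
proof (rule walsh_approximable_limit)
  show "integrable unit_measure (indicator A :: real \<Rightarrow> real)"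
    using assms finite_measure.emeasure_finite[OF finite_measure_unit, of A]
    by (intro integrable_real_indicator) (auto simp: less_top)
  fix e :: real assume e: "e > 0"
  have A: "A \<subseteq> {0..<1}" "A \<in> sets lebesgue" using assms by (auto simp: sets_unit)
  obtain U where U: "open U" "A \<subseteq> U" "U - A \<in> lmeasurable" "emeasure lebesgue (U - A) < ennreal e"
    using sets_lebesgue_outer_open[OF A(2) e] by auto
  have sets: "(U - A) \<inter> {0..<1} \<in> sets unit_measure"
    using U(3) by (auto simp: sets_unit)
  have "(LINT x|unit_measure. \<bar>indicator A x - indicator U x\<bar>) = (LINT x|unit_measure. indicator ((U - A) \<inter> {0..<1}) x :: real)"
    using U(2) by (intro Bochner_Integration.integral_cong) (auto simp: indicator_def)
  also have "\<dots> = measure unit_measure ((U - A) \<inter> {0..<1})"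
    using sets by (simp add: Int_absorb2 sets.sets_into_space)
  also have "\<dots> = measure lebesgue ((U - A) \<inter> {0..<1})"
    by (simp add: measure_def emeasure_unit)
  also have "\<dots> \<le> measure lebesgue (U - A)"
    using U(3) by (intro measure_mono_fmeasurable) auto
  also have "\<dots> < e"
    using U(3,4) e by (simp add: emeasure_eq_measure2 ennreal_less_iff)
  finally show "\<exists>g. walsh_approximable g \<and> (LINT x|unit_measure. \<bar>indicator A x - g x\<bar>) < e"
    using walsh_approximable_open[OF U(1)] by blast
qed

lemma integrable_imp_walsh_approximable:
  assumes "integrable unit_measure f"
  shows "walsh_approximable f"
  using assms
proof (induction rule: integrable_induct)
  case (base A c)
  then show ?case using walsh_approximable_scale[OF walsh_approximable_indicator] by simp
next
  case (add f g)
  then show ?case by (intro walsh_approximable_add)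
next
  case (lim f s)
  show ?case
  proof (rule walsh_approximable_dominated[where s = s and w = "\<lambda>x. 2 * \<bar>f x\<bar>"])
  qed (use lim in auto)
qed

section \<open>Noerlund means as integral operators\<close>

abbreviation "sign_pair x t \<equiv> (\<lambda>k. rademacher k x * rademacher k t)"

lemma sign_seq_pair: "sign_seq (sign_pair x t)"
  by (intro sign_seq_mult sign_seq_rademacher)

lemma walsh_partial_sum_integral:
  assumes f: "integrable unit_measure f"
  shows "has_bochner_integral unit_measure (\<lambda>t. f t * dirichlet (sign_pair x t) n) (walsh_partial_sum f n x)"
proof -
  have "has_bochner_integral unit_measure (\<lambda>t. f t * walsh k t) (walsh_coeff f k)" for k
    unfolding walsh_coeff_def by (intro has_bochner_integral_integrable integrable_mult_walsh f)
  then have "has_bochner_integral unit_measure (\<lambda>t. \<Sum>k<n. f t * walsh k t * walsh k x) (\<Sum>k<n. walsh_coeff f k * walsh k x)"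
    by (intro has_bochner_integral_sum has_bochner_integral_mult_left)
  moreover have "(\<Sum>k<n. f t * walsh k t * walsh k x) = f t * dirichlet (sign_pair x t) n" for t
    by (simp add: dirichlet_def walsh_char_mult walsh_eq_walsh_char sum_distrib_left mult_ac)
  ultimately show ?thesis by (simp add: walsh_partial_sum_def)
qed

lemma norlund_mean_integral:
  assumes f: "integrable unit_measure f" and that: "weight_sum q n \<noteq> 0"
  shows "has_bochner_integral unit_measure (\<lambda>t. f t * norlund_kernel q n (sign_pair x t))
    (weight_sum q n * norlund_mean q f n x)"
proof -
  have "has_bochner_integral unit_measure (\<lambda>t. \<Sum>k=1..n. q (n - k) * (f t * dirichlet (sign_pair x t) k))
      (\<Sum>k=1..n. q (n - k) * walsh_partial_sum f k x)"
    by (intro has_bochner_integral_sum has_bochner_integral_mult_right walsh_partial_sum_integral f)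
  moreover have "(\<Sum>k=1..n. q (n - k) * (f t * dirichlet (sign_pair x t) k)) = f t * norlund_kernel q n (sign_pair x t)" for t
    by (simp add: norlund_kernel_def sum_distrib_left mult_ac)
  ultimately show ?thesis using that by (simp add: norlund_mean_def)
qed

lemma norlund_mean_add_scaled:
  assumes f: "integrable unit_measure f" and g: "integrable unit_measure g"
  shows "norlund_mean q (\<lambda>x. f x + c * g x) n x = norlund_mean q f n x + c * norlund_mean q g n x"
proof -
  have "walsh_coeff (\<lambda>x. f x + c * g x) k = walsh_coeff f k + c * walsh_coeff g k" for k
  proof -
    have "walsh_coeff (\<lambda>x. f x + c * g x) k = (LINT x|unit_measure. f x * walsh k x + c * (g x * walsh k x))"
      by (simp add: walsh_coeff_def algebra_simps)
    also have "\<dots> = walsh_coeff f k + c * walsh_coeff g k"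
      unfolding walsh_coeff_def using integrable_mult_walsh[OF f] integrable_mult_walsh[OF g]
      by (subst Bochner_Integration.integral_add) auto
    finally show ?thesis .
  qed
  then have "walsh_partial_sum (\<lambda>x. f x + c * g x) k x = walsh_partial_sum f k x + c * walsh_partial_sum g k x" for k
    by (simp add: walsh_partial_sum_def distrib_right sum.distrib sum_distrib_left mult.assoc)
  then show ?thesis
    by (simp add: norlund_mean_def distrib_left sum.distrib sum_distrib_left mult_ac)
qed

corollary norlund_mean_diff:
  assumes "integrable unit_measure f" "integrable unit_measure g"
  shows "norlund_mean q (\<lambda>x. f x - g x) n x = norlund_mean q f n x - norlund_mean q g n x"
  using norlund_mean_add_scaled[OF assms, of q "-1"] by simp

lemma cell_index_eqI:
  assumes "x \<in> {0..<1}" "t \<in> {0..<1}" "\<And>k. k < s \<Longrightarrow> sign_pair x t k = 1"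
  shows "cell_index s t = cell_index s x"
proof (rule bit_eqI)
  fix b
  show "bit (cell_index s t) b = bit (cell_index s x) b"
  proof (cases "b < s")
    case True
    then show ?thesis
      using assms(1,2) assms(3)[of "s - 1 - b"] rademacher_eq_digit_sign[of x "s - 1 - b" s]
        rademacher_eq_digit_sign[of t "s - 1 - b" s] by (auto simp: digit_sign_def split: if_splits)
  next
    case False
    then show ?thesis using bit_less_exp cell_index_less assms(1,2) by blast
  qed
qed

lemma cell_index_flipI:
  assumes "x \<in> {0..<1}" "t \<in> {0..<1}" "j < s"
    and "\<And>k. k < s \<Longrightarrow> sign_pair x t k = (if k = j then -1 else 1)"
  shows "cell_index s t = flip_bit (s - 1 - j) (cell_index s x)"
proof (rule bit_eqI)
  fix b
  show "bit (cell_index s t) b = bit (flip_bit (s - 1 - j) (cell_index s x)) b"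
  proof (cases "b < s")
    case True
    then have "s - 1 - b = j \<longleftrightarrow> b = s - 1 - j" using assms(3) by auto
    then show ?thesis
      using True assms(1,2) assms(4)[of "s - 1 - b"] rademacher_eq_digit_sign[of x "s - 1 - b" s]
        rademacher_eq_digit_sign[of t "s - 1 - b" s] by (auto simp: digit_sign_def bit_flip_bit_iff split: if_splits)
  next
    case False
    have "flip_bit (s - 1 - j) (cell_index s x) < 2 ^ s"
      using assms(3) by (intro flip_bit_less cell_index_less assms(1)) simp
    then have "\<not> bit (cell_index s t) b" "\<not> bit (flip_bit (s - 1 - j) (cell_index s x)) b"
      using False bit_less_exp cell_index_less[OF assms(2), of s] by blast+
    then show ?thesis by simp
  qed
qed

text \<open>In their first \<open>s\<close> digits, \<open>t\<close> agrees with \<open>x\<close> in the first summand and differs from it precisely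
  in digit \<open>j\<close> in the others. The weights \<open>2 ^ s\<close> and \<open>2 ^ j\<close> are the largest sizes there
  of Dirichlet kernels of order at most \<open>2 ^ s\<close>.\<close>

definition near_kernel :: "nat \<Rightarrow> real \<Rightarrow> real \<Rightarrow> real" where
  "near_kernel s x t = 2 ^ s * of_bool (cell_index s t = cell_index s x) +
     (\<Sum>j<s. 2 ^ j * of_bool (cell_index s t = flip_bit (s - 1 - j) (cell_index s x)))"

lemma near_kernel_nonneg: "near_kernel s x t \<ge> 0"
  unfolding near_kernel_def by (intro add_nonneg_nonneg sum_nonneg) auto

lemma near_kernel_ge_exp:
  assumes "cell_index s t = cell_index s x"
  shows "2 ^ s \<le> near_kernel s x t"
proof -
  have "(\<Sum>j<s. 2 ^ j * of_bool (cell_index s t = flip_bit (s - 1 - j) (cell_index s x)) :: real) \<ge> 0"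
    by (intro sum_nonneg) auto
  then show ?thesis using assms by (simp add: near_kernel_def)
qed

lemma near_kernel_ge_exp_flip:
  assumes "cell_index s t = flip_bit (s - 1 - j) (cell_index s x)" "j < s"
  shows "2 ^ j \<le> near_kernel s x t"
proof -
  have "(2 ^ j * of_bool (cell_index s t = flip_bit (s - 1 - j) (cell_index s x)) :: real) \<le>
     (\<Sum>j<s. 2 ^ j * of_bool (cell_index s t = flip_bit (s - 1 - j) (cell_index s x)))"
    using assms(2) by (intro member_le_sum) auto
  moreover have "2 ^ s * of_bool (cell_index s t = cell_index s x) \<ge> (0::real)" by simp
  moreover have "(2 ^ j * of_bool (cell_index s t = flip_bit (s - 1 - j) (cell_index s x)) :: real) = 2 ^ j"
    by (simp add: assms(1))
  ultimately show ?thesis unfolding near_kernel_def by linarith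
qed

text \<open>The summand that dominates depends on the first two digits in which \<open>x\<close> and \<open>t\<close> differ: on a
  pair \<open>j < i < M\<close> it is the one of rank \<open>i\<close>, by \<open>abs_kernel_two_signs\<close>, and if fewer
  than two differences occur before \<open>M\<close> it is the one of rank \<open>M\<close>.\<close>

context norlund_weights
begin

lemma abs_kernel_le_near_kernel:
  assumes x: "x \<in> {0..<1}" and t: "t \<in> {0..<1}" and n: "n < 2 ^ M"
  shows "\<bar>norlund_kernel q n (sign_pair x t)\<bar> \<le> 6 * (\<Sum>s\<le>M. weight_sum q (2 ^ s) * near_kernel s x t)"
proof -
  define \<rho> where "\<rho> = sign_pair x t"
  have \<rho>: "sign_seq \<rho>" unfolding \<rho>_def by (rule sign_seq_pair)
  have Qn: "weight_sum q n \<le> weight_sum q (2 ^ M)" using n by (intro weight_mono) simp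
  have Q0: "weight_sum q k \<ge> 0" for k using weight_pos[of k] by simp
  have "\<exists>s\<le>M. \<bar>norlund_kernel q n \<rho>\<bar> \<le> 6 * (weight_sum q (2 ^ s) * near_kernel s x t)"
  proof (cases "\<exists>j<M. \<rho> j = -1")
    case False
    then have "\<rho> k = 1" if "k < M" for k
      using that \<rho> unfolding sign_seq_def by blast
    then have near: "2 ^ M \<le> near_kernel M x t"
      unfolding \<rho>_def by (intro near_kernel_ge_exp cell_index_eqI x t)
    have "\<bar>dirichlet \<rho> k\<bar> \<le> 2 ^ M" if "k \<le> n" for k
    proof -
      have "real k \<le> real (2 ^ M)" using that n by (intro of_nat_mono) simp
      then have "real k \<le> 2 ^ M" by (simp only: of_nat_power of_nat_numeral)
      then show ?thesis using abs_dirichlet_le[OF \<rho>, of k] by linarith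
    qed
    then have "\<bar>norlund_kernel q n \<rho>\<bar> \<le> 2 ^ M * weight_sum q n" by (rule abs_kernel_le)
    also have "\<dots> \<le> near_kernel M x t * weight_sum q (2 ^ M)"
      using near Qn Q0 by (intro mult_mono) (auto simp: near_kernel_nonneg)
    also have "\<dots> \<le> 6 * (weight_sum q (2 ^ M) * near_kernel M x t)"
      using mult_nonneg_nonneg[OF Q0[of "2 ^ M"] near_kernel_nonneg[of M x t]] by (simp add: mult.commute)
    finally show ?thesis by blast
  next
    case True
    define j where "j = (LEAST j. \<rho> j = -1)"
    obtain j0 where j0: "j0 < M" "\<rho> j0 = -1" using True by blast
    have j: "\<rho> j = -1" unfolding j_def using j0(2) by (rule LeastI)
    have jM: "j < M" using Least_le[of "\<lambda>j. \<rho> j = -1", OF j0(2)] j0(1) by (simp add: j_def)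
    have before: "\<rho> k = 1" if "k < j" for k
      using not_less_Least[OF that[unfolded j_def]] \<rho> by (auto simp: sign_seq_def)
    show ?thesis
    proof (cases "\<exists>i. j < i \<and> i < M \<and> \<rho> i = -1")
      case False
      then have "\<rho> k = (if k = j then -1 else 1)" if "k < M" for k
        using that \<rho> before[of k] j False unfolding sign_seq_def by (cases k j rule: linorder_cases) auto
      then have near: "2 ^ j \<le> near_kernel M x t"
        unfolding \<rho>_def by (intro near_kernel_ge_exp_flip cell_index_flipI x t jM)
      have "\<bar>norlund_kernel q n \<rho>\<bar> \<le> 2 ^ j * weight_sum q n"
        by (intro abs_kernel_le abs_dirichlet_le_exp \<rho> j)
      also have "\<dots> \<le> near_kernel M x t * weight_sum q (2 ^ M)"
        using near Qn Q0 by (intro mult_mono) (auto simp: near_kernel_nonneg)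
      also have "\<dots> \<le> 6 * (weight_sum q (2 ^ M) * near_kernel M x t)"
        using mult_nonneg_nonneg[OF Q0[of "2 ^ M"] near_kernel_nonneg[of M x t]] by (simp add: mult.commute)
      finally show ?thesis by blast
    next
      case True
      define i where "i = (LEAST i. j < i \<and> \<rho> i = -1)"
      obtain i0 where i0: "i0 < M" "j < i0 \<and> \<rho> i0 = -1" using True by blast
      have i: "j < i \<and> \<rho> i = -1" unfolding i_def using i0(2) by (rule LeastI)
      have iM: "i < M" using Least_le[of "\<lambda>i. j < i \<and> \<rho> i = -1", OF i0(2)] i0(1) by (simp add: i_def)
      have "\<rho> k = (if k = j then -1 else 1)" if "k < i" for k
        using not_less_Least[OF that[unfolded i_def]] \<rho> before[of k] j unfolding sign_seq_def
        by (cases k j rule: linorder_cases) auto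
      then have near: "2 ^ j \<le> near_kernel i x t"
        unfolding \<rho>_def using i by (intro near_kernel_ge_exp_flip cell_index_flipI x t) auto
      have "\<bar>norlund_kernel q n \<rho>\<bar> \<le> 6 * (2 ^ j * weight_sum q (2 ^ i))"
        using abs_kernel_two_signs[OF \<rho> j, of i n] i by simp
      also have "\<dots> \<le> 6 * (weight_sum q (2 ^ i) * near_kernel i x t)"
        using mult_right_mono[OF near Q0[of "2 ^ i"]] by (simp add: mult.commute)
      finally show ?thesis using iM by (intro exI[of _ i]) auto
    qed
  qed
  then obtain s where s: "s \<le> M" "\<bar>norlund_kernel q n \<rho>\<bar> \<le> 6 * (weight_sum q (2 ^ s) * near_kernel s x t)"
    by blast
  have "weight_sum q (2 ^ s) * near_kernel s x t \<le> (\<Sum>s\<le>M. weight_sum q (2 ^ s) * near_kernel s x t)"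
    using s(1) Q0 by (intro member_le_sum) (auto simp: near_kernel_nonneg)
  then show ?thesis using s(2) by (simp add: \<rho>_def)
qed

end

definition cell_mass :: "(real \<Rightarrow> real) \<Rightarrow> nat \<Rightarrow> nat \<Rightarrow> real" where
  "cell_mass f s a = (LINT t|unit_measure. \<bar>f t\<bar> * of_bool (cell_index s t = a))"

lemma integrable_cell_mass:
  fixes f :: "real \<Rightarrow> real"
  assumes "integrable unit_measure f"
  shows "integrable unit_measure (\<lambda>t. \<bar>f t\<bar> * of_bool (P (cell_index s t)))"
proof (rule Bochner_Integration.integrable_bound[OF assms])
  have "(\<lambda>t. of_bool (P (cell_index s t)) :: real) \<in> borel_measurable unit_measure"
    by (rule measurable_step)
  then show "(\<lambda>t. \<bar>f t\<bar> * of_bool (P (cell_index s t))) \<in> borel_measurable unit_measure"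
    using assms by (intro borel_measurable_times borel_measurable_abs) auto
qed auto

lemma cell_mass_nonneg: "cell_mass f s a \<ge> 0"
  unfolding cell_mass_def by (intro integral_nonneg_AE) auto

definition near_mass :: "(real \<Rightarrow> real) \<Rightarrow> nat \<Rightarrow> real \<Rightarrow> real" where
  "near_mass f s x = 2 ^ s * cell_mass f s (cell_index s x) +
     (\<Sum>j<s. 2 ^ j * cell_mass f s (flip_bit (s - 1 - j) (cell_index s x)))"

lemma near_mass_integral:
  assumes "integrable unit_measure f"
  shows "has_bochner_integral unit_measure (\<lambda>t. \<bar>f t\<bar> * near_kernel s x t) (near_mass f s x)"
proof -
  have "has_bochner_integral unit_measure (\<lambda>t. \<bar>f t\<bar> * of_bool (cell_index s t = a)) (cell_mass f s a)" for a
    unfolding cell_mass_def by (intro has_bochner_integral_integrable integrable_cell_mass assms)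
  then have "has_bochner_integral unit_measure (\<lambda>t. 2 ^ s * (\<bar>f t\<bar> * of_bool (cell_index s t = cell_index s x)) +
     (\<Sum>j<s. 2 ^ j * (\<bar>f t\<bar> * of_bool (cell_index s t = flip_bit (s - 1 - j) (cell_index s x))))) (near_mass f s x)"
    unfolding near_mass_def
    by (intro has_bochner_integral_add has_bochner_integral_sum has_bochner_integral_mult_right)
  moreover have "2 ^ s * (\<bar>f t\<bar> * of_bool (cell_index s t = cell_index s x)) +
     (\<Sum>j<s. 2 ^ j * (\<bar>f t\<bar> * of_bool (cell_index s t = flip_bit (s - 1 - j) (cell_index s x)))) = \<bar>f t\<bar> * near_kernel s x t" for t
    unfolding near_kernel_def distrib_left sum_distrib_left
    by (intro arg_cong2[where f = "(+)"] sum.cong refl) (simp_all only: mult_ac)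
  ultimately show ?thesis by simp
qed

context norlund_weights
begin

lemma abs_norlund_mean_le:
  assumes f: "integrable unit_measure f" and x: "x \<in> {0..<1}" and n: "n < 2 ^ M"
  shows "weight_sum q n * \<bar>norlund_mean q f n x\<bar> \<le> 6 * (\<Sum>s\<le>M. weight_sum q (2 ^ s) * near_mass f s x)"
proof -
  have Q: "weight_sum q n \<noteq> 0" using weight_pos[of n] by simp
  note I = norlund_mean_integral[OF f Q, of x]
  define R where "R t = 6 * (\<Sum>s\<le>M. weight_sum q (2 ^ s) * (\<bar>f t\<bar> * near_kernel s x t))" for t
  have J: "has_bochner_integral unit_measure R (6 * (\<Sum>s\<le>M. weight_sum q (2 ^ s) * near_mass f s x))"
    unfolding R_def by (intro has_bochner_integral_mult_right has_bochner_integral_sum near_mass_integral f)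
  have "\<bar>LINT t|unit_measure. f t * norlund_kernel q n (sign_pair x t)\<bar> \<le>
      (LINT t|unit_measure. \<bar>f t * norlund_kernel q n (sign_pair x t)\<bar>)"
    by (rule integral_abs_bound)
  also have "\<dots> \<le> (LINT t|unit_measure. R t)"
  proof (rule integral_mono)
    show "integrable unit_measure (\<lambda>t. \<bar>f t * norlund_kernel q n (sign_pair x t)\<bar>)"
      using I by (auto simp: has_bochner_integral_iff)
    show "integrable unit_measure R" using J by (auto simp: has_bochner_integral_iff)
    fix t assume "t \<in> space unit_measure"
    then have "\<bar>norlund_kernel q n (sign_pair x t)\<bar> \<le> 6 * (\<Sum>s\<le>M. weight_sum q (2 ^ s) * near_kernel s x t)"
      using x n by (intro abs_kernel_le_near_kernel) auto
    then have "\<bar>f t\<bar> * \<bar>norlund_kernel q n (sign_pair x t)\<bar> \<le> \<bar>f t\<bar> * (6 * (\<Sum>s\<le>M. weight_sum q (2 ^ s) * near_kernel s x t))"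
      by (intro mult_left_mono) auto
    also have "\<dots> = R t" by (simp add: R_def sum_distrib_left mult_ac)
    finally show "\<bar>f t * norlund_kernel q n (sign_pair x t)\<bar> \<le> R t" by (simp add: abs_mult)
  qed
  finally show ?thesis
    using I J Q weight_pos[of n] by (simp add: has_bochner_integral_iff abs_mult)
qed

end

lemma flip_bit_div_exp:
  "flip_bit k a div 2 ^ d = (if k < d then a div 2 ^ d else flip_bit (k - d) (a div 2 ^ d :: nat))"
  unfolding drop_bit_eq_div[symmetric]
  by (rule bit_eqI) (auto simp: bit_drop_bit_eq bit_flip_bit_iff)

lemma cell_mass_mono:
  assumes "integrable unit_measure f" "r \<le> s"
  shows "cell_mass f s a \<le> cell_mass f r (a div 2 ^ (s - r))"
  unfolding cell_mass_def
proof (rule integral_mono)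
  fix t assume "t \<in> space unit_measure"
  then show "\<bar>f t\<bar> * of_bool (cell_index s t = a) \<le> \<bar>f t\<bar> * of_bool (cell_index r t = a div 2 ^ (s - r))"
    using cell_index_coarser[of t r s] assms(2) by (intro mult_left_mono) auto
qed (intro integrable_cell_mass[where P = "\<lambda>b. b = _"] assms(1))+

section \<open>A weak type inequality\<close>

text \<open>A cell of a Calderon-Zygmund decomposition: the mean of \<open>\<bar>f\<bar>\<close> over the cell exceeds \<open>\<theta>\<close>, and no
  larger dyadic cell around it has this property.\<close>

definition stopping_cell :: "(real \<Rightarrow> real) \<Rightarrow> real \<Rightarrow> nat \<Rightarrow> nat \<Rightarrow> bool" where
  "stopping_cell f \<theta> r a \<longleftrightarrow> a < 2 ^ r \<and> 2 ^ r * cell_mass f r a > \<theta> \<and>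
     (\<forall>r'<r. 2 ^ r' * cell_mass f r' (a div 2 ^ (r - r')) \<le> \<theta>)"

lemma ex_stopping_cell:
  assumes "a < 2 ^ s" "2 ^ s * cell_mass f s a > \<theta>"
  shows "\<exists>r\<le>s. stopping_cell f \<theta> r (a div 2 ^ (s - r))"
proof -
  define P where "P r \<longleftrightarrow> r \<le> s \<and> 2 ^ r * cell_mass f r (a div 2 ^ (s - r)) > \<theta>" for r
  define r where "r = (LEAST r. P r)"
  have "P s" using assms by (simp add: P_def)
  then have r: "P r" unfolding r_def by (rule LeastI)
  then have rs: "r \<le> s" by (simp add: P_def)
  have "2 ^ r' * cell_mass f r' (a div 2 ^ (s - r) div 2 ^ (r - r')) \<le> \<theta>" if "r' < r" for r'
  proof -
    have "\<not> P r'" using not_less_Least[OF that[unfolded r_def]] .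
    moreover have "a div 2 ^ (s - r) div 2 ^ (r - r') = a div 2 ^ (s - r')"
      using that rs by (simp flip: div_mult2_eq power_add)
    ultimately show ?thesis using that rs by (auto simp: P_def)
  qed
  moreover have "a div 2 ^ (s - r) < 2 ^ r"
    using assms(1) rs by (simp add: less_mult_imp_div_less flip: power_add)
  ultimately show ?thesis using r rs by (auto simp: P_def stopping_cell_def)
qed

lemma stopping_cell_unique:
  assumes "t \<in> {0..<1}" "stopping_cell f \<theta> r (cell_index r t)" "stopping_cell f \<theta> r' (cell_index r' t)"
  shows "r = r'"
proof -
  have "\<not> p < p'" if "stopping_cell f \<theta> p (cell_index p t)" "stopping_cell f \<theta> p' (cell_index p' t)" for p p'
  proof
    assume "p < p'"
    then have "2 ^ p * cell_mass f p (cell_index p' t div 2 ^ (p' - p)) \<le> \<theta>"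
      using that(2) by (simp add: stopping_cell_def)
    then show False using that(1) cell_index_coarser[of t p p'] \<open>p < p'\<close> assms(1) by (simp add: stopping_cell_def)
  qed
  then show ?thesis using assms(2,3) by (metis linorder_neqE_nat)
qed

text \<open>Stopping cells are disjoint, so their masses add up to at most the norm of \<open>f\<close>.\<close>

lemma sum_stopping_mass:
  assumes f: "integrable unit_measure f"
  shows "(\<Sum>r<R. \<Sum>a<2^r. if stopping_cell f \<theta> r a then cell_mass f r a else 0) \<le> (LINT t|unit_measure. \<bar>f t\<bar>)"
proof -
  have "has_bochner_integral unit_measure (\<lambda>t. \<bar>f t\<bar> * of_bool (cell_index s t = a)) (cell_mass f s a)" for a s
    unfolding cell_mass_def by (intro has_bochner_integral_integrable integrable_cell_mass f)
  then have I: "has_bochner_integral unit_measure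
      (\<lambda>t. \<Sum>r<R. \<Sum>a<2^r. of_bool (stopping_cell f \<theta> r a) * (\<bar>f t\<bar> * of_bool (cell_index r t = a)))
      (\<Sum>r<R. \<Sum>a<2^r. of_bool (stopping_cell f \<theta> r a) * cell_mass f r a)"
    by (intro has_bochner_integral_sum has_bochner_integral_mult_right)
  have le: "(\<Sum>r<R. \<Sum>a<2^r. of_bool (stopping_cell f \<theta> r a) * (\<bar>f t\<bar> * of_bool (cell_index r t = a))) \<le> \<bar>f t\<bar>"
    if t: "t \<in> {0..<1}" for t
  proof -
    have inner: "(\<Sum>a<2^r. of_bool (stopping_cell f \<theta> r a) * (\<bar>f t\<bar> * of_bool (cell_index r t = a))) =
      \<bar>f t\<bar> * of_bool (stopping_cell f \<theta> r (cell_index r t))" for r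
    proof -
      have "(\<Sum>a<2^r. of_bool (stopping_cell f \<theta> r a) * (\<bar>f t\<bar> * of_bool (cell_index r t = a))) =
        (\<Sum>a<2^r. if a = cell_index r t then \<bar>f t\<bar> * of_bool (stopping_cell f \<theta> r a) else 0)"
        by (intro sum.cong) auto
      then show ?thesis using cell_index_less[OF t] by simp
    qed
    define A where "A = {r \<in> {..<R}. stopping_cell f \<theta> r (cell_index r t)}"
    have "card A \<le> 1"
      using stopping_cell_unique[OF t] by (intro card_le_Suc0_iff_eq[THEN iffD2, simplified One_nat_def[symmetric]]) (auto simp: A_def)
    have "(\<Sum>r<R. \<bar>f t\<bar> * of_bool (stopping_cell f \<theta> r (cell_index r t))) = \<bar>f t\<bar> * card A"
      by (simp add: A_def sum_of_bool_eq Int_def flip: sum_distrib_left)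
    also have "\<dots> \<le> \<bar>f t\<bar> * 1"
      using \<open>card A \<le> 1\<close> by (intro mult_left_mono) auto
    finally show ?thesis by (simp add: inner)
  qed
  have "(\<Sum>r<R. \<Sum>a<2^r. if stopping_cell f \<theta> r a then cell_mass f r a else 0) =
      (\<Sum>r<R. \<Sum>a<2^r. of_bool (stopping_cell f \<theta> r a) * cell_mass f r a)"
    by (intro sum.cong) auto
  also have "\<dots> = (LINT t|unit_measure. (\<Sum>r<R. \<Sum>a<2^r. of_bool (stopping_cell f \<theta> r a) * (\<bar>f t\<bar> * of_bool (cell_index r t = a))))"
    using I by (rule has_bochner_integral_integral_eq[symmetric])
  also have "\<dots> \<le> (LINT t|unit_measure. \<bar>f t\<bar>)"
  proof (rule integral_mono)
    show "integrable unit_measure (\<lambda>t. \<bar>f t\<bar>)" using f by simp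
  qed (use I le in \<open>simp_all add: has_bochner_integral_iff\<close>)
  finally show ?thesis .
qed

text \<open>The exceptional set consists of the stopping cells and of the points where too much mass
  of stopping cells is seen after flipping a digit. A stopping cell of rank \<open>r\<close> is seen through digit
  \<open>j < r\<close> with weight \<open>2 ^ j\<close> on a cell of measure \<open>2 ^ (-r)\<close>; the sum over \<open>j\<close> is bounded by its mass. So
  both parts have integral at most the norm of \<open>f\<close>, whence the factor \<open>2\<close>.

  For \<open>x\<close> outside the exceptional set a cell occurring in \<open>near_mass f s x\<close> either has mean at most
  \<open>\<theta>\<close>, or lies in a stopping cell. The latter does not contain \<open>x\<close>, so its rank exceeds \<open>j\<close>, and it
  is itself seen from \<open>x\<close> after flipping digit \<open>j\<close>; its mass has been accounted for.\<close>

lemma near_mass_weak_type: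
  assumes f: "integrable unit_measure f" and \<theta>: "\<theta> > 0"
  shows "\<exists>B\<in>sets unit_measure. emeasure unit_measure B \<le> ennreal (2 * (LINT t|unit_measure. \<bar>f t\<bar>) / \<theta>) \<and>
    (\<forall>x\<in>{0..<1} - B. \<forall>s. near_mass f s x \<le> 3 * \<theta>)"
proof -
  define stop where "stop = stopping_cell f \<theta>"
  define G where "G r a = (if stop r a then cell_mass f r a else 0)" for r a
  \<comment> \<open>what \<open>x\<close> sees of the stopping cells of rank \<open>r\<close>, by flipping a digit or by lying in one\<close>
  define H where "H r x = (\<Sum>j<r. 2 ^ j * G r (flip_bit (r - 1 - j) (cell_index r x))) + \<theta> * of_bool (stop r (cell_index r x))" for r x
  define B where "B R = {x \<in> {0..<1}. \<theta> \<le> (\<Sum>r<R. H r x)}" for R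
  have G0: "G r a \<ge> 0" for r a by (simp add: G_def cell_mass_nonneg)
  have H0: "H r x \<ge> 0" for r x using G0 \<theta> unfolding H_def by (intro add_nonneg_nonneg sum_nonneg) auto
  define S where "S r = (\<Sum>a<2^r. G r a)" for r
  have S0: "S r \<ge> 0" for r using G0 by (auto simp: S_def intro: sum_nonneg)
  have intH: "\<exists>I. has_bochner_integral unit_measure (H r) I \<and> I \<le> 2 * S r" for r
  proof -
    have "has_bochner_integral unit_measure (H r) ((\<Sum>j<r. 2 ^ j * ((\<Sum>a<2^r. G r (flip_bit (r - 1 - j) a)) / 2 ^ r)) + \<theta> * ((\<Sum>a<2^r. of_bool (stop r a)) / 2 ^ r))"
      unfolding H_def
      by (intro has_bochner_integral_add has_bochner_integral_sum has_bochner_integral_mult_right has_integral_step)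
    moreover have "(\<Sum>j<r. 2 ^ j * ((\<Sum>a<2^r. G r (flip_bit (r - 1 - j) a)) / 2 ^ r)) = (\<Sum>j<r. 2 ^ j * (S r / 2 ^ r))"
      unfolding S_def by (intro sum.cong refl arg_cong2[where f = "(*)"] arg_cong2[where f = "(/)"] sum_flip_bit) auto
    moreover have "(\<Sum>j<r. 2 ^ j * (S r / 2 ^ r)) \<le> S r"
    proof -
      have "(\<Sum>j<r. 2 ^ j * (S r / 2 ^ r)) = (2 ^ r - 1) / 2 ^ r * S r"
        unfolding sum_distrib_right[symmetric] by (simp add: geometric_sum)
      also have "\<dots> \<le> 1 * S r" using S0 by (intro mult_right_mono) auto
      finally show ?thesis by simp
    qed
    moreover have "\<theta> * ((\<Sum>a<2^r. of_bool (stop r a)) / 2 ^ r) \<le> S r"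
    proof -
      have "\<theta> * ((\<Sum>a<2^r. of_bool (stop r a)) / 2 ^ r) = (\<Sum>a<2^r. \<theta> / 2 ^ r * of_bool (stop r a))"
        unfolding sum_divide_distrib sum_distrib_left by (simp del: sum_of_bool_eq)
      also have "\<dots> \<le> S r"
        unfolding S_def
      proof (rule sum_mono)
        fix a
        show "\<theta> / 2 ^ r * of_bool (stop r a) \<le> G r a"
        proof (cases "stop r a")
          case True
          then have "\<theta> < cell_mass f r a * 2 ^ r" by (simp add: stop_def stopping_cell_def mult.commute)
          then show ?thesis using True by (simp add: G_def pos_divide_le_eq)
        qed (simp add: G_def)
      qed
      finally show ?thesis .
    qed
    ultimately show ?thesis by (intro exI[of _ "(\<Sum>j<r. 2 ^ j * (S r / 2 ^ r)) + \<theta> * ((\<Sum>a<2^r. of_bool (stop r a)) / 2 ^ r)"]) auto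
  qed
  then obtain I where I: "\<And>r. has_bochner_integral unit_measure (H r) (I r)" "\<And>r. I r \<le> 2 * S r"
    by metis
  have IR: "has_bochner_integral unit_measure (\<lambda>x. \<Sum>r<R. H r x) (\<Sum>r<R. I r)" for R
    by (intro has_bochner_integral_sum I)
  have sumI: "(\<Sum>r<R. I r) \<le> 2 * (LINT t|unit_measure. \<bar>f t\<bar>)" for R
  proof -
    have "(\<Sum>r<R. I r) \<le> 2 * (\<Sum>r<R. S r)" unfolding sum_distrib_left by (intro sum_mono I)
    also have "(\<Sum>r<R. S r) \<le> (LINT t|unit_measure. \<bar>f t\<bar>)"
      using sum_stopping_mass[OF f, of \<theta> R] by (simp add: S_def G_def stop_def)
    finally show ?thesis by simp
  qed
  have Bsets: "B R \<in> sets unit_measure" for R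
  proof -
    have "(\<lambda>x. \<Sum>r<R. H r x) \<in> borel_measurable unit_measure"
      using IR by (simp add: has_bochner_integral_iff borel_measurable_integrable)
    then have "{x \<in> space unit_measure. \<theta> \<le> (\<Sum>r<R. H r x)} \<in> sets unit_measure" by measurable
    then show ?thesis by (simp add: B_def)
  qed
  have "emeasure unit_measure (B R) \<le> ennreal (2 * (LINT t|unit_measure. \<bar>f t\<bar>) / \<theta>)" for R
  proof -
    have "emeasure unit_measure {x \<in> space unit_measure. \<theta> \<le> (\<Sum>r<R. H r x)} \<le> ennreal (1 / \<theta> * (LINT x|unit_measure. (\<Sum>r<R. H r x)))"
      using IR[of R] H0 \<theta> by (intro integral_Markov_inequality) (auto simp: has_bochner_integral_iff intro: sum_nonneg)
    also have "\<dots> \<le> ennreal (2 * (LINT t|unit_measure. \<bar>f t\<bar>) / \<theta>)"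
      using IR[of R] sumI[of R] \<theta> by (intro ennreal_leI) (simp add: has_bochner_integral_iff divide_right_mono)
    finally show ?thesis by (simp add: B_def)
  qed
  moreover have "incseq B"
  proof (rule incseq_SucI)
    show "B R \<subseteq> B (Suc R)" for R
      using H0[of R] by (force simp: B_def intro: add_increasing2)
  qed
  ultimately have measB: "emeasure unit_measure (\<Union>R. B R) \<le> ennreal (2 * (LINT t|unit_measure. \<bar>f t\<bar>) / \<theta>)"
    using Bsets by (subst SUP_emeasure_incseq[symmetric]) (auto intro: SUP_least)
  have "near_mass f s x \<le> 3 * \<theta>" if x: "x \<in> {0..<1} - (\<Union>R. B R)" for x s
  proof -
    have x01: "x \<in> {0..<1}" using x by simp
    have sumH: "(\<Sum>r<R. H r x) < \<theta>" for R using x by (auto simp: B_def not_le)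
    have nostop: "\<not> stop r (cell_index r x)" for r
    proof
      assume "stop r (cell_index r x)"
      then have "\<theta> \<le> H r x" unfolding H_def using G0 by (simp add: sum_nonneg)
      also have "\<dots> \<le> (\<Sum>r<Suc r. H r x)" using H0 by (intro member_le_sum) auto
      finally show False using sumH[of "Suc r"] by simp
    qed
    have centre: "2 ^ r * cell_mass f r (cell_index r x) \<le> \<theta>" for r
    proof (rule ccontr)
      assume "\<not> ?thesis"
      then obtain p where "p \<le> r" "stop p (cell_index r x div 2 ^ (r - p))"
        using ex_stopping_cell[OF cell_index_less[OF x01, of r], of \<theta> f] by (auto simp: stop_def)
      then show False using nostop[of p] cell_index_coarser[of x p r] x01 by simp
    qed
    have flipped: "2 ^ j * cell_mass f s (flip_bit (s - 1 - j) (cell_index s x)) \<le>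
        \<theta> / 2 ^ s * 2 ^ j + (\<Sum>r<Suc s. of_bool (j < r) * (2 ^ j * G r (flip_bit (r - 1 - j) (cell_index r x))))"
      (is "?l \<le> ?m + ?r") if j: "j < s" for j
    proof -
      define b where "b = flip_bit (s - 1 - j) (cell_index s x)"
      have b: "b < 2 ^ s" unfolding b_def using j by (intro flip_bit_less cell_index_less x01) auto
      have m0: "?m \<ge> 0" using \<theta> by simp
      have r0: "?r \<ge> 0" using G0 by (intro sum_nonneg) auto
      show ?thesis
      proof (cases "2 ^ s * cell_mass f s b > \<theta>")
        case False
        then have "cell_mass f s b \<le> \<theta> / 2 ^ s" by (simp add: pos_le_divide_eq mult.commute)
        then have "?l \<le> ?m" unfolding b_def[symmetric] by (subst mult.commute) (intro mult_right_mono, auto)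
        then show ?thesis using r0 by simp
      next
        case True
        then obtain r where r: "r \<le> s" "stop r (b div 2 ^ (s - r))"
          using ex_stopping_cell[OF b] by (auto simp: stop_def)
        have c: "cell_index r x = cell_index s x div 2 ^ (s - r)"
          using cell_index_coarser[of x r s] r(1) x01 by simp
        have jr: "j < r"
        proof (rule ccontr)
          assume "\<not> j < r"
          then have "b div 2 ^ (s - r) = cell_index r x"
            unfolding b_def flip_bit_div_exp c using j by auto
          then show False using nostop[of r] r(2) by simp
        qed
        have "s - 1 - j - (s - r) = r - 1 - j" "\<not> s - 1 - j < s - r" using jr r(1) by auto
        then have bd: "b div 2 ^ (s - r) = flip_bit (r - 1 - j) (cell_index r x)"
          unfolding b_def flip_bit_div_exp c by simp
        have "cell_mass f s b \<le> G r (flip_bit (r - 1 - j) (cell_index r x))"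
          using cell_mass_mono[OF f r(1), of b] r(2) by (simp add: G_def bd)
        then have "?l \<le> of_bool (j < r) * (2 ^ j * G r (flip_bit (r - 1 - j) (cell_index r x)))"
          using jr by (simp add: b_def)
        also have "\<dots> \<le> ?r" using r(1) G0 by (intro member_le_sum) auto
        finally show ?thesis using m0 by linarith
      qed
    qed
    have "(\<Sum>j<s. 2 ^ j * cell_mass f s (flip_bit (s - 1 - j) (cell_index s x))) \<le>
      (\<Sum>j<s. \<theta> / 2 ^ s * 2 ^ j) + (\<Sum>j<s. \<Sum>r<Suc s. of_bool (j < r) * (2 ^ j * G r (flip_bit (r - 1 - j) (cell_index r x))))"
      unfolding sum.distrib[symmetric] by (intro sum_mono flipped) simp
    also have "(\<Sum>j<s. \<theta> / 2 ^ s * 2 ^ j) = \<theta> * (2 ^ s - 1) / 2 ^ s"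
      unfolding sum_distrib_left[symmetric] by (simp add: geometric_sum)
    also have "\<dots> \<le> \<theta>" using \<theta> by (simp add: field_simps)
    also have "(\<Sum>j<s. \<Sum>r<Suc s. of_bool (j < r) * (2 ^ j * G r (flip_bit (r - 1 - j) (cell_index r x)))) =
      (\<Sum>r<Suc s. \<Sum>j<s. of_bool (j < r) * (2 ^ j * G r (flip_bit (r - 1 - j) (cell_index r x))))"
      by (rule sum.swap)
    also have "\<dots> = (\<Sum>r<Suc s. \<Sum>j<r. 2 ^ j * G r (flip_bit (r - 1 - j) (cell_index r x)))"
      by (intro sum.cong[OF refl] sum.mono_neutral_cong_right) auto
    also have "\<dots> \<le> (\<Sum>r<Suc s. H r x)" unfolding H_def using \<theta> by (intro sum_mono) simp
    also have "\<dots> \<le> \<theta>" using sumH[of "Suc s"] by simp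
    finally show ?thesis using centre[of s] by (simp add: near_mass_def)
  qed
  then show ?thesis using measB Bsets by (intro bexI[of _ "\<Union>R. B R"]) auto
qed

section \<open>Almost everywhere convergence\<close>

lemma AE_of_small_exceptions:
  assumes "\<And>e. e > 0 \<Longrightarrow> \<exists>B\<in>sets M. emeasure M B \<le> ennreal e \<and> (\<forall>x\<in>space M - B. P x)"
  shows "AE x in M. P x"
proof -
  obtain B where B: "\<And>e. e > 0 \<Longrightarrow> B e \<in> sets M \<and> emeasure M (B e) \<le> ennreal e \<and> (\<forall>x\<in>space M - B e. P x)"
    using assms by metis
  define N where "N = (\<Inter>i. B (inverse (real (Suc i))))"
  have N: "N \<in> sets M" unfolding N_def using B by (intro sets.countable_INT') auto
  have small: "emeasure M N \<le> ennreal e" if e: "e > 0" for e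
  proof -
    obtain i where i: "inverse (real (Suc i)) < e" using reals_Archimedean[OF e] by blast
    have "emeasure M N \<le> emeasure M (B (inverse (real (Suc i))))"
      unfolding N_def using B by (intro emeasure_mono) auto
    also have "\<dots> \<le> ennreal (inverse (real (Suc i)))" using B[of "inverse (real (Suc i))"] by simp
    also have "\<dots> \<le> ennreal e" using i by (intro ennreal_leI) simp
    finally show ?thesis .
  qed
  have "emeasure M N \<le> 0"
    by (rule ennreal_le_epsilon) (simp add: small)
  then have "N \<in> null_sets M" using N by auto
  moreover have "{x \<in> space M. \<not> P x} \<subseteq> N" 
  proof
    fix x assume x: "x \<in> {x \<in> space M. \<not> P x}"
    have "x \<in> B (inverse (real (Suc i)))" for i
      using B[of "inverse (real (Suc i))"] x by auto
    then show "x \<in> N" by (simp add: N_def)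
  qed
  ultimately show ?thesis by (rule AE_I')
qed

context norlund_weights
begin

lemma norlund_mean_atMost: "norlund_mean q f n x = (\<Sum>k\<le>n. q (n - k) * walsh_partial_sum f k x) / weight_sum q n"
proof -
  have "(\<Sum>k\<le>n. q (n - k) * walsh_partial_sum f k x) = (\<Sum>k=1..n. q (n - k) * walsh_partial_sum f k x)"
    by (rule sum.mono_neutral_right) (auto simp: walsh_partial_sum_def not_less_eq_eq)
  then show ?thesis by (simp add: norlund_mean_def)
qed

lemma weight_sum_reverse: "(\<Sum>k\<le>n. q (n - k)) = weight_sum q n"
  unfolding weight_sum_def by (rule sum.reindex_bij_witness[of _ "\<lambda>k. n - k" "\<lambda>k. n - k"]) auto

text \<open>The partial sums of a polynomial of order \<open>m\<close> are eventually constant, so only the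
  weights \<open>q (n - k)\<close> with \<open>k < m\<close> matter, and each of them is at most \<open>Q n / (n - m + 1)\<close> by monotonicity.\<close>

lemma norlund_mean_walsh_poly_tendsto:
  "(\<lambda>n. norlund_mean q (walsh_poly \<alpha> m) n x) \<longlonglongrightarrow> walsh_poly \<alpha> m x"
proof -
  define g where "g = walsh_poly \<alpha> m x"
  define d where "d k = walsh_partial_sum (walsh_poly \<alpha> m) k x - g" for k
  define D where "D = (\<Sum>k<m. \<bar>d k\<bar>)"
  have d0: "d k = 0" if "k \<ge> m" for k
    using that by (simp add: d_def g_def walsh_partial_sum_walsh_poly min_absorb1)
  have bound: "\<bar>norlund_mean q (walsh_poly \<alpha> m) n x - g\<bar> \<le> D * inverse (real (Suc (n - m)))" if n: "n \<ge> m" for n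
  proof -
    have Q: "weight_sum q n > 0" by (rule weight_pos)
    have "norlund_mean q (walsh_poly \<alpha> m) n x - g = (\<Sum>k\<le>n. q (n - k) * d k) / weight_sum q n"
    proof -
      have "(\<Sum>k\<le>n. q (n - k) * d k) = (\<Sum>k\<le>n. q (n - k) * walsh_partial_sum (walsh_poly \<alpha> m) k x) - weight_sum q n * g"
        unfolding weight_sum_reverse[symmetric] d_def by (simp add: right_diff_distrib sum_subtractf sum_distrib_right)
      then show ?thesis using Q by (simp add: norlund_mean_atMost diff_divide_distrib)
    qed
    also have "(\<Sum>k\<le>n. q (n - k) * d k) = (\<Sum>k<m. q (n - k) * d k)"
      using n d0 by (intro sum.mono_neutral_right) auto
    also have "(\<Sum>k<m. q (n - k) * d k) / weight_sum q n = (\<Sum>k<m. q (n - k) / weight_sum q n * d k)"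
      by (simp add: sum_divide_distrib)
    finally have "\<bar>norlund_mean q (walsh_poly \<alpha> m) n x - g\<bar> \<le> (\<Sum>k<m. \<bar>q (n - k) / weight_sum q n * d k\<bar>)"
      using sum_abs by metis
    also have "\<dots> \<le> (\<Sum>k<m. inverse (real (Suc (n - m))) * \<bar>d k\<bar>)"
    proof (rule sum_mono)
      fix k assume k: "k \<in> {..<m}"
      have "real (Suc (n - m)) * q (n - k) \<le> real (Suc (n - k)) * q (n - k)"
        using k n q_nonneg by (intro mult_right_mono) auto
      also have "\<dots> \<le> weight_sum q (n - k)" by (rule q_le_weight)
      also have "\<dots> \<le> weight_sum q n" by (rule weight_mono) simp
      finally have "q (n - k) / weight_sum q n \<le> inverse (real (Suc (n - m)))"
        using Q by (simp add: field_simps del: of_nat_Suc)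
      then have "\<bar>q (n - k) / weight_sum q n\<bar> \<le> inverse (real (Suc (n - m)))"
        using Q q_nonneg[of "n - k"] by simp
      then show "\<bar>q (n - k) / weight_sum q n * d k\<bar> \<le> inverse (real (Suc (n - m))) * \<bar>d k\<bar>"
        unfolding abs_mult by (intro mult_right_mono) auto
    qed
    finally show ?thesis by (simp add: D_def sum_distrib_left mult.commute)
  qed
  have "(\<lambda>n. D * inverse (real (Suc n))) \<longlonglongrightarrow> D * 0"
    by (intro tendsto_intros LIMSEQ_inverse_real_of_nat)
  then have lim: "(\<lambda>n. D * inverse (real (Suc n))) \<longlonglongrightarrow> 0" by simp
  have "(\<lambda>n. norlund_mean q (walsh_poly \<alpha> m) (n + m) x - g) \<longlonglongrightarrow> 0"
  proof (rule Lim_null_comparison[OF _ lim], intro always_eventually allI)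
    show "norm (norlund_mean q (walsh_poly \<alpha> m) (n + m) x - g) \<le> D * inverse (real (Suc n))" for n
      using bound[of "n + m"] by simp
  qed
  then have "(\<lambda>n. norlund_mean q (walsh_poly \<alpha> m) (n + m) x) \<longlonglongrightarrow> g"
    by (simp add: LIM_zero_iff)
  then show ?thesis unfolding g_def by (rule LIMSEQ_offset)
qed

lemma abs_norlund_mean_le_near_mass:
  assumes K: "\<And>N. (\<Sum>s\<le>N. weight_sum q (2 ^ s)) \<le> K * weight_sum q (2 ^ N)"
    and f: "integrable unit_measure f" and x: "x \<in> {0..<1}" and n: "n \<ge> 1"
    and near: "\<And>s. near_mass f s x \<le> c"
  shows "\<bar>norlund_mean q f n x\<bar> \<le> 6 * (K + 2) * c"
proof -
  obtain N where N: "2 ^ N \<le> n" "n < 2 ^ (N + 1)" using ex_power_ivl1[of 2 n] n by auto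
  have c0: "c \<ge> 0"
  proof -
    have "near_mass f 0 x \<ge> 0" by (simp add: near_mass_def cell_mass_nonneg)
    then show ?thesis using near[of 0] by linarith
  qed
  have Qs: "(\<Sum>s\<le>N + 1. weight_sum q (2 ^ s)) \<le> (K + 2) * weight_sum q n"
  proof -
    have "(\<Sum>s\<le>N + 1. weight_sum q (2 ^ s)) = (\<Sum>s\<le>N. weight_sum q (2 ^ s)) + weight_sum q (2 * 2 ^ N)" by simp
    also have "\<dots> \<le> K * weight_sum q (2 ^ N) + 2 * weight_sum q (2 ^ N)"
      by (intro add_mono K weight_double)
    also have "\<dots> = (K + 2) * weight_sum q (2 ^ N)" by (simp add: algebra_simps)
    also have "\<dots> \<le> (K + 2) * weight_sum q n"
    proof (intro mult_left_mono weight_mono N)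
      have "0 < K * weight_sum q 1" using K[of 0] weight_pos[of 1] by simp
      then show "0 \<le> K + 2" using weight_pos[of 1] by (simp add: zero_less_mult_iff)
    qed
    finally show ?thesis .
  qed
  have "weight_sum q n * \<bar>norlund_mean q f n x\<bar> \<le> 6 * (\<Sum>s\<le>N + 1. weight_sum q (2 ^ s) * near_mass f s x)"
    by (rule abs_norlund_mean_le[OF f x N(2)])
  also have "(\<Sum>s\<le>N + 1. weight_sum q (2 ^ s) * near_mass f s x) \<le> (\<Sum>s\<le>N + 1. weight_sum q (2 ^ s) * c)"
    by (intro sum_mono mult_left_mono near less_imp_le[OF weight_pos])
  also have "\<dots> = (\<Sum>s\<le>N + 1. weight_sum q (2 ^ s)) * c" by (rule sum_distrib_right[symmetric])
  also have "\<dots> \<le> (K + 2) * weight_sum q n * c" by (intro mult_right_mono Qs c0)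
  finally have "weight_sum q n * \<bar>norlund_mean q f n x\<bar> \<le> weight_sum q n * (6 * (K + 2) * c)" by (simp add: mult_ac)
  then show ?thesis using weight_pos[of n] by (simp only: mult_le_cancel_left_pos)
qed

text \<open>The usual passage from a maximal inequality to convergence: a remainder of small norm
  changes the oscillation of the means at \<open>x\<close> by a multiple of \<open>\<theta>\<close> only, off a set of small
  measure.\<close>

theorem norlund_mean_AE_tendsto:
  assumes K: "\<And>N. (\<Sum>s\<le>N. weight_sum q (2 ^ s)) \<le> K * weight_sum q (2 ^ N)"
    and f: "integrable unit_measure f"
  shows "AE x in unit_measure. (\<lambda>n. norlund_mean q f n x) \<longlonglongrightarrow> f x"
proof -
  \<comment> \<open>\<open>6 * (K + 2) * 3\<close> from the means of the remainder, \<open>1\<close> from its value at \<open>x\<close> and \<open>1\<close> from the polynomial\<close>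
  define C where "C = 6 * (K + 2) * 3 + 2"
  have "0 < K * weight_sum q 1" using K[of 0] weight_pos[of 1] by simp
  then have "K > 0" using weight_pos[of 1] by (simp add: zero_less_mult_iff)
  then have C: "C > 0" by (simp add: C_def)
  have near_limit: "AE x in unit_measure. \<forall>\<^sub>F n in sequentially. \<bar>norlund_mean q f n x - f x\<bar> \<le> C * \<theta>"
    if \<theta>: "\<theta> > 0" for \<theta> :: real
  proof (rule AE_of_small_exceptions)
    fix e :: real assume e: "e > 0"
    then have "e * \<theta> / 3 > 0" using \<theta> by simp
    then obtain \<alpha> m where p: "(LINT x|unit_measure. \<bar>f x - walsh_poly \<alpha> m x\<bar>) < e * \<theta> / 3"
      using integrable_imp_walsh_approximable[OF f] unfolding walsh_approximable_def by meson
    define h where "h x = f x - walsh_poly \<alpha> m x" for x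
    define \<delta> where "\<delta> = (LINT x|unit_measure. \<bar>h x\<bar>)"
    have h: "integrable unit_measure h" unfolding h_def using f integrable_walsh_poly by auto
    obtain B where B: "B \<in> sets unit_measure" "emeasure unit_measure B \<le> ennreal (2 * \<delta> / \<theta>)"
        "\<And>x s. x \<in> {0..<1} - B \<Longrightarrow> near_mass h s x \<le> 3 * \<theta>"
      using near_mass_weak_type[OF h \<theta>] unfolding \<delta>_def by blast
    define A where "A = {x \<in> space unit_measure. \<theta> \<le> \<bar>h x\<bar>}"
    have A: "A \<in> sets unit_measure" unfolding A_def using borel_measurable_integrable[OF h] by measurable
    have "emeasure unit_measure A \<le> ennreal (1 / \<theta> * \<delta>)"
      unfolding A_def \<delta>_def using h \<theta> by (intro integral_Markov_inequality) auto
    then have "emeasure unit_measure (A \<union> B) \<le> ennreal (1 / \<theta> * \<delta>) + ennreal (2 * \<delta> / \<theta>)"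
      using emeasure_subadditive[OF A B(1)] B(2) by (meson add_mono order.trans)
    also have "\<dots> = ennreal (3 * \<delta> / \<theta>)"
    proof -
      have "\<delta> \<ge> 0" unfolding \<delta>_def by (intro integral_nonneg_AE) auto
      then show ?thesis using \<theta> by (subst ennreal_plus[symmetric]) (auto simp: field_simps)
    qed
    also have "\<dots> \<le> ennreal e"
      using p \<theta> by (intro ennreal_leI) (simp add: \<delta>_def h_def field_simps)
    finally have AB: "emeasure unit_measure (A \<union> B) \<le> ennreal e" .
    have "\<forall>\<^sub>F n in sequentially. \<bar>norlund_mean q f n x - f x\<bar> \<le> C * \<theta>" if x: "x \<in> space unit_measure - (A \<union> B)" for x
    proof -
      define g where "g = walsh_poly \<alpha> m"
      have x01: "x \<in> {0..<1}" using x by simp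
      have "\<forall>\<^sub>F n in sequentially. \<bar>norlund_mean q g n x - g x\<bar> < \<theta>"
        using tendstoD[OF norlund_mean_walsh_poly_tendsto \<theta>] by (simp add: dist_real_def g_def)
      then show ?thesis using eventually_ge_at_top[of 1]
      proof eventually_elim
        case (elim n)
        have "\<bar>norlund_mean q h n x\<bar> \<le> 6 * (K + 2) * (3 * \<theta>)"
          using elim(2) B(3)[of x] x by (intro abs_norlund_mean_le_near_mass K h x01) auto
        moreover have "norlund_mean q h n x = norlund_mean q f n x - norlund_mean q g n x"
          unfolding h_def g_def by (intro norlund_mean_diff f integrable_walsh_poly)
        moreover have "\<bar>h x\<bar> < \<theta>" using x by (auto simp: A_def)
        moreover have "h x = f x - g x" by (simp add: h_def g_def)
        moreover have "C * \<theta> = 6 * (K + 2) * (3 * \<theta>) + \<theta> + \<theta>" by (simp add: C_def algebra_simps)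
        ultimately show ?case using elim(1) by linarith
      qed
    qed
    then show "\<exists>B\<in>sets unit_measure. emeasure unit_measure B \<le> ennreal e \<and>
        (\<forall>x\<in>space unit_measure - B. \<forall>\<^sub>F n in sequentially. \<bar>norlund_mean q f n x - f x\<bar> \<le> C * \<theta>)"
      using AB A B(1) by (intro bexI[of _ "A \<union> B"]) auto
  qed
  have "AE x in unit_measure. \<forall>i. \<forall>\<^sub>F n in sequentially. \<bar>norlund_mean q f n x - f x\<bar> \<le> C * inverse (real (Suc i))"
    unfolding AE_all_countable by (intro allI near_limit) simp
  then show ?thesis
  proof eventually_elim
    case (elim x)
    show ?case
    proof (rule tendstoI)
      fix e :: real assume "e > 0"
      then have "e / C > 0" using C by simp
      then obtain i where "inverse (real (Suc i)) < e / C" using reals_Archimedean by blast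
      then have "C * inverse (real (Suc i)) < e" using C by (simp add: pos_less_divide_eq mult.commute)
      then show "\<forall>\<^sub>F n in sequentially. dist (norlund_mean q f n x) (f x) < e"
        using eventually_mono[OF spec[OF elim, of i], of "\<lambda>n. \<bar>norlund_mean q f n x - f x\<bar> < e"]
        by (simp add: dist_real_def)
    qed
  qed
qed

end

section \<open>Walsh polynomials with everywhere large partial sums\<close>

lemma dirichlet_cong:
  assumes "\<And>k. k < m \<Longrightarrow> \<rho> k = \<sigma> k" "n \<le> 2 ^ m"
  shows "dirichlet \<rho> n = dirichlet \<sigma> n"
  unfolding dirichlet_def
proof (intro sum.cong refl walsh_char_cong)
  fix l k assume "l \<in> {..<n}" "bit l k"
  then show "\<rho> k = \<sigma> k" using assms bit_less_exp[of l m k] by auto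
qed

text \<open>The high digits of \<open>n\<close> act on both factors by the same sign and cancel in the product. For
  the remaining low part the Dirichlet kernel is a nonnegative tent, and the character is \<open>-1\<close> if the
  digit at \<open>j\<close> is set.\<close>

lemma walsh_char_mult_dirichlet_sign:
  assumes \<rho>: "sign_seq \<rho>" and init: "\<And>k. k < j \<Longrightarrow> \<rho> k = 1" and j: "\<rho> j = -1"
  shows "if bit n j then walsh_char \<rho> n * dirichlet \<rho> n \<le> 0 else walsh_char \<rho> n * dirichlet \<rho> n \<ge> 0"
proof -
  define b c where "b = n mod 2 ^ Suc j" and "c = n div 2 ^ Suc j"
  have b: "b < 2 ^ Suc j" by (simp add: b_def)
  have n: "n = 2 ^ Suc j * c + b" unfolding b_def c_def by (simp only: mult_div_mod_eq)
  define w where "w = walsh_char \<rho> (2 ^ Suc j * c)"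
  have "walsh_char \<rho> n = w * walsh_char \<rho> b"
    unfolding n w_def by (rule walsh_char_block[OF b])
  moreover have "dirichlet \<rho> n = w * dirichlet \<rho> b"
    using dirichlet_split[of \<rho> j "Suc j" n, OF j] by (simp add: w_def b_def c_def)
  moreover have "w * w = 1"
    using abs_walsh_char[OF \<rho>, of "2 ^ Suc j * c"] unfolding w_def by (metis abs_mult_self_eq mult_1)
  ultimately have eq: "walsh_char \<rho> n * dirichlet \<rho> n = walsh_char \<rho> b * dirichlet \<rho> b"
    by (simp add: algebra_simps)
  have bit: "bit n j \<longleftrightarrow> bit b j" unfolding n using bit_block[OF b, of c j] by simp
  show ?thesis
  proof (cases "b < 2 ^ j")
    case True
    then have "\<not> bit b j" using bit_less_exp by blast
    then show ?thesis
      unfolding eq bit using walsh_char_initial[OF init True] dirichlet_initial[of j \<rho> b, OF init] True by simp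
  next
    case False
    define b' where "b' = b - 2 ^ j"
    have b': "b = 2 ^ j * 1 + b'" "b' < 2 ^ j" using False b by (auto simp: b'_def)
    have "bit b j" unfolding b'(1) using bit_block[OF b'(2), of 1 j] by (simp add: bit_0)
    moreover have "walsh_char \<rho> b = -1"
      unfolding b'(1) walsh_char_block[OF b'(2)] using walsh_char_initial[OF init b'(2)] j by simp
    moreover have "dirichlet \<rho> b \<ge> 0"
    proof -
      have "b \<le> 2 * 2 ^ j" using b by simp
      then have "real b \<le> real (2 * 2 ^ j)" by (rule of_nat_mono)
      then show ?thesis using dirichlet_tent[of j \<rho> b, OF init j b] by (simp add: abs_if)
    qed
    ultimately show ?thesis unfolding eq bit by simp
  qed
qed

lemma ex_third_of_power_4: "\<exists>n::nat. 3 * n + 1 = 4 ^ r"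
proof (induction r)
  case (Suc r)
  then obtain n where "3 * n + 1 = (4::nat) ^ r" by blast
  then have "3 * (4 * n + 1) + 1 = (4::nat) ^ Suc r" by simp
  then show ?case by blast
qed auto

text \<open>With \<open>n\<close> close to \<open>2 ^ m / 3\<close> the remainder of \<open>n\<close> modulo \<open>2 ^ (j + 1)\<close> is close to one or two
  thirds of the modulus for every \<open>j < m\<close>, so the tents are high at all scales simultaneously.\<close>

lemma abs_dirichlet_third_ge:
  assumes \<rho>: "sign_seq \<rho>" and init: "\<And>k. k < j \<Longrightarrow> \<rho> k = 1" and j: "\<rho> j = -1" "j < m"
    and n: "3 * n + 1 = 2 ^ m"
  shows "\<bar>dirichlet \<rho> n\<bar> \<ge> 2 ^ j / 3"
proof -
  define b where "b = n mod 2 ^ Suc j"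
  have b: "b < 2 ^ Suc j" by (simp add: b_def)
  have "2 ^ Suc j dvd (2::nat) ^ m" using j(2) by (intro le_imp_power_dvd) auto
  then have "(3 * n + 1) mod 2 ^ Suc j = 0" unfolding n by auto
  then have "(3 * b + 1) mod 2 ^ Suc j = 0" unfolding b_def by (metis mod_add_left_eq mod_mult_right_eq)
  then obtain c where c: "3 * b + 1 = 2 ^ Suc j * c" by (metis dvd_def mod_eq_0_iff_dvd)
  have "2 ^ Suc j * c < 2 ^ Suc j * 3" using b unfolding c[symmetric] by simp
  then have "c < 3" by simp
  moreover have "c \<noteq> 0" using c by (intro notI) simp
  ultimately consider "c = 1" | "c = 2" by linarith
  then have "2 ^ j / 3 \<le> 2 ^ j - \<bar>2 ^ j - real b\<bar>"
  proof cases
    case 1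
    then have "real (3 * b + 1) = real (2 * 2 ^ j)" using c by simp
    then have "3 * real b + 1 = 2 * 2 ^ j" by simp
    moreover have "(1::real) \<le> 2 ^ j" by simp
    ultimately show ?thesis by linarith
  next
    case 2
    then have "real (3 * b + 1) = real (4 * 2 ^ j)" using c by simp
    then have "3 * real b + 1 = 4 * 2 ^ j" by simp
    moreover have "(1::real) \<le> 2 ^ j" by simp
    ultimately show ?thesis by linarith
  qed
  then show ?thesis using abs_dirichlet_tent[OF \<rho> init j(1), of n] by (simp add: b_def)
qed

definition bit_sign :: "nat \<Rightarrow> nat \<Rightarrow> real" where
  "bit_sign a s = (if bit a s then -1 else 1)"

lemma sign_seq_bit_sign: "sign_seq (bit_sign a)"
  by (auto simp: sign_seq_def bit_sign_def)

text \<open>A lower bound for the Lebesgue constant of order \<open>n\<close>: the sequences with first \<open>-1\<close> at \<open>j\<close> form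
  the fraction \<open>2 ^ (-j - 1)\<close> of all sign patterns, and each of them contributes at least \<open>2 ^ j / 3\<close>.
  So every scale \<open>j < m\<close> contributes \<open>1 / 6\<close> to the mean.\<close>

lemma sum_abs_dirichlet_ge:
  assumes n: "3 * n + 1 = 2 ^ m"
  shows "real m * 2 ^ m / 6 \<le> (\<Sum>a<2^m. of_bool (a \<noteq> 0) * \<bar>dirichlet (bit_sign a) n\<bar>)"
proof -
  \<comment> \<open>the patterns whose lowest set bit is \<open>j\<close>\<close>
  define A where "A j = (\<lambda>c. 2 ^ j * (2 * c + 1)) ` {..<2 ^ (m - 1 - j) :: nat}" for j :: nat
  have bitA: "bit (2 ^ j * (2 * c + 1)) k \<longleftrightarrow> (if k < j then False else bit (2 * c + 1) (k - j))" for j c k :: nat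
    using bit_block[of 0 j "2 * c + 1" k] by simp
  have sub: "A j \<subseteq> {..<2 ^ m}" if "j < m" for j
  proof
    fix a assume "a \<in> A j"
    then obtain c where c: "a = 2 ^ j * (2 * c + 1)" "c < 2 ^ (m - 1 - j)" by (auto simp: A_def)
    have "2 * c + 1 < 2 * 2 ^ (m - 1 - j)" using c(2) by simp
    then have "a < 2 ^ j * (2 * 2 ^ (m - 1 - j))" unfolding c(1) by (intro mult_strict_left_mono) auto
    also have "\<dots> = 2 ^ (j + Suc (m - 1 - j))" by (simp add: power_add)
    also have "j + Suc (m - 1 - j) = m" using that by simp
    finally show "a \<in> {..<2 ^ m}" by simp
  qed
  have disj: "A i \<inter> A j = {}" if "i < j" for i j
  proof -
    have False if "a \<in> A i" "a \<in> A j" for a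
    proof -
      have "bit a i" using that(1) bitA[of i _ i] by (auto simp: A_def bit_0)
      moreover have "\<not> bit a i" using that(2) bitA[of j _ i] \<open>i < j\<close> by (auto simp: A_def)
      ultimately show False by simp
    qed
    then show ?thesis by blast
  qed
  have big: "2 ^ j / 3 \<le> of_bool (a \<noteq> 0) * \<bar>dirichlet (bit_sign a) n\<bar>" if aj: "a \<in> A j" "j < m" for a j
  proof -
    obtain c where c: "a = 2 ^ j * (2 * c + 1)" using aj(1) unfolding A_def by blast
    then have "a \<noteq> 0" by simp
    moreover have "2 ^ j / 3 \<le> \<bar>dirichlet (bit_sign a) n\<bar>"
    proof (rule abs_dirichlet_third_ge[OF sign_seq_bit_sign _ _ aj(2) n])
      show "bit_sign a k = 1" if "k < j" for k
        using bitA[of j c k] that unfolding bit_sign_def c by simp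
      show "bit_sign a j = -1"
        using bitA[of j c j] unfolding bit_sign_def c by (simp add: bit_0)
    qed
    ultimately show ?thesis by simp
  qed
  have card: "card (A j) = 2 ^ (m - 1 - j)" for j
    unfolding A_def by (subst card_image) (auto simp: inj_on_def)
  have "real m * 2 ^ m / 6 = (\<Sum>j<m. real (card (A j)) * (2 ^ j / 3))"
  proof -
    have each: "real (card (A j)) * (2 ^ j / 3) = 2 ^ m / 6" if "j < m" for j
    proof -
      have "(2::real) ^ m = 2 * (2 ^ (m - 1 - j) * 2 ^ j)"
        using that by (simp flip: power_add power_Suc)
      then show ?thesis by (simp add: card)
    qed
    have "(\<Sum>j<m. real (card (A j)) * (2 ^ j / 3)) = (\<Sum>j<m. 2 ^ m / 6)"
      by (intro sum.cong refl each) simp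
    then show ?thesis by simp
  qed
  also have "\<dots> \<le> (\<Sum>j<m. \<Sum>a\<in>A j. of_bool (a \<noteq> 0) * \<bar>dirichlet (bit_sign a) n\<bar>)"
    using big by (intro sum_mono sum_bounded_below) auto
  also have "\<dots> = (\<Sum>a\<in>(\<Union>j<m. A j). of_bool (a \<noteq> 0) * \<bar>dirichlet (bit_sign a) n\<bar>)"
  proof (rule sum.UNION_disjoint[symmetric])
    show "\<forall>i\<in>{..<m}. \<forall>j\<in>{..<m}. i \<noteq> j \<longrightarrow> A i \<inter> A j = {}"
    proof (intro ballI impI)
      fix i j :: nat assume "i \<noteq> j"
      then show "A i \<inter> A j = {}" using disj[of i j] disj[of j i] by (cases i j rule: linorder_cases) auto
    qed
  qed (auto simp: A_def)
  also have "\<dots> \<le> (\<Sum>a<2^m. of_bool (a \<noteq> 0) * \<bar>dirichlet (bit_sign a) n\<bar>)"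
    using sub by (intro sum_mono2) auto
  finally show ?thesis .
qed

lemma nat_with_bits: "\<exists>n::nat. n < 2 ^ m \<and> (\<forall>k. bit n k \<longleftrightarrow> k < m \<and> P k)"
proof -
  define n :: nat where "n = horner_sum of_bool 2 (map P [0..<m])"
  have "bit n k \<longleftrightarrow> k < m \<and> P k" for k
    unfolding n_def by (auto simp: bit_horner_sum_bit_iff)
  moreover have "n < 2 ^ m" unfolding n_def using horner_sum_of_bool_2_less[of "map P [0..<m]"] by simp
  ultimately show ?thesis by blast
qed

text \<open>The digits of a point in the cell with pattern \<open>a\<close>, one for each \<open>a < 2 ^ m\<close>. Beyond the first
  \<open>m\<close> digits it carries a \<open>-1\<close> at the place \<open>m + a\<close> reserved for it and \<open>1\<close> at the places of the other
  points, so a digit \<open>m + a\<close> in the order of a character flips the sign at this one point.\<close>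

definition tagged_sign :: "nat \<Rightarrow> nat \<Rightarrow> nat \<Rightarrow> real" where
  "tagged_sign m a s = (if s < m then bit_sign a s else if s = m + a then -1 else 1)"

lemma sign_seq_tagged_sign: "sign_seq (tagged_sign m a)"
  by (auto simp: sign_seq_def tagged_sign_def bit_sign_def)

text \<open>Let \<open>\<xi>\<close> be the sign sequence of a point \<open>x\<close>. Outside the cell of \<open>x\<close>, the kernel of order \<open>h\<close>
  with \<open>h mod 2 ^ m = n\<close> is the kernel of order \<open>n\<close> up to the sign given by the high digits of \<open>h\<close>; choosing
  these according to the set \<open>E0\<close> of points with negative kernel makes all values agree in sign.

  In the cell of \<open>x\<close> itself the high digits enter the kernel and it may be huge, with the wrong
  sign. Its sign relative to \<open>X\<close> is the one of character times kernel, reversed if the cell belongs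
  to the flipped set. If \<open>E0\<close> gives the wrong sign, then the product is negative, hence the digit of \<open>h\<close>
  at the first \<open>-1\<close> is set. Adding the cell to the flipped set keeps this digit, so the product
  stays nonpositive while the relative sign is reversed.\<close>

lemma ex_aligned_order:
  assumes \<xi>: "sign_seq \<xi>" and n: "n < 2 ^ m"
  shows "\<exists>h<2 ^ (m + 2 ^ m). \<exists>X. \<bar>X\<bar> = 1 \<and> (\<forall>a<2^m.
    X * dirichlet (\<lambda>s. \<xi> s * tagged_sign m a s) h \<ge>
      of_bool (\<exists>s<m. \<xi> s * tagged_sign m a s = -1) * \<bar>dirichlet (\<lambda>s. \<xi> s * tagged_sign m a s) n\<bar>)"
proof -
  define \<rho> where "\<rho> a = (\<lambda>s. \<xi> s * tagged_sign m a s)" for a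
  have \<rho>: "sign_seq (\<rho> a)" for a unfolding \<rho>_def by (intro sign_seq_mult \<xi> sign_seq_tagged_sign)
  define own where "own a \<longleftrightarrow> (\<forall>s<m. \<rho> a s \<noteq> -1)" for a
  define good where "good E h X \<longleftrightarrow> h < 2 ^ (m + 2 ^ m) \<and> \<bar>X\<bar> = 1 \<and> h mod 2 ^ m = n \<and>
      (\<forall>l. bit h (m + l) \<longleftrightarrow> l < 2 ^ m \<and> l \<in> E) \<and>
      (\<forall>a<2^m. \<not> own a \<longrightarrow> X * dirichlet (\<rho> a) h = (if a \<in> E then -1 else 1) * dirichlet (\<rho> a) n) \<and>
      (\<forall>a<2^m. own a \<longrightarrow> X * dirichlet (\<rho> a) h = (if a \<in> E then -1 else 1) * (walsh_char (\<rho> a) h * dirichlet (\<rho> a) h))"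
    for E h X
  have ex_good: "\<exists>h X. good E h X" for E
  proof -
    obtain \<Lambda> :: nat where \<Lambda>: "\<Lambda> < 2 ^ (2 ^ m)" "\<And>k. bit \<Lambda> k \<longleftrightarrow> k < 2 ^ m \<and> k \<in> E"
      using nat_with_bits[of "2 ^ m" "\<lambda>k. k \<in> E"] by blast
    define h X where "h = 2 ^ m * \<Lambda> + n" and "X = walsh_char (\<lambda>k. \<xi> (k + m)) \<Lambda>"
    have hm: "h mod 2 ^ m = n" "h div 2 ^ m = \<Lambda>" using n by (auto simp: h_def)
    have X: "\<bar>X\<bar> = 1" unfolding X_def using \<xi> by (intro abs_walsh_char) (auto simp: sign_seq_def)
    then have XX: "X * X = 1" by (metis abs_mult_self_eq mult_1)
    have char: "walsh_char (\<rho> a) (2 ^ m * \<Lambda>) = X * (if a \<in> E then -1 else 1)" if a: "a < 2 ^ m" for a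
    proof -
      have "walsh_char (\<rho> a) (2 ^ m * \<Lambda>) = walsh_char (\<lambda>k. \<xi> (k + m) * (if k = a then -1 else 1)) \<Lambda>"
        unfolding walsh_char_shift by (intro walsh_char_cong) (auto simp: \<rho>_def tagged_sign_def)
      also have "\<dots> = X * walsh_char (\<lambda>k. if k = a then -1 else 1) \<Lambda>"
        by (simp add: walsh_char_mult X_def)
      also have "walsh_char (\<lambda>k. if k = a then -1 else 1) \<Lambda> = (if a \<in> E then -1 else 1)"
        unfolding walsh_char_def prod.delta[OF finite_bits] by (simp add: \<Lambda>(2) a)
      finally show ?thesis .
    qed
    have "h < 2 ^ (m + 2 ^ m)"
    proof -
      have "h < 2 ^ m * Suc \<Lambda>" using n by (simp add: h_def)
      also have "\<dots> \<le> 2 ^ m * 2 ^ (2 ^ m)" using \<Lambda>(1) by (intro mult_le_mono) auto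
      finally show ?thesis by (simp add: power_add)
    qed
    moreover have "bit h (m + l) \<longleftrightarrow> l < 2 ^ m \<and> l \<in> E" for l
      unfolding h_def using bit_block[OF n, of \<Lambda> "m + l"] \<Lambda>(2) by simp
    moreover have "X * dirichlet (\<rho> a) h = (if a \<in> E then -1 else 1) * dirichlet (\<rho> a) n"
      if a: "a < 2 ^ m" "\<not> own a" for a
    proof -
      obtain s where s: "s < m" "\<rho> a s = -1" using a(2) by (auto simp: own_def)
      have "dirichlet (\<rho> a) h = walsh_char (\<rho> a) (2 ^ m * \<Lambda>) * dirichlet (\<rho> a) n"
        using dirichlet_split[of "\<rho> a" s m h] s hm by simp
      then show ?thesis using XX by (simp add: char[OF a(1)])
    qed
    moreover have "X * dirichlet (\<rho> a) h = (if a \<in> E then -1 else 1) * (walsh_char (\<rho> a) h * dirichlet (\<rho> a) h)"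
      if a: "a < 2 ^ m" "own a" for a
    proof -
      have "\<rho> a k = 1" if "k < m" for k using a(2) that \<rho>[of a] by (auto simp: own_def sign_seq_def)
      then have "walsh_char (\<rho> a) n = 1" using n by (rule walsh_char_initial)
      then have "walsh_char (\<rho> a) h = X * (if a \<in> E then -1 else 1)"
        unfolding h_def walsh_char_block[OF n] by (simp add: char[OF a(1)])
      then show ?thesis by simp
    qed
    ultimately show ?thesis unfolding good_def using X hm(1) by blast
  qed
  define E0 where "E0 = {a. \<not> own a \<and> dirichlet (\<rho> a) n < 0}"
  have finish: ?thesis if good: "good E h X" and E: "\<And>a. \<not> own a \<Longrightarrow> a \<in> E \<longleftrightarrow> a \<in> E0"
    and own_ok: "\<And>a. a < 2 ^ m \<Longrightarrow> own a \<Longrightarrow> (if a \<in> E then -1 else 1) * (walsh_char (\<rho> a) h * dirichlet (\<rho> a) h) \<ge> 0" for E h X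
  proof (intro exI[of _ h] conjI exI[of _ X] allI impI)
    show "h < 2 ^ (m + 2 ^ m)" "\<bar>X\<bar> = 1" using good by (auto simp: good_def)
    fix a :: nat assume a: "a < 2 ^ m"
    have "of_bool (\<exists>s<m. \<rho> a s = -1) * \<bar>dirichlet (\<rho> a) n\<bar> \<le> X * dirichlet (\<rho> a) h"
    proof (cases "own a")
      case True
      have "X * dirichlet (\<rho> a) h = (if a \<in> E then -1 else 1) * (walsh_char (\<rho> a) h * dirichlet (\<rho> a) h)"
        using good a True unfolding good_def by blast
      then have "X * dirichlet (\<rho> a) h \<ge> 0" using own_ok[OF a True] by linarith
      then show ?thesis using True by (auto simp: own_def)
    next
      case False
      have "X * dirichlet (\<rho> a) h = (if a \<in> E then -1 else 1) * dirichlet (\<rho> a) n"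
        using good a False unfolding good_def by blast
      then have "X * dirichlet (\<rho> a) h = \<bar>dirichlet (\<rho> a) n\<bar>"
        using E[OF False] False by (auto simp: E0_def)
      then show ?thesis by auto
    qed
    then show "of_bool (\<exists>s<m. \<xi> s * tagged_sign m a s = -1) * \<bar>dirichlet (\<lambda>s. \<xi> s * tagged_sign m a s) n\<bar>
        \<le> X * dirichlet (\<lambda>s. \<xi> s * tagged_sign m a s) h"
      by (simp add: \<rho>_def)
  qed
  have own_unique: "a = b" if "a < 2 ^ m" "b < 2 ^ m" "own a" "own b" for a b
  proof (rule bit_eqI)
    fix k
    show "bit a k \<longleftrightarrow> bit b k"
    proof (cases "k < m")
      case True
      then have "\<xi> k * bit_sign a k \<noteq> -1" "\<xi> k * bit_sign b k \<noteq> -1"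
        using that(3,4) by (auto simp: own_def \<rho>_def tagged_sign_def)
      then show ?thesis using \<xi> by (auto simp: sign_seq_def bit_sign_def split: if_splits)
    next
      case False
      then show ?thesis using bit_less_exp that(1,2) by blast
    qed
  qed
  obtain h X where good: "good E0 h X" using ex_good by blast
  show ?thesis
  proof (cases "\<exists>a<2^m. own a \<and> walsh_char (\<rho> a) h * dirichlet (\<rho> a) h < 0")
    case False
    then show ?thesis by (intro finish[OF good]) (auto simp: E0_def not_less)
  next
    case True
    then obtain a where a: "a < 2 ^ m" "own a" "walsh_char (\<rho> a) h * dirichlet (\<rho> a) h < 0" by blast
    have "\<exists>p. \<rho> a p = -1"
    proof (rule ccontr)
      assume "\<not> ?thesis"
      then have one: "\<rho> a k = 1" for k using \<rho>[of a] by (auto simp: sign_seq_def)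
      have "h < 2 ^ (m + 2 ^ m)" using good by (simp add: good_def)
      then show False using a(3) walsh_char_initial[of "m + 2 ^ m" "\<rho> a" h] dirichlet_initial[of "m + 2 ^ m" "\<rho> a" h] one by simp
    qed
    define p where "p = (LEAST p. \<rho> a p = -1)"
    have p: "\<rho> a p = -1" unfolding p_def using \<open>\<exists>p. \<rho> a p = -1\<close> by (rule LeastI_ex)
    have init: "\<rho> a k = 1" if "k < p" for k
      using not_less_Least[OF that[unfolded p_def]] \<rho>[of a] by (auto simp: sign_seq_def)
    have "p \<ge> m" using p a(2) by (auto simp: own_def not_less[symmetric])
    then obtain l where l: "p = m + l" using le_Suc_ex by blast
    have "bit h p" using walsh_char_mult_dirichlet_sign[OF \<rho> init p, of h] a(3) by (auto split: if_splits)
    then have "l < 2 ^ m" "l \<in> E0" using good unfolding l good_def by auto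
    obtain h' X' where good': "good (insert a E0) h' X'" using ex_good by blast
    have "bit h' p" using good' \<open>l < 2 ^ m\<close> \<open>l \<in> E0\<close> unfolding l good_def by auto
    then have "walsh_char (\<rho> a) h' * dirichlet (\<rho> a) h' \<le> 0"
      using walsh_char_mult_dirichlet_sign[OF \<rho> init p, of h'] by simp
    then show ?thesis
      using own_unique[OF a(1) _ a(2)] a(2) by (intro finish[OF good']) auto
  qed
qed

lemma xor_less_exp:
  assumes "a < 2 ^ m" "b < 2 ^ m"
  shows "xor a b < (2::nat) ^ m"
proof -
  have "take_bit m (xor a b) = xor (take_bit m a) (take_bit m b)" by (rule take_bit_xor)
  also have "\<dots> = xor a b" by (simp only: take_bit_nat_eq_self assms)
  finally show ?thesis by (rule take_bit_nat_eq_self_iff[THEN iffD1])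
qed

lemma ex_large_average_order:
  fixes n :: nat
  assumes \<xi>: "sign_seq \<xi>" and n: "3 * n + 1 = 2 ^ m"
  shows "\<exists>h<2 ^ (m + 2 ^ m). real m / 6 \<le> \<bar>\<Sum>a<2^m. dirichlet (\<lambda>s. \<xi> s * tagged_sign m a s) h\<bar> / 2 ^ m"
proof -
  have n': "n < 2 ^ m" unfolding n[symmetric] by simp
  define \<rho> where "\<rho> a = (\<lambda>s. \<xi> s * tagged_sign m a s)" for a
  obtain h X where h: "h < 2 ^ (m + 2 ^ m)" "\<bar>X\<bar> = 1"
    "\<And>a. a < 2 ^ m \<Longrightarrow> of_bool (\<exists>s<m. \<rho> a s = -1) * \<bar>dirichlet (\<rho> a) n\<bar> \<le> X * dirichlet (\<rho> a) h"
    using ex_aligned_order[OF \<xi> n'] unfolding \<rho>_def by blast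
  obtain b :: nat where b: "b < 2 ^ m" "\<And>k. bit b k \<longleftrightarrow> k < m \<and> \<xi> k = -1"
    using nat_with_bits[of m "\<lambda>k. \<xi> k = -1"] by blast
  have \<rho>_xor: "\<rho> a s = bit_sign (xor a b) s" if "s < m" for a s
    using that \<xi> by (auto simp: \<rho>_def tagged_sign_def bit_sign_def bit_xor_iff b(2) sign_seq_def)
  have "real m * 2 ^ m / 6 \<le> (\<Sum>a<2^m. of_bool (a \<noteq> 0) * \<bar>dirichlet (bit_sign a) n\<bar>)"
    by (rule sum_abs_dirichlet_ge[OF n])
  also have "\<dots> = (\<Sum>a<2^m. of_bool (xor a b \<noteq> 0) * \<bar>dirichlet (bit_sign (xor a b)) n\<bar>)"
    by (rule sum.reindex_bij_witness[of _ "\<lambda>a. xor a b" "\<lambda>a. xor a b"]) (auto simp: xor_less_exp b(1) xor.assoc)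
  also have "\<dots> = (\<Sum>a<2^m. of_bool (\<exists>s<m. \<rho> a s = -1) * \<bar>dirichlet (\<rho> a) n\<bar>)"
  proof (intro sum.cong refl arg_cong2[where f = "(*)"])
    fix a :: nat assume a: "a \<in> {..<2 ^ m}"
    have "xor a b < 2 ^ m" using a b(1) by (simp add: xor_less_exp)
    then have "xor a b \<noteq> 0 \<longleftrightarrow> (\<exists>s<m. bit (xor a b) s)"
      using bit_eq_iff[of "xor a b" 0] bit_less_exp[of "xor a b" m] by auto
    then show "of_bool (xor a b \<noteq> 0) = (of_bool (\<exists>s<m. \<rho> a s = -1) :: real)"
      using \<rho>_xor[of _ a] by (auto simp: bit_sign_def)
    show "\<bar>dirichlet (bit_sign (xor a b)) n\<bar> = \<bar>dirichlet (\<rho> a) n\<bar>"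
      using dirichlet_cong[of m "bit_sign (xor a b)" "\<rho> a" n] \<rho>_xor n' by simp
  qed
  also have "\<dots> \<le> (\<Sum>a<2^m. X * dirichlet (\<rho> a) h)" by (intro sum_mono h(3)) simp
  also have "\<dots> = X * (\<Sum>a<2^m. dirichlet (\<rho> a) h)" by (rule sum_distrib_left[symmetric])
  also have "\<dots> \<le> \<bar>\<Sum>a<2^m. dirichlet (\<rho> a) h\<bar>"
    using h(2) abs_ge_self[of "X * (\<Sum>a<2^m. dirichlet (\<rho> a) h)"] by (simp add: abs_mult)
  finally have "real m / 6 \<le> \<bar>\<Sum>a<2^m. dirichlet (\<rho> a) h\<bar> / 2 ^ m" by (simp add: field_simps)
  then show ?thesis using h(1) unfolding \<rho>_def by blast
qed

text \<open>The polynomial is the mean of the \<open>2 ^ m\<close> kernels \<open>dirichlet _ (2 ^ (m + 2 ^ m))\<close> centred at the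
  tagged points, that is, an approximation to the uniform distribution on these points. Its
  partial sums at \<open>x\<close> are means of Dirichlet kernels, which the order \<open>h\<close> aligns in sign.\<close>

lemma ex_walsh_poly_large_partial_sums:
  "\<exists>\<alpha> n. \<alpha> 0 = 1 \<and> (\<forall>x. 0 \<le> walsh_poly \<alpha> n x) \<and> (\<forall>x. \<exists>h<n. C \<le> \<bar>walsh_poly \<alpha> h x\<bar>)"
proof -
  obtain r :: nat where r: "C * 3 \<le> real r" using real_arch_simple by blast
  define m where "m = 2 * r"
  obtain n0 :: nat where n0: "3 * n0 + 1 = 2 ^ m"
    using ex_third_of_power_4[of r] by (auto simp: m_def power_mult)
  define \<alpha> where "\<alpha> l = (\<Sum>a<2^m. walsh_char (tagged_sign m a) l) / 2 ^ m" for l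
  have poly: "walsh_poly \<alpha> h x = (\<Sum>a<2^m. dirichlet (\<lambda>s. rademacher s x * tagged_sign m a s) h) / 2 ^ m" for h x
  proof -
    have "walsh_poly \<alpha> h x = (\<Sum>l<h. \<Sum>a<2^m. walsh_char (\<lambda>s. rademacher s x * tagged_sign m a s) l) / 2 ^ m"
      by (simp add: walsh_poly_def \<alpha>_def walsh_char_mult walsh_eq_walsh_char sum_divide_distrib sum_distrib_left mult_ac)
    then show ?thesis by (subst (asm) sum.swap) (simp add: dirichlet_def)
  qed
  have "\<alpha> 0 = 1" by (simp add: \<alpha>_def)
  moreover have "0 \<le> walsh_poly \<alpha> (2 ^ (m + 2 ^ m)) x" for x
  proof -
    have "0 \<le> dirichlet \<rho> (2 ^ k)" if "sign_seq \<rho>" for \<rho> k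
      using that unfolding dirichlet_exp sign_seq_def by (intro prod_nonneg) (metis add_nonneg_nonneg add.right_inverse order_refl zero_le_one)
    then show ?thesis
      unfolding poly by (intro divide_nonneg_nonneg sum_nonneg) (auto intro: sign_seq_mult sign_seq_rademacher sign_seq_tagged_sign)
  qed
  moreover have "\<exists>h<2 ^ (m + 2 ^ m). C \<le> \<bar>walsh_poly \<alpha> h x\<bar>" for x
  proof -
    have "C \<le> real m / 6" using r by (simp add: m_def)
    moreover obtain h where "h < 2 ^ (m + 2 ^ m)" "real m / 6 \<le> \<bar>walsh_poly \<alpha> h x\<bar>"
      using ex_large_average_order[OF sign_seq_rademacher n0, of x] unfolding poly by auto
    ultimately show ?thesis by (meson order.trans)
  qed
  ultimately show ?thesis by blast
qed

section \<open>Dilated polynomials and slowly varying weights\<close>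

lemma rademacher_shift: "rademacher (k + L) x = rademacher k (frac (2 ^ L * x))"
proof -
  define z where "z = 2 ^ k * \<lfloor>2 ^ L * x\<rfloor>"
  have "2 ^ (k + 1) * frac (2 ^ L * x) = 2 ^ (k + L + 1) * x - of_int (2 * z)"
    by (simp add: frac_def z_def power_add algebra_simps)
  then have "\<lfloor>2 ^ (k + 1) * frac (2 ^ L * x)\<rfloor> = \<lfloor>2 ^ (k + L + 1) * x\<rfloor> - 2 * z"
    by (metis floor_diff_of_int)
  then have "\<lfloor>2 ^ (k + 1) * frac (2 ^ L * x)\<rfloor> mod 2 = \<lfloor>2 ^ (k + L + 1) * x\<rfloor> mod 2"
    by (metis minus_mult_minus mod_mult_self2 mult_minus_right uminus_add_conv_diff add.commute)
  then show ?thesis by (simp add: rademacher_def dyadic_digit_def)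
qed

lemma walsh_dilate: "walsh (2 ^ L * l) x = walsh l (frac (2 ^ L * x))"
  by (simp add: walsh_eq_walsh_char walsh_char_shift rademacher_shift)

definition dilate :: "nat \<Rightarrow> (nat \<Rightarrow> real) \<Rightarrow> nat \<Rightarrow> real" where
  "dilate L \<alpha> k = (if 2 ^ L dvd k then \<alpha> (k div 2 ^ L) else 0)"

text \<open>All frequencies of the dilated polynomial are multiples of \<open>2 ^ L\<close>, so its partial sums of
  orders in \<open>(2 ^ L * (h - 1), 2 ^ L * h]\<close> coincide.\<close>

lemma walsh_poly_dilate:
  assumes "2 ^ L * h < k + 2 ^ L" "k \<le> 2 ^ L * h"
  shows "walsh_poly (dilate L \<alpha>) k x = walsh_poly \<alpha> h (frac (2 ^ L * x))"
proof -
  have sub: "(\<lambda>l. 2 ^ L * l) ` {..<h} \<subseteq> {..<k}"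
  proof
    fix i :: nat assume "i \<in> (\<lambda>l. 2 ^ L * l) ` {..<h}"
    then obtain l where l: "i = 2 ^ L * l" "l < h" by auto
    have "2 ^ L * Suc l \<le> 2 ^ L * h" using l(2) by (intro mult_le_mono) auto
    then show "i \<in> {..<k}" using assms(1) l(1) by simp
  qed
  have out: "dilate L \<alpha> i = 0" if i: "i \<in> {..<k} - (\<lambda>l. 2 ^ L * l) ` {..<h}" for i
  proof -
    have "\<not> 2 ^ L dvd i"
    proof
      assume "2 ^ L dvd i"
      then obtain l where l: "i = 2 ^ L * l" by (rule dvdE)
      then have "2 ^ L * l < k" using i by simp
      then have "2 ^ L * l < 2 ^ L * h" using assms(2) by (rule less_le_trans)
      then have "l < h" by simp
      then show False using i l by blast
    qed
    then show ?thesis by (simp add: dilate_def)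
  qed
  have "walsh_poly (dilate L \<alpha>) k x = (\<Sum>i\<in>(\<lambda>l. 2 ^ L * l) ` {..<h}. dilate L \<alpha> i * walsh i x)"
    unfolding walsh_poly_def using sub out by (intro sum.mono_neutral_right) auto
  also have "\<dots> = (\<Sum>l<h. dilate L \<alpha> (2 ^ L * l) * walsh (2 ^ L * l) x)"
    by (subst sum.reindex) (auto simp: inj_on_def)
  finally show ?thesis by (simp add: walsh_poly_def dilate_def walsh_dilate)
qed

lemma walsh_partial_sum_dilate:
  assumes "2 ^ L * h < k + 2 ^ L" "k \<le> 2 ^ L * h" "h \<le> m"
  shows "walsh_partial_sum (walsh_poly (dilate L \<alpha>) (2 ^ L * m)) k x = walsh_poly \<alpha> h (frac (2 ^ L * x))"
proof -
  have "2 ^ L * h \<le> 2 ^ L * m" using assms(3) by simp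
  with assms(2) have "k \<le> 2 ^ L * m" by (rule order.trans)
  then have "min (2 ^ L * m) k = k" by (rule min_absorb2)
  then show ?thesis
    using walsh_poly_dilate[OF assms(1,2), of \<alpha> x] by (simp add: walsh_partial_sum_walsh_poly)
qed

lemma abs_walsh_partial_sum_le:
  assumes f: "integrable unit_measure f"
  shows "\<bar>walsh_partial_sum f n x\<bar> \<le> real n * (LINT t|unit_measure. \<bar>f t\<bar>)"
proof -
  have "\<bar>walsh_coeff f k\<bar> \<le> (LINT t|unit_measure. \<bar>f t\<bar>)" for k
  proof -
    have "\<bar>walsh_coeff f k\<bar> \<le> (LINT t|unit_measure. \<bar>f t * walsh k t\<bar>)"
      unfolding walsh_coeff_def by (rule integral_abs_bound)
    then show ?thesis by (simp add: abs_mult)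
  qed
  then have "(\<Sum>k<n. \<bar>walsh_coeff f k * walsh k x\<bar>) \<le> (\<Sum>k<n. (LINT t|unit_measure. \<bar>f t\<bar>))"
    by (intro sum_mono) (simp add: abs_mult)
  also have "\<dots> = real n * (LINT t|unit_measure. \<bar>f t\<bar>)" by simp
  finally show ?thesis unfolding walsh_partial_sum_def by (rule order.trans[OF sum_abs])
qed

context norlund_weights
begin

lemma abs_norlund_mean_le_bound:
  assumes "\<And>k. k \<le> n \<Longrightarrow> \<bar>walsh_partial_sum f k x\<bar> \<le> B"
  shows "\<bar>norlund_mean q f n x\<bar> \<le> B"
proof -
  have "\<bar>\<Sum>k\<le>n. q (n - k) * walsh_partial_sum f k x\<bar> \<le> (\<Sum>k\<le>n. q (n - k) * B)"
    using assms q_nonneg by (intro order.trans[OF sum_abs] sum_mono) (auto simp: abs_mult intro!: mult_left_mono)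
  also have "\<dots> = weight_sum q n * B" by (simp add: weight_sum_reverse flip: sum_distrib_right)
  finally show ?thesis
    using weight_pos[of n] by (simp add: norlund_mean_atMost abs_divide pos_divide_le_eq mult.commute)
qed

lemma abs_norlund_mean_le_L1:
  assumes f: "integrable unit_measure f"
  shows "\<bar>norlund_mean q f n x\<bar> \<le> real n * (LINT t|unit_measure. \<bar>f t\<bar>)"
proof (rule abs_norlund_mean_le_bound)
  fix k assume "k \<le> n"
  have "(LINT t|unit_measure. \<bar>f t\<bar>) \<ge> 0" by (intro integral_nonneg_AE) auto
  then show "\<bar>walsh_partial_sum f k x\<bar> \<le> real n * (LINT t|unit_measure. \<bar>f t\<bar>)"
    using \<open>k \<le> n\<close> by (intro order.trans[OF abs_walsh_partial_sum_le[OF f, of k x] mult_right_mono]) auto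
qed

text \<open>If \<open>Q\<close> grew by a factor \<open>1 + e\<close> over every \<open>H\<close> dyadic steps, the sum of the \<open>Q (2 ^ s)\<close> with \<open>s \<le> N\<close>
  would be dominated by \<open>H\<close> copies of a geometric series with top term \<open>Q (2 ^ N)\<close>.\<close>

lemma ex_slow_window:
  assumes unbounded: "\<And>K. \<exists>N. K * weight_sum q (2 ^ N) < (\<Sum>s\<le>N. weight_sum q (2 ^ s))" and e: "e > 0"
  shows "\<exists>L. weight_sum q (2 ^ (L + H)) \<le> (1 + e) * weight_sum q (2 ^ L)"
proof (rule ccontr)
  assume "\<not> ?thesis"
  then have fast: "(1 + e) * weight_sum q (2 ^ L) < weight_sum q (2 ^ (L + H))" for L by (simp add: not_le)
  \<comment> \<open>\<open>H\<close> times the sum of the geometric series with ratio \<open>1 / (1 + e)\<close>\<close>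
  define K where "K = real H * (1 + e) / e"
  have K: "real H \<le> K" using e by (simp add: K_def field_simps)
  have K0: "K \<ge> 0" using e by (simp add: K_def)
  have Q0: "weight_sum q k > 0" for k by (rule weight_pos)
  have H: "H > 0"
  proof (rule ccontr)
    assume "\<not> H > 0"
    then show False using fast[of 0] mult_pos_pos[OF e Q0[of 1]] by (simp add: algebra_simps)
  qed
  have "(\<Sum>s\<le>N. weight_sum q (2 ^ s)) \<le> K * weight_sum q (2 ^ N)" for N
  proof (induction N rule: less_induct)
    case (less N)
    have top: "(\<Sum>s\<in>A. weight_sum q (2 ^ s)) \<le> real (card A) * weight_sum q (2 ^ N)" if "A \<subseteq> {..N}" for A
      using that by (intro sum_bounded_above weight_mono power_increasing) auto
    show ?case
    proof (cases "N < H")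
      case True
      have "(\<Sum>s\<le>N. weight_sum q (2 ^ s)) \<le> real (Suc N) * weight_sum q (2 ^ N)" using top[of "{..N}"] by simp
      also have "\<dots> \<le> K * weight_sum q (2 ^ N)"
        using True K Q0[of "2 ^ N"] by (intro mult_right_mono) auto
      finally show ?thesis .
    next
      case False
      have "{..N} = {..N - H} \<union> {N - H<..N}" by auto
      then have "(\<Sum>s\<le>N. weight_sum q (2 ^ s)) = (\<Sum>s\<le>N - H. weight_sum q (2 ^ s)) + (\<Sum>s\<in>{N - H<..N}. weight_sum q (2 ^ s))"
        by (simp only:) (rule sum.union_disjoint, auto)
      also have "\<dots> \<le> K * weight_sum q (2 ^ (N - H)) + real H * weight_sum q (2 ^ N)"
      proof (rule add_mono)
        show "(\<Sum>s\<le>N - H. weight_sum q (2 ^ s)) \<le> K * weight_sum q (2 ^ (N - H))"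
          using H False by (intro less) simp
        show "(\<Sum>s\<in>{N - H<..N}. weight_sum q (2 ^ s)) \<le> real H * weight_sum q (2 ^ N)"
          using top[of "{N - H<..N}"] False by (simp add: subset_iff)
      qed
      also have "\<dots> \<le> K * (weight_sum q (2 ^ N) / (1 + e)) + real H * weight_sum q (2 ^ N)"
        using fast[of "N - H"] False e K0 by (intro add_right_mono mult_left_mono) (auto simp: field_simps)
      also have "\<dots> = (K / (1 + e) + real H) * weight_sum q (2 ^ N)" by (simp add: algebra_simps)
      also have "K / (1 + e) = real H / e" using e by (simp add: K_def)
      also have "real H / e + real H = K" using e by (simp add: K_def distrib_left add_divide_distrib)
      finally show ?thesis .
    qed
  qed
  then show False using unbounded[of K] by (auto simp: not_le[symmetric])
qed

text \<open>The first \<open>2 ^ Suc L\<close> weights all meet the same partial sum of the dilated polynomial. In a slow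
  window they carry almost the whole of \<open>Q n\<close>, and the remaining fraction \<open>e\<close> is so small that it
  outweighs the size of the coefficients.\<close>

lemma norlund_mean_dilate_ge:
  assumes slow: "weight_sum q (2 ^ (L + Suc J)) \<le> (1 + e) * weight_sum q (2 ^ L)"
    and e: "0 < e" "e \<le> 1" "(\<Sum>k<m. \<bar>\<alpha> k\<bar>) * e \<le> 1"
    and h: "0 < h" "h \<le> m" "h \<le> 2 ^ J"
  shows "\<bar>walsh_poly \<alpha> h (frac (2 ^ Suc L * x))\<bar> / 2 - 1 \<le>
    \<bar>norlund_mean q (walsh_poly (dilate (Suc L) \<alpha>) (2 ^ Suc L * m)) (2 ^ Suc L * h) x\<bar>"
proof -
  define P where "P = walsh_poly (dilate (Suc L) \<alpha>) (2 ^ Suc L * m)"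
  define n where "n = 2 ^ Suc L * h"
  define A where "A = (\<Sum>k<m. \<bar>\<alpha> k\<bar>)"
  define y where "y = walsh_poly \<alpha> h (frac (2 ^ Suc L * x))"
  define \<sigma> where "\<sigma> = (\<Sum>l<2 ^ Suc L. q l)"
  define R where "R = (\<Sum>l=2 ^ Suc L..n. q l * walsh_partial_sum P (n - l) x)"
  have A0: "A \<ge> 0" unfolding A_def by (intro sum_nonneg) auto
  have n: "2 ^ Suc L \<le> n" using h(1) by (simp add: n_def)
  have Qn: "weight_sum q n > 0" by (rule weight_pos)
  have split: "(\<Sum>l\<le>n. g l) = (\<Sum>l<2 ^ Suc L. g l) + (\<Sum>l=2 ^ Suc L..n. g l)" for g :: "nat \<Rightarrow> real"
  proof -
    have "{..n} = {..<2 ^ Suc L} \<union> {2 ^ Suc L..n}" using n by auto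
    then show ?thesis by (simp add: sum.union_disjoint ivl_disj_int del: power_Suc)
  qed
  have "weight_sum q n * norlund_mean q P n x = (\<Sum>k\<le>n. q (n - k) * walsh_partial_sum P k x)"
    using Qn by (simp add: norlund_mean_atMost)
  also have "\<dots> = (\<Sum>l\<le>n. q l * walsh_partial_sum P (n - l) x)"
    by (rule sum.reindex_bij_witness[of _ "\<lambda>k. n - k" "\<lambda>k. n - k"]) auto
  also have "\<dots> = (\<Sum>l<2 ^ Suc L. q l * walsh_partial_sum P (n - l) x) + R" unfolding R_def by (rule split)
  also have "(\<Sum>l<2 ^ Suc L. q l * walsh_partial_sum P (n - l) x) = (\<Sum>l<2 ^ Suc L. q l * y)"
  proof (intro sum.cong refl arg_cong2[where f = "(*)"])
    fix l :: nat assume "l \<in> {..<2 ^ Suc L}"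
    then have l: "l < 2 ^ Suc L" by simp
    show "walsh_partial_sum P (n - l) x = y"
      unfolding P_def y_def
    proof (rule walsh_partial_sum_dilate)
      show "2 ^ Suc L * h < n - l + 2 ^ Suc L" using l n unfolding n_def[symmetric] by linarith
      show "n - l \<le> 2 ^ Suc L * h" unfolding n_def[symmetric] by simp
    qed (rule h(2))
  qed
  also have "\<dots> = \<sigma> * y" by (simp add: \<sigma>_def sum_distrib_right)
  finally have eq: "weight_sum q n * norlund_mean q P n x = \<sigma> * y + R" .
  have \<sigma>: "weight_sum q (2 ^ L) \<le> \<sigma>"
    unfolding weight_sum_def \<sigma>_def using q_nonneg by (intro sum_mono2) (auto simp: less_Suc_eq_le[symmetric] intro: le_less_trans)
  have "n \<le> 2 ^ (L + Suc J)" using h(3) by (simp add: n_def power_add)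
  then have "weight_sum q n \<le> (1 + e) * weight_sum q (2 ^ L)" using slow weight_mono order.trans by blast
  moreover have "e * weight_sum q (2 ^ L) \<le> e * weight_sum q n"
    using e n by (intro mult_left_mono weight_mono) auto
  ultimately have rest: "weight_sum q n - \<sigma> \<le> e * weight_sum q n" using \<sigma> by (simp add: algebra_simps)
  have half: "weight_sum q n / 2 \<le> \<sigma>"
  proof -
    have "(1 + e) * weight_sum q (2 ^ L) \<le> 2 * weight_sum q (2 ^ L)"
      using e weight_pos[of "2 ^ L"] by (intro mult_right_mono) auto
    then show ?thesis using \<open>weight_sum q n \<le> (1 + e) * weight_sum q (2 ^ L)\<close> \<sigma> by linarith
  qed
  have "\<bar>R\<bar> \<le> (\<Sum>l=2 ^ Suc L..n. q l * A)"
    unfolding R_def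
  proof (intro order.trans[OF sum_abs] sum_mono)
    fix l
    have "\<bar>walsh_partial_sum P k x\<bar> \<le> A" for k
    proof -
      have "walsh_partial_sum P k x = walsh_poly (dilate (Suc L) \<alpha>) (min (2 ^ Suc L * m) k) x"
        unfolding P_def by (rule walsh_partial_sum_walsh_poly)
      then have "\<bar>walsh_partial_sum P k x\<bar> \<le> (\<Sum>i<min (2 ^ Suc L * m) k. \<bar>dilate (Suc L) \<alpha> i\<bar>)"
        by (simp only: abs_walsh_poly_le)
      also have "\<dots> \<le> (\<Sum>i<2 ^ Suc L * m. \<bar>dilate (Suc L) \<alpha> i\<bar>)" by (intro sum_mono2) auto
      also have "\<dots> = (\<Sum>i\<in>(\<lambda>l. 2 ^ Suc L * l) ` {..<m}. \<bar>dilate (Suc L) \<alpha> i\<bar>)"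
        by (intro sum.mono_neutral_right) (auto simp: dilate_def image_iff elim!: dvdE)
      also have "\<dots> = A"
        by (subst sum.reindex) (auto simp: inj_on_def A_def dilate_def)
      finally show ?thesis .
    qed
    then show "\<bar>q l * walsh_partial_sum P (n - l) x\<bar> \<le> q l * A"
      unfolding abs_mult using q_nonneg[of l] by (intro mult_mono) auto
  qed
  also have "\<dots> = A * (weight_sum q n - \<sigma>)"
    using split[of q] by (simp add: weight_sum_def \<sigma>_def flip: sum_distrib_right)
  also have "\<dots> \<le> A * (e * weight_sum q n)" using A0 rest by (intro mult_left_mono)
  also have "\<dots> = (A * e) * weight_sum q n" by simp
  also have "\<dots> \<le> 1 * weight_sum q n" using e(3) Qn by (intro mult_right_mono) (auto simp: A_def)
  finally have R: "\<bar>R\<bar> \<le> weight_sum q n" by simp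
  have "weight_sum q n * (\<bar>y\<bar> / 2 - 1) = weight_sum q n / 2 * \<bar>y\<bar> - weight_sum q n" by (simp add: algebra_simps)
  also have "\<dots> \<le> \<sigma> * \<bar>y\<bar> - \<bar>R\<bar>" using half R by (intro diff_mono mult_right_mono) auto
  also have "\<dots> = \<bar>\<sigma> * y\<bar> - \<bar>R\<bar>" using half Qn by (simp add: abs_mult)
  also have "\<dots> \<le> \<bar>\<sigma> * y + R\<bar>" by linarith
  also have "\<dots> = weight_sum q n * \<bar>norlund_mean q P n x\<bar>" using Qn by (simp add: abs_mult flip: eq)
  finally show ?thesis using Qn unfolding P_def n_def y_def by (simp only: mult_le_cancel_left_pos)
qed

lemma ex_walsh_poly_large_norlund_means:
  assumes unbounded: "\<And>K. \<exists>N. K * weight_sum q (2 ^ N) < (\<Sum>s\<le>N. weight_sum q (2 ^ s))"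
  shows "\<exists>\<alpha> m N. (LINT x|unit_measure. \<bar>walsh_poly \<alpha> m x\<bar>) \<le> 1 \<and>
    (\<forall>x\<in>{0..<1}. \<exists>n\<le>N. C \<le> \<bar>norlund_mean q (walsh_poly \<alpha> m) n x\<bar>)"
proof -
  define C' where "C' = 2 * (\<bar>C\<bar> + 1)"
  obtain \<alpha> m where \<alpha>: "\<alpha> 0 = 1" "\<And>x. 0 \<le> walsh_poly \<alpha> m x" "\<And>x. \<exists>h<m. C' \<le> \<bar>walsh_poly \<alpha> h x\<bar>"
    using ex_walsh_poly_large_partial_sums[of C'] by blast
  have m: "m > 0" using \<alpha>(3)[of 0] by auto
  define A where "A = (\<Sum>k<m. \<bar>\<alpha> k\<bar>)"
  have A0: "A \<ge> 0" unfolding A_def by (intro sum_nonneg) auto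
  define e where "e = 1 / (A + 1)"
  have e: "0 < e" "e \<le> 1" "A * e \<le> 1" using A0 by (auto simp: e_def field_simps)
  obtain L where L: "weight_sum q (2 ^ (L + Suc m)) \<le> (1 + e) * weight_sum q (2 ^ L)"
    using ex_slow_window[OF unbounded e(1)] by blast
  define \<beta> where "\<beta> = dilate (Suc L) \<alpha>"
  define M where "M = 2 ^ Suc L * m"
  have poly: "walsh_poly \<beta> M x = walsh_poly \<alpha> m (frac (2 ^ Suc L * x))" for x
    unfolding \<beta>_def M_def by (rule walsh_poly_dilate) auto
  have "(LINT x|unit_measure. \<bar>walsh_poly \<beta> M x\<bar>) = (LINT x|unit_measure. walsh_poly \<beta> M x)"
    using \<alpha>(2) by (simp add: poly)
  also have "\<dots> = \<beta> 0" using m by (intro integral_walsh_poly) (simp add: M_def)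
  also have "\<dots> = 1" by (simp add: \<beta>_def dilate_def \<alpha>(1))
  finally have "(LINT x|unit_measure. \<bar>walsh_poly \<beta> M x\<bar>) \<le> 1" by simp
  moreover have "\<exists>n\<le>M. C \<le> \<bar>norlund_mean q (walsh_poly \<beta> M) n x\<bar>" for x
  proof -
    obtain h where h: "h < m" "C' \<le> \<bar>walsh_poly \<alpha> h (frac (2 ^ Suc L * x))\<bar>" using \<alpha>(3) by blast
    have "h \<noteq> 0"
    proof
      assume "h = 0"
      then show False using h(2) by (simp add: walsh_poly_def C'_def)
    qed
    moreover have "h \<le> 2 ^ m" using less_trans[OF h(1) less_exp[of m]] by (rule less_imp_le)
    ultimately have "\<bar>walsh_poly \<alpha> h (frac (2 ^ Suc L * x))\<bar> / 2 - 1 \<le> \<bar>norlund_mean q (walsh_poly \<beta> M) (2 ^ Suc L * h) x\<bar>"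
      using h(1) e unfolding \<beta>_def M_def by (intro norlund_mean_dilate_ge[OF L]) (auto simp: A_def)
    then have "C \<le> \<bar>norlund_mean q (walsh_poly \<beta> M) (2 ^ Suc L * h) x\<bar>" using h(2) by (simp add: C'_def)
    moreover have "2 ^ Suc L * h \<le> M" using h(1) by (simp add: M_def)
    ultimately show ?thesis by blast
  qed
  ultimately show ?thesis by blast
qed

end

section \<open>Everywhere divergence\<close>

lemma L1_limit_of_fast_Cauchy:
  fixes g :: "nat \<Rightarrow> 'a \<Rightarrow> real"
  assumes g: "\<And>i. integrable M (g i)"
    and c: "\<And>i. (LINT x|M. \<bar>g (Suc i) x - g i x\<bar>) \<le> c i" "summable c"
  shows "\<exists>f. integrable M f \<and> (\<forall>i. (LINT x|M. \<bar>f x - g i x\<bar>) \<le> (\<Sum>l. c (l + i)))"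
proof -
  define u where "u i x = g (Suc i) x - g i x" for i x
  have u: "integrable M (u i)" for i unfolding u_def using g by auto
  have u_meas [measurable]: "u i \<in> borel_measurable M" for i using u by (rule borel_measurable_integrable)
  have c0: "0 \<le> (LINT x|M. \<bar>u i x\<bar>)" for i by (intro integral_nonneg_AE) auto
  have sumL1: "summable (\<lambda>i. LINT x|M. \<bar>u i x\<bar>)"
    using c c0 by (intro summable_comparison_test'[OF c(2), of 0]) (auto simp: u_def)
  have "(\<integral>\<^sup>+x. (\<Sum>i. ennreal \<bar>u i x\<bar>) \<partial>M) = (\<Sum>i. (\<integral>\<^sup>+x. ennreal \<bar>u i x\<bar> \<partial>M))"
    by (intro nn_integral_suminf) measurable
  also have "\<dots> = (\<Sum>i. ennreal (LINT x|M. \<bar>u i x\<bar>))"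
    using u by (intro suminf_cong nn_integral_eq_integral) auto
  also have "\<dots> = ennreal (\<Sum>i. LINT x|M. \<bar>u i x\<bar>)"
    using c0 sumL1 by (intro suminf_ennreal2)
  finally have "(\<integral>\<^sup>+x. (\<Sum>i. ennreal \<bar>u i x\<bar>) \<partial>M) \<noteq> \<infinity>" by simp
  then have "AE x in M. (\<Sum>i. ennreal \<bar>u i x\<bar>) \<noteq> \<infinity>"
    by (intro nn_integral_PInf_AE) measurable
  then have AE_summable: "AE x in M. summable (\<lambda>i. \<bar>u i x\<bar>)"
  proof eventually_elim
    case (elim x)
    show ?case by (rule summable_suminf_not_top) (use elim in simp_all)
  qed
  have int_u: "integrable M (\<lambda>x. \<Sum>l. u (l + i) x)" for i
    using u AE_summable sumL1 by (intro integrable_suminf) (auto intro: summable_ignore_initial_segment)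
  define f where "f x = g 0 x + (\<Sum>l. u l x)" for x
  have f: "integrable M f" unfolding f_def using g int_u[of 0] by auto
  have "(LINT x|M. \<bar>f x - g i x\<bar>) \<le> (\<Sum>l. c (l + i))" for i
  proof -
    have AE_i: "AE x in M. summable (\<lambda>l. norm \<bar>u (l + i) x\<bar>)"
      using AE_summable by eventually_elim (auto intro: summable_ignore_initial_segment)
    have sum_i: "summable (\<lambda>l. LINT x|M. norm \<bar>u (l + i) x\<bar>)"
      using sumL1 by (auto intro: summable_ignore_initial_segment)
    have "(LINT x|M. \<bar>f x - g i x\<bar>) \<le> (LINT x|M. (\<Sum>l. \<bar>u (l + i) x\<bar>))"
    proof (rule integral_mono_AE)
      show "integrable M (\<lambda>x. \<bar>f x - g i x\<bar>)" using f g by auto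
      show "integrable M (\<lambda>x. \<Sum>l. \<bar>u (l + i) x\<bar>)"
        using u AE_i sum_i by (intro integrable_suminf) auto
      show "AE x in M. \<bar>f x - g i x\<bar> \<le> (\<Sum>l. \<bar>u (l + i) x\<bar>)"
        using AE_summable
      proof eventually_elim
        case (elim x)
        have "summable (\<lambda>l. u l x)" using elim by (rule summable_rabs_cancel)
        then have "(\<Sum>l. u l x) = (\<Sum>l. u (l + i) x) + (\<Sum>l<i. u l x)" by (rule suminf_split_initial_segment)
        moreover have "(\<Sum>l<i. u l x) = g i x - g 0 x"
          unfolding u_def by (rule sum_lessThan_telescope)
        ultimately have "f x - g i x = (\<Sum>l. u (l + i) x)" by (simp add: f_def)
        then show ?case using summable_rabs[OF summable_ignore_initial_segment[OF elim, of i]] by simp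
      qed
    qed
    also have "\<dots> = (\<Sum>l. LINT x|M. \<bar>u (l + i) x\<bar>)"
      using u AE_i sum_i by (intro integral_suminf) auto
    also have "\<dots> \<le> (\<Sum>l. c (l + i))"
      using sum_i c by (intro suminf_le) (auto simp: u_def intro: summable_ignore_initial_segment)
    finally show ?thesis .
  qed
  then show ?thesis using f by blast
qed

context norlund_weights
begin

text \<open>The means of the given polynomial are bounded by \<open>A\<close>, so adding a small multiple of a
  polynomial with much larger means makes the means of the sum large at every point.\<close>

lemma ex_perturbation_large_norlund_means:
  assumes unbounded: "\<And>K. \<exists>N. K * weight_sum q (2 ^ N) < (\<Sum>s\<le>N. weight_sum q (2 ^ s))" and d: "d > 0"
  shows "\<exists>\<beta> n N. (LINT x|unit_measure. \<bar>walsh_poly \<beta> n x - walsh_poly \<alpha> m x\<bar>) \<le> d \<and>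
    (\<forall>x\<in>{0..<1}. \<exists>k\<le>N. C \<le> \<bar>norlund_mean q (walsh_poly \<beta> n) k x\<bar>)"
proof -
  define A where "A = (\<Sum>k<m. \<bar>\<alpha> k\<bar>)"
  have A: "\<bar>norlund_mean q (walsh_poly \<alpha> m) k x\<bar> \<le> A" for k x
  proof (rule abs_norlund_mean_le_bound)
    fix l
    have "\<bar>walsh_partial_sum (walsh_poly \<alpha> m) l x\<bar> \<le> (\<Sum>k<min m l. \<bar>\<alpha> k\<bar>)"
      unfolding walsh_partial_sum_walsh_poly by (rule abs_walsh_poly_le)
    also have "\<dots> \<le> A" unfolding A_def by (intro sum_mono2) auto
    finally show "\<bar>walsh_partial_sum (walsh_poly \<alpha> m) l x\<bar> \<le> A" .
  qed
  obtain \<gamma> k N where \<gamma>: "(LINT x|unit_measure. \<bar>walsh_poly \<gamma> k x\<bar>) \<le> 1"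
    "\<And>x. x \<in> {0..<1} \<Longrightarrow> \<exists>n\<le>N. (C + A) / d \<le> \<bar>norlund_mean q (walsh_poly \<gamma> k) n x\<bar>"
    using ex_walsh_poly_large_norlund_means[OF unbounded, of "(C + A) / d"] by blast
  obtain \<beta> n where \<beta>: "\<And>x. walsh_poly \<beta> n x = walsh_poly \<alpha> m x + d * walsh_poly \<gamma> k x"
    using walsh_poly_add_scaled[of \<alpha> m d \<gamma> k] by blast
  then have eq: "walsh_poly \<beta> n = (\<lambda>x. walsh_poly \<alpha> m x + d * walsh_poly \<gamma> k x)" by blast
  have "(LINT x|unit_measure. \<bar>walsh_poly \<beta> n x - walsh_poly \<alpha> m x\<bar>) = d * (LINT x|unit_measure. \<bar>walsh_poly \<gamma> k x\<bar>)"
    using d by (simp add: \<beta> abs_mult)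
  also have "\<dots> \<le> d" using \<gamma>(1) d by (simp add: mult_left_le)
  finally have "(LINT x|unit_measure. \<bar>walsh_poly \<beta> n x - walsh_poly \<alpha> m x\<bar>) \<le> d" .
  moreover have "\<exists>k\<le>N. C \<le> \<bar>norlund_mean q (walsh_poly \<beta> n) k x\<bar>" if x: "x \<in> {0..<1}" for x
  proof -
    obtain l where l: "l \<le> N" "(C + A) / d \<le> \<bar>norlund_mean q (walsh_poly \<gamma> k) l x\<bar>" using \<gamma>(2)[OF x] by blast
    have "norlund_mean q (walsh_poly \<beta> n) l x = norlund_mean q (walsh_poly \<alpha> m) l x + d * norlund_mean q (walsh_poly \<gamma> k) l x"
      unfolding eq by (intro norlund_mean_add_scaled integrable_walsh_poly)
    moreover have "C + A \<le> \<bar>d * norlund_mean q (walsh_poly \<gamma> k) l x\<bar>"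
      using l(2) d by (simp add: abs_mult pos_divide_le_eq mult.commute)
    ultimately have "C \<le> \<bar>norlund_mean q (walsh_poly \<beta> n) l x\<bar>" using A[of l x] by linarith
    then show ?thesis using l(1) by blast
  qed
  ultimately show ?thesis by blast
qed

text \<open>A gliding hump: polynomials are perturbed successively, the \<open>i\<close>-th having at every point
  a mean of modulus at least \<open>i\<close> and of order at most \<open>top\<close>. Later perturbations are so small in norm that they change
  means of these orders by at most \<open>1\<close> in total. Hence the means of the limit are unbounded at every
  point.\<close>

theorem ex_everywhere_divergent_norlund_means:
  assumes unbounded: "\<And>K. \<exists>N. K * weight_sum q (2 ^ N) < (\<Sum>s\<le>N. weight_sum q (2 ^ s))"
  shows "\<exists>f. integrable unit_measure f \<and> (\<forall>x\<in>{0..<1}. \<not> convergent (\<lambda>n. norlund_mean q f n x))"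
proof -
  define poly :: "(nat \<Rightarrow> real) \<times> nat \<times> nat \<Rightarrow> real \<Rightarrow> real" where "poly s = walsh_poly (fst s) (fst (snd s))" for s
  define top :: "(nat \<Rightarrow> real) \<times> nat \<times> nat \<Rightarrow> nat" where "top s = snd (snd s)" for s
  define large where "large i s \<longleftrightarrow> (\<forall>x\<in>{0..<1}. \<exists>k\<le>top s. real i \<le> \<bar>norlund_mean q (poly s) k x\<bar>)" for i s
  define near where "near i s s' \<longleftrightarrow> (LINT x|unit_measure. \<bar>poly s' x - poly s x\<bar>) \<le> (1 / 2) ^ Suc i / (real (top s) + 1) \<and> top s \<le> top s'"
    for i s s'
  have step: "\<exists>s'. large i' s' \<and> near i s s'" for i i' s
  proof -
    have "(1 / 2) ^ Suc i / (real (top s) + 1) > 0" by simp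
    from ex_perturbation_large_norlund_means[OF unbounded this, of "fst s" "fst (snd s)" "real i'"]
    obtain \<beta> n N where *: "(LINT x|unit_measure. \<bar>walsh_poly \<beta> n x - poly s x\<bar>) \<le> (1 / 2) ^ Suc i / (real (top s) + 1)"
      "\<forall>x\<in>{0..<1}. \<exists>k\<le>N. real i' \<le> \<bar>norlund_mean q (walsh_poly \<beta> n) k x\<bar>"
      unfolding poly_def by blast
    have "large i' (\<beta>, n, max N (top s))"
      unfolding large_def poly_def top_def using *(2) by (fastforce simp: le_max_iff_disj)
    moreover have "near i s (\<beta>, n, max N (top s))"
      unfolding near_def using *(1) by (simp add: poly_def top_def)
    ultimately show ?thesis by blast
  qed
  have "\<exists>s. \<forall>i. large i (s i) \<and> near i (s i) (s (Suc i))"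
  proof (rule dependent_nat_choice)
    show "\<exists>t. large 0 t" using step[of 0] by blast
    show "\<exists>t'. large (Suc i) t' \<and> near i t t'" for t i by (rule step)
  qed
  then obtain s where seq: "\<forall>i. large i (s i) \<and> near i (s i) (s (Suc i))" by (rule exE)
  have s: "large i (s i)" "near i (s i) (s (Suc i))" for i
    using spec[OF seq, of i] by simp_all
  have mono: "top (s i) \<le> top (s j)" if "i \<le> j" for i j
  proof (rule lift_Suc_mono_le[of "\<lambda>i. top (s i)", OF _ that])
    show "top (s i) \<le> top (s (Suc i))" for i using s(2)[of i] by (simp add: near_def)
  qed
  define c where "c i = (1 / 2) ^ Suc i / (real (top (s i)) + 1)" for i
  have half: "summable (\<lambda>i. (1 / 2 :: real) ^ Suc i)" using summable_geometric[of "1/2::real"] by (simp add: summable_mult)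
  have c_le: "c (l + i) \<le> (1 / 2) ^ Suc l * (1 / (real (top (s i)) + 1))" for l i
  proof -
    have "c (l + i) \<le> (1 / 2) ^ Suc l / (real (top (s i)) + 1)"
      unfolding c_def using mono[of i "l + i"] by (intro frac_le power_decreasing) auto
    then show ?thesis by simp
  qed
  have c0: "0 \<le> c i" for i by (simp add: c_def)
  have sum_c: "summable c"
    using c_le[of _ 0] c0 by (intro summable_comparison_test'[OF summable_mult2[OF half, of "1 / (real (top (s 0)) + 1)"], of 0]) auto
  have int_poly: "integrable unit_measure (poly t)" for t unfolding poly_def by (rule integrable_walsh_poly)
  obtain f where f: "integrable unit_measure f" "\<And>i. (LINT x|unit_measure. \<bar>f x - poly (s i) x\<bar>) \<le> (\<Sum>l. c (l + i))"
    using L1_limit_of_fast_Cauchy[of unit_measure "\<lambda>i. poly (s i)" c] int_poly s(2) sum_c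
    unfolding near_def c_def by blast
  have tail: "(\<Sum>l. c (l + i)) \<le> 1 / (real (top (s i)) + 1)" for i
  proof -
    have "(\<Sum>l. c (l + i)) \<le> (\<Sum>l. (1 / 2) ^ Suc l * (1 / (real (top (s i)) + 1)))"
      using c_le sum_c half by (intro suminf_le) (auto intro!: summable_ignore_initial_segment summable_mult2 simp del: power_Suc)
    also have "\<dots> = (\<Sum>l. (1 / 2) ^ Suc l) * (1 / (real (top (s i)) + 1))" by (rule suminf_mult2[OF half, symmetric])
    also have "(\<Sum>l. (1 / 2 :: real) ^ Suc l) = 1"
      using power_half_series by (rule sums_unique[symmetric])
    finally show ?thesis by simp
  qed
  have "\<not> convergent (\<lambda>n. norlund_mean q f n x)" if x: "x \<in> {0..<1}" for x
  proof
    assume "convergent (\<lambda>n. norlund_mean q f n x)"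
    then obtain K where K: "\<And>n. \<bar>norlund_mean q f n x\<bar> \<le> K"
      using convergent_imp_Bseq BseqE by (metis real_norm_def)
    obtain i :: nat where i: "K + 1 < real i" using reals_Archimedean2 by blast
    obtain n where n: "n \<le> top (s i)" "real i \<le> \<bar>norlund_mean q (poly (s i)) n x\<bar>"
      using s(1)[of i] x unfolding large_def by blast
    have "norlund_mean q (\<lambda>x. f x - poly (s i) x) n x = norlund_mean q f n x - norlund_mean q (poly (s i)) n x"
      by (intro norlund_mean_diff f int_poly)
    moreover have "\<bar>norlund_mean q (\<lambda>x. f x - poly (s i) x) n x\<bar> \<le> 1"
    proof -
      have "\<bar>norlund_mean q (\<lambda>x. f x - poly (s i) x) n x\<bar> \<le> real n * (LINT x|unit_measure. \<bar>f x - poly (s i) x\<bar>)"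
        using f(1) int_poly by (intro abs_norlund_mean_le_L1) auto
      also have "\<dots> \<le> real (top (s i)) * (1 / (real (top (s i)) + 1))"
        using n(1) f(2)[of i] tail[of i] by (intro mult_mono) (auto intro: integral_nonneg_AE)
      also have "\<dots> \<le> 1" by simp
      finally show ?thesis .
    qed
    ultimately show False using K[of n] i n(2) by linarith
  qed
  then show ?thesis using f(1) by blast
qed

end

lemma binary_order_exp: "binary_order (2 ^ N) = N"
  by (simp add: binary_order_def bit_exp_iff)

theorem theorem6:
  fixes q :: "nat \<Rightarrow> real"
  assumes "decseq q"
    and "\<And>n. q n \<ge> 0"
    and "\<And>n. weight_sum q n > 0"
  shows
    "((SUP n\<in>{1..}. ereal (1 / weight_sum q (2 ^ binary_order n)
          * (\<Sum>s=0..binary_order n. weight_sum q (2 ^ s)))) < \<infinity>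
      \<longrightarrow> (\<forall>f. integrable unit_measure f
            \<longrightarrow> (AE x in unit_measure. (\<lambda>n. norlund_mean q f n x) \<longlonglongrightarrow> f x)))
     \<and>
     ((SUP n\<in>{1..}. ereal (1 / weight_sum q (2 ^ binary_order n)
          * (\<Sum>s=0..binary_order n. weight_sum q (2 ^ s)))) = \<infinity>
      \<longrightarrow> (\<exists>f. integrable unit_measure f
            \<and> (\<forall>x\<in>{0..<1}. \<not> convergent (\<lambda>n. norlund_mean q f n x))))"
proof -
  interpret norlund_weights q by standard (fact assms)+
  define ratio where "ratio N = 1 / weight_sum q (2 ^ N) * (\<Sum>s=0..N. weight_sum q (2 ^ s))" for N
  have ratio_le: "ratio N \<le> K \<longleftrightarrow> (\<Sum>s\<le>N. weight_sum q (2 ^ s)) \<le> K * weight_sum q (2 ^ N)" for N K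
    using weight_pos[of "2 ^ N"] by (simp add: ratio_def atLeast0AtMost pos_divide_le_eq)
  show ?thesis
    unfolding ratio_def[symmetric]
  proof (intro conjI impI allI)
    fix f :: "real \<Rightarrow> real"
    assume "(SUP n\<in>{1..}. ereal (ratio (binary_order n))) < \<infinity>" and f: "integrable unit_measure f"
    then obtain K where K: "(SUP n\<in>{1..}. ereal (ratio (binary_order n))) \<le> ereal K"
      using ereal_dense2 less_imp_le by blast
    have "ratio N \<le> K" for N
    proof -
      have "ereal (ratio (binary_order (2 ^ N))) \<le> (SUP n\<in>{1..}. ereal (ratio (binary_order n)))"
        by (rule SUP_upper) simp
      then have "ereal (ratio (binary_order (2 ^ N))) \<le> ereal K" using K by (rule order.trans)
      then show ?thesis by (simp add: binary_order_exp)
    qed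
    then show "AE x in unit_measure. (\<lambda>n. norlund_mean q f n x) \<longlonglongrightarrow> f x"
      by (intro norlund_mean_AE_tendsto[OF _ f]) (simp add: ratio_le)
  next
    assume infinite: "(SUP n\<in>{1..}. ereal (ratio (binary_order n))) = \<infinity>"
    show "\<exists>f. integrable unit_measure f \<and> (\<forall>x\<in>{0..<1}. \<not> convergent (\<lambda>n. norlund_mean q f n x))"
    proof (rule ex_everywhere_divergent_norlund_means)
      fix K
      show "\<exists>N. K * weight_sum q (2 ^ N) < (\<Sum>s\<le>N. weight_sum q (2 ^ s))"
      proof (rule ccontr)
        assume "\<not> ?thesis"
        then have "ratio N \<le> K" for N by (simp add: ratio_le not_less)
        then have "(SUP n\<in>{1..}. ereal (ratio (binary_order n))) \<le> ereal K"
          by (intro SUP_least) simp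
        then show False using infinite by simp
      qed
    qed
  qed
qed

end
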